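(* Let $\mathcal{D}$ be a triangulated category closed with respect to small coproducts. Assume that $\mathcal{D}=\mathcal{T}^{\coprod}$, where $\mathcal{T}\subset\mathcal{D}$ is a triangulated subcategory whose objects are compact in $\mathcal{D}$, and let $D=(\mathcal{LO},\mathcal{RO})$ be a semi-orthogonal decomposition of $\mathcal{T}$. I.1. The couple $D^{\coprod}=(\mathcal{LO}^{\coprod},\mathcal{RO}^{\coprod})$ is a semi-orthogonal decomposition of $\mathcal{D}$. I.2. Assume in addition that $\mathcal{T}$ is essentially small (so that $\mathcal{D}$ is compactly generated by $\mathcal{T}$). Then $D^{\perp}_{\mathcal{D}}=(\mathcal{LO}^{\perp}_{\mathcal{D}},\mathcal{RO}^{\perp}_{\mathcal{D}})$ is a semi-orthogonal decomposition of $\mathcal{D}$ as well. Moreover, $D^{\perp}_{\mathcal{D}}$ is also $\mathcal{D}$-adjacent to $D^{\coprod}$, and $\mathcal{LO}^{\perp}_{\mathcal{D}}=\mathcal{RO}^{\coprod}$. I.3. Assume that $\mathcal{T}_0$ is a triangulated subcategory of $\mathcal{D}$ such that $D^{\perp}_{\mathcal{D}}$ restricts to a semi-orthogonal decomposition $D_0=(\mathcal{LO}_0,\mathcal{RO}_0)$ of $\mathcal{T}_0$. Then $D^{\perp}_{\mathcal{D}}$ restricts to the category $\mathcal{T}_0^{\coprod}$ as well, and this restriction equals $D_0^{\coprod}=(\mathcal{LO}_0^{\coprod},\mathcal{RO}_0^{\coprod})$. II. Assume that $\mathcal{T}$ is essentially small, $R$ is a commutative unital ring, $\mathcal{D}$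 is $R$-linear, and $\underline{A}$ is an exact abelian subcategory of the category $R\text{-Mod}^{\mathbb{Z}}$ of $\mathbb{Z}$-graded $R$-modules that is stable with respect to the obvious shifts on this category (that is, $M=\bigoplus M^i$ belongs to $\underline{A}$ if and only if the module $M[1]=\bigoplus M^{i+1}$ does). Let $\mathcal{T}_{\underline{A}}$ be the full subcategory of $\mathcal{D}$ consisting of those $N\in\operatorname{Obj}\mathcal{D}$ such that for any $M\in\operatorname{Obj}\mathcal{T}$ the graded module $S_N(M)=\bigoplus_{j}\mathcal{D}(M[-j],N)$ belongs to $\underline{A}$. II.1. Then $\mathcal{T}_{\underline{A}}$ is triangulated and the functors $L_{D^{\perp}_{\mathcal{D}}}$ and $R_{D^{\perp}_{\mathcal{D}}}$ corresponding to $D^{\perp}_{\mathcal{D}}$ send $\mathcal{T}_{\underline{A}}$ into itself. II.2. Consequently, the couple $D^{\perp}_{\mathcal{T}_{\underline{A}}}=(\mathcal{LO}^{\perp}_{\mathcal{T}_{\underline{A}}},\mathcal{RO}^{\perp}_{\mathcal{T}_{\underline{A}}})$ is a semi-orthogonal decomposition of $\mathcal{T}_{\underline{A}}$.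
   Context: All subcategories are strictly full. $\mathcal{D}(X,Y)$ denotes the set of morphisms from $X$ to $Y$ in $\mathcal{D}$. For classes of objects $E,E'$ of $\mathcal{D}$, $E\perp E'$ means $\mathcal{D}(X,Y)=\{0\}$ for all $X\in E$, $Y\in E'$. All coproducts are small. An object $M$ of $\mathcal{D}$ is compact if the functor $\mathcal{D}(M,-)$ to abelian groups respects coproducts. For a triangulated subcategory $\mathcal{T}\subset\mathcal{D}$, $\mathcal{T}^{\coprod}$ is the smallest strictly full triangulated subcategory of $\mathcal{D}$ closed with respect to $\mathcal{D}$-coproducts and containing $\mathcal{T}$. $\mathcal{T}$ compactly generates $\mathcal{D}$ if $\mathcal{T}$ is essentially small, its objects are compact in $\mathcal{D}$, and $\mathcal{D}=\mathcal{T}^{\coprod}$. For triangulated subcategories $\mathcal{T},\mathcal{T}'\subset\mathcal{D}$, $\mathcal{T}^{\perp}_{\mathcal{T}'}$ is the full subcategory of those $Y\in\operatorname{Obj}\mathcal{T}'$ with $\mathcal{D}(X,Y)=\{0\}$ for all $X\in\operatorname{Obj}\mathcal{T}$. A semi-orthogonal decomposition of a triangulated category $\mathcal{T}$ is a couple $D=(\mathcal{LO},\mathcal{RO})$ of strictly full triangulated subcategories of $\mathcal{T}$ with $\operatorname{Obj}\mathcal{LO}\perp\operatorname{Obj}\mathcal{RO}$ such that each $M\in\operatorname{Obj}\mathcal{T}$ fits into a distinguished triangle $L\to M\to R\to L[1]$ with $L\in\mathcal{LO}$, $R\in\mathcal{RO}$. Then the embedding $\mathcal{LO}\to\mathcal{T}$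 has an exact right adjoint $R_D$, and the embedding $\mathcal{RO}\to\mathcal{T}$ has a left adjoint $L_D$ (both are also viewed as functors $\mathcal{T}\to\mathcal{T}$); the triangle above is functorially determined by $M$, with $L\cong R_D(M)$ and $R\cong L_D(M)$. If $D=(\mathcal{LO},\mathcal{RO})$ is a semi-orthogonal decomposition of a triangulated subcategory $\mathcal{T}\subset\mathcal{D}$ and $\mathcal{T}'\subset\mathcal{D}$ is a triangulated subcategory, the couple $D^{\perp}_{\mathcal{T}'}=(\mathcal{LO}^{\perp}_{\mathcal{T}'},\mathcal{RO}^{\perp}_{\mathcal{T}'})$ is said to be $\mathcal{D}$-adjacent to $D$ if it is a semi-orthogonal decomposition of $\mathcal{T}'$. A semi-orthogonal decomposition $(\mathcal{LO}_{\mathcal{D}},\mathcal{RO}_{\mathcal{D}})$ of $\mathcal{D}$ restricts to a triangulated subcategory $\mathcal{T}'$ if $(\mathcal{LO}_{\mathcal{D}}\cap\mathcal{T}',\mathcal{RO}_{\mathcal{D}}\cap\mathcal{T}')$ is a semi-orthogonal decomposition of $\mathcal{T}'$; the latter couple is the restriction. An exact abelian subcategory of an abelian category is a (strictly full) subcategory that is abelian and whose embedding functor is exact.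
   Formalization: In II, "T_A is triangulated" and II.2 are stated only for A closed under extensions in R-Mod^Z; without this they fail (R=Z, D=D(Z), T perfect complexes, RO=0, A = graded groups killed by p: F_p is in T_A but its self-extension Z/p^2 is not). *)

theory Defs
  imports "HOL-Algebra.Module" "HOL-Algebra.Product_Groups"
begin

unbundle cardinal_syntax

section \<open>Smallness\<close>

text \<open>
  HOL has no distinction between sets and proper classes, so size is measured by a cardinal
  \<open>\<kappa>\<close>: a set is small if it has fewer than \<open>\<kappa>\<close> elements. Being uncountable and
  regular are the closure properties of small sets that are required of \<open>\<kappa>\<close>; the cardinal of
  a Grothendieck universe is an example.
\<close>

definition smallness_cardinal :: "'u rel \<Rightarrow> bool" where
  "smallness_cardinal \<kappa> \<longleftrightarrow> Card_order \<kappa> \<and> natLeq <o \<kappa> \<and> regularCard \<kappa>"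

definition small :: "'u rel \<Rightarrow> 'a set \<Rightarrow> bool" where
  "small \<kappa> S \<longleftrightarrow> |S| <o \<kappa>"


section \<open>Preadditive and abelian categories\<close>

text \<open>
  Morphism sets are abelian groups in the sense of \<open>abelian_group\<close>, that is with respect to
  the fields \<open>carrier\<close>, \<open>zero\<close>, \<open>add\<close> of a \<open>ring\<close> record; its
  multiplicative fields are never used. \<open>Comp C X Y Z g f\<close> is the composite
  of \<open>f : X \<rightarrow> Y\<close> and \<open>g : Y \<rightarrow> Z\<close>; since all operations are
  indexed by objects, distinct morphism sets need not be disjoint.
\<close>

record ('o, 'm) precat =
  Obj :: "'o set"
  Hom :: "'o \<Rightarrow> 'o \<Rightarrow> 'm ring"
  Id :: "'o \<Rightarrow> 'm"
  Comp :: "'o \<Rightarrow> 'o \<Rightarrow> 'o \<Rightarrow> 'm \<Rightarrow> 'm \<Rightarrow> 'm"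

abbreviation Mor :: "('o, 'm, 'x) precat_scheme \<Rightarrow> 'o \<Rightarrow> 'o \<Rightarrow> 'm set" where
  "Mor C X Y \<equiv> carrier (Hom C X Y)"

abbreviation Zero :: "('o, 'm, 'x) precat_scheme \<Rightarrow> 'o \<Rightarrow> 'o \<Rightarrow> 'm" where
  "Zero C X Y \<equiv> \<zero>\<^bsub>Hom C X Y\<^esub>"

locale preadditive_category =
  fixes C :: "('o, 'm, 'x) precat_scheme"
  assumes Hom_abelian_group:
      "\<lbrakk>X \<in> Obj C; Y \<in> Obj C\<rbrakk> \<Longrightarrow> abelian_group (Hom C X Y)"
    and Id_closed: "X \<in> Obj C \<Longrightarrow> Id C X \<in> Mor C X X"
    and Comp_closed:
      "\<lbrakk>X \<in> Obj C; Y \<in> Obj C; Z \<in> Obj C; f \<in> Mor C X Y; g \<in> Mor C Y Z\<rbrakk>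
        \<Longrightarrow> Comp C X Y Z g f \<in> Mor C X Z"
    and Comp_Id_left:
      "\<lbrakk>X \<in> Obj C; Y \<in> Obj C; f \<in> Mor C X Y\<rbrakk> \<Longrightarrow> Comp C X Y Y (Id C Y) f = f"
    and Comp_Id_right:
      "\<lbrakk>X \<in> Obj C; Y \<in> Obj C; f \<in> Mor C X Y\<rbrakk> \<Longrightarrow> Comp C X X Y f (Id C X) = f"
    and Comp_assoc:
      "\<lbrakk>W \<in> Obj C; X \<in> Obj C; Y \<in> Obj C; Z \<in> Obj C;
        f \<in> Mor C W X; g \<in> Mor C X Y; h \<in> Mor C Y Z\<rbrakk>
        \<Longrightarrow> Comp C W Y Z h (Comp C W X Y g f) = Comp C W X Z (Comp C X Y Z h g) f"
    and Comp_add_left: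
      "\<lbrakk>X \<in> Obj C; Y \<in> Obj C; Z \<in> Obj C; f \<in> Mor C X Y; g \<in> Mor C Y Z; g' \<in> Mor C Y Z\<rbrakk>
        \<Longrightarrow> Comp C X Y Z (g \<oplus>\<^bsub>Hom C Y Z\<^esub> g') f
            = Comp C X Y Z g f \<oplus>\<^bsub>Hom C X Z\<^esub> Comp C X Y Z g' f"
    and Comp_add_right:
      "\<lbrakk>X \<in> Obj C; Y \<in> Obj C; Z \<in> Obj C; f \<in> Mor C X Y; f' \<in> Mor C X Y; g \<in> Mor C Y Z\<rbrakk>
        \<Longrightarrow> Comp C X Y Z g (f \<oplus>\<^bsub>Hom C X Y\<^esub> f')
            = Comp C X Y Z g f \<oplus>\<^bsub>Hom C X Z\<^esub> Comp C X Y Z g f'"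

definition is_iso :: "('o, 'm, 'x) precat_scheme \<Rightarrow> 'o \<Rightarrow> 'o \<Rightarrow> 'm \<Rightarrow> bool" where
  "is_iso C X Y f \<longleftrightarrow> f \<in> Mor C X Y \<and>
     (\<exists>g\<in>Mor C Y X. Comp C X Y X g f = Id C X \<and> Comp C Y X Y f g = Id C Y)"

definition isomorphic :: "('o, 'm, 'x) precat_scheme \<Rightarrow> 'o \<Rightarrow> 'o \<Rightarrow> bool" where
  "isomorphic C X Y \<longleftrightarrow> (\<exists>f. is_iso C X Y f)"

definition zero_object :: "('o, 'm, 'x) precat_scheme \<Rightarrow> 'o \<Rightarrow> bool" where
  "zero_object C Z \<longleftrightarrow> Z \<in> Obj C \<and>
     (\<forall>X\<in>Obj C. Mor C X Z = {Zero C X Z} \<and> Mor C Z X = {Zero C Z X})"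

definition is_coproduct ::
  "('o, 'm, 'x) precat_scheme \<Rightarrow> 'i set \<Rightarrow> ('i \<Rightarrow> 'o) \<Rightarrow> 'o \<Rightarrow> ('i \<Rightarrow> 'm) \<Rightarrow> bool" where
  "is_coproduct C I X P \<iota> \<longleftrightarrow> P \<in> Obj C \<and> (\<forall>i\<in>I. X i \<in> Obj C \<and> \<iota> i \<in> Mor C (X i) P) \<and>
     (\<forall>Y\<in>Obj C. \<forall>f. (\<forall>i\<in>I. f i \<in> Mor C (X i) Y) \<longrightarrow>
        (\<exists>!h. h \<in> Mor C P Y \<and> (\<forall>i\<in>I. Comp C (X i) P Y h (\<iota> i) = f i)))"

text \<open>In a preadditive category finite coproducts are biproducts.\<close>

locale additive_category = preadditive_category C
  for C :: "('o, 'm, 'x) precat_scheme" +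
  assumes zero_object_exists: "\<exists>Z. zero_object C Z"
    and binary_coproduct_exists:
      "\<lbrakk>X \<in> Obj C; Y \<in> Obj C\<rbrakk>
        \<Longrightarrow> \<exists>P \<iota>. is_coproduct C (UNIV :: bool set) (\<lambda>b. if b then X else Y) P \<iota>"

definition is_mono :: "('o, 'm, 'x) precat_scheme \<Rightarrow> 'o \<Rightarrow> 'o \<Rightarrow> 'm \<Rightarrow> bool" where
  "is_mono C X Y f \<longleftrightarrow> f \<in> Mor C X Y \<and>
     (\<forall>W\<in>Obj C. \<forall>g\<in>Mor C W X. \<forall>h\<in>Mor C W X. Comp C W X Y f g = Comp C W X Y f h \<longrightarrow> g = h)"

definition is_epi :: "('o, 'm, 'x) precat_scheme \<Rightarrow> 'o \<Rightarrow> 'o \<Rightarrow> 'm \<Rightarrow> bool" where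
  "is_epi C X Y f \<longleftrightarrow> f \<in> Mor C X Y \<and>
     (\<forall>W\<in>Obj C. \<forall>g\<in>Mor C Y W. \<forall>h\<in>Mor C Y W. Comp C X Y W g f = Comp C X Y W h f \<longrightarrow> g = h)"

text \<open>\<open>k : K \<rightarrow> X\<close> is a kernel of \<open>f : X \<rightarrow> Y\<close>,
  respectively \<open>c : Y \<rightarrow> Q\<close> is a cokernel of \<open>f : X \<rightarrow> Y\<close>.\<close>

definition is_kernel ::
  "('o, 'm, 'x) precat_scheme \<Rightarrow> 'o \<Rightarrow> 'o \<Rightarrow> 'o \<Rightarrow> 'm \<Rightarrow> 'm \<Rightarrow> bool" where
  "is_kernel C K X Y k f \<longleftrightarrow> K \<in> Obj C \<and> k \<in> Mor C K X \<and> Comp C K X Y f k = Zero C K Y \<and>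
     (\<forall>W\<in>Obj C. \<forall>g\<in>Mor C W X. Comp C W X Y f g = Zero C W Y \<longrightarrow>
        (\<exists>!h. h \<in> Mor C W K \<and> Comp C W K X k h = g))"

definition is_cokernel ::
  "('o, 'm, 'x) precat_scheme \<Rightarrow> 'o \<Rightarrow> 'o \<Rightarrow> 'o \<Rightarrow> 'm \<Rightarrow> 'm \<Rightarrow> bool" where
  "is_cokernel C X Y Q f c \<longleftrightarrow> Q \<in> Obj C \<and> c \<in> Mor C Y Q \<and> Comp C X Y Q c f = Zero C X Q \<and>
     (\<forall>W\<in>Obj C. \<forall>g\<in>Mor C Y W. Comp C X Y W g f = Zero C X W \<longrightarrow>
        (\<exists>!h. h \<in> Mor C Q W \<and> Comp C Y Q W h c = g))"

locale abelian_category = additive_category C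
  for C :: "('o, 'm, 'x) precat_scheme" +
  assumes kernel_exists:
      "\<lbrakk>X \<in> Obj C; Y \<in> Obj C; f \<in> Mor C X Y\<rbrakk> \<Longrightarrow> \<exists>K k. is_kernel C K X Y k f"
    and cokernel_exists:
      "\<lbrakk>X \<in> Obj C; Y \<in> Obj C; f \<in> Mor C X Y\<rbrakk> \<Longrightarrow> \<exists>Q c. is_cokernel C X Y Q f c"
    and mono_is_kernel:
      "\<lbrakk>X \<in> Obj C; Y \<in> Obj C; is_mono C X Y f\<rbrakk>
        \<Longrightarrow> \<exists>Z\<in>Obj C. \<exists>g\<in>Mor C Y Z. is_kernel C X Y Z f g"
    and epi_is_cokernel:
      "\<lbrakk>X \<in> Obj C; Y \<in> Obj C; is_epi C X Y f\<rbrakk>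
        \<Longrightarrow> \<exists>W\<in>Obj C. \<exists>g\<in>Mor C W X. is_cokernel C W X Y g f"

definition short_exact ::
  "('o, 'm, 'x) precat_scheme \<Rightarrow> 'o \<Rightarrow> 'o \<Rightarrow> 'o \<Rightarrow> 'm \<Rightarrow> 'm \<Rightarrow> bool" where
  "short_exact C X Y Z f g \<longleftrightarrow> X \<in> Obj C \<and> Y \<in> Obj C \<and> Z \<in> Obj C \<and>
     f \<in> Mor C X Y \<and> g \<in> Mor C Y Z \<and> is_kernel C X Y Z f g \<and> is_cokernel C X Y Z f g"

text \<open>A full subcategory is given by its set of objects.\<close>

definition full_sub :: "('o, 'm, 'x) precat_scheme \<Rightarrow> 'o set \<Rightarrow> ('o, 'm, 'x) precat_scheme" where
  "full_sub C S = C\<lparr>Obj := S\<rparr>"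

definition strictly_full :: "('o, 'm, 'x) precat_scheme \<Rightarrow> 'o set \<Rightarrow> bool" where
  "strictly_full C S \<longleftrightarrow> S \<subseteq> Obj C \<and> (\<forall>X\<in>S. \<forall>Y\<in>Obj C. isomorphic C X Y \<longrightarrow> Y \<in> S)"

text \<open>The embedding of a full subcategory is additive, so it is exact if and only if it
  preserves short exact sequences.\<close>

definition exact_abelian_subcategory :: "('o, 'm, 'x) precat_scheme \<Rightarrow> 'o set \<Rightarrow> bool" where
  "exact_abelian_subcategory C S \<longleftrightarrow> strictly_full C S \<and> abelian_category (full_sub C S) \<and>
     (\<forall>X Y Z f g. short_exact (full_sub C S) X Y Z f g \<longrightarrow> short_exact C X Y Z f g)"

text \<open>
  Exact abelian subcategories need not be closed under extensions: for \<open>p\<close> prime, the abelian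
  groups annihilated by \<open>p\<close> form an exact abelian subcategory of all abelian groups.
\<close>

definition extension_closed :: "('o, 'm, 'x) precat_scheme \<Rightarrow> 'o set \<Rightarrow> bool" where
  "extension_closed C S \<longleftrightarrow>
     (\<forall>X Y Z f g. short_exact C X Y Z f g \<and> X \<in> S \<and> Z \<in> S \<longrightarrow> Y \<in> S)"


section \<open>Functors and adjunctions\<close>

type_synonym ('o, 'm, 'p, 'n) functor_data = "('o \<Rightarrow> 'p) \<times> ('o \<Rightarrow> 'o \<Rightarrow> 'm \<Rightarrow> 'n)"

definition is_functor ::
  "('o, 'm, 'x) precat_scheme \<Rightarrow> ('p, 'n, 'y) precat_scheme \<Rightarrow> ('o, 'm, 'p, 'n) functor_data \<Rightarrow> bool"
where
  "is_functor C C' F \<longleftrightarrow>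
     (\<forall>X\<in>Obj C. fst F X \<in> Obj C') \<and>
     (\<forall>X\<in>Obj C. \<forall>Y\<in>Obj C. \<forall>f\<in>Mor C X Y. snd F X Y f \<in> Mor C' (fst F X) (fst F Y)) \<and>
     (\<forall>X\<in>Obj C. snd F X X (Id C X) = Id C' (fst F X)) \<and>
     (\<forall>X\<in>Obj C. \<forall>Y\<in>Obj C. \<forall>Z\<in>Obj C. \<forall>f\<in>Mor C X Y. \<forall>g\<in>Mor C Y Z.
        snd F X Z (Comp C X Y Z g f)
        = Comp C' (fst F X) (fst F Y) (fst F Z) (snd F Y Z g) (snd F X Y f))"

text \<open>\<open>F : C \<rightarrow> C'\<close> is left adjoint to \<open>G : C' \<rightarrow> C\<close>: there
  are bijections \<open>C'(F X, Y) \<cong> C(X, G Y)\<close>, natural in \<open>X\<close> and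
  \<open>Y\<close>.\<close>

definition adjoint_functors ::
  "('o, 'm, 'x) precat_scheme \<Rightarrow> ('p, 'n, 'y) precat_scheme \<Rightarrow>
   ('o, 'm, 'p, 'n) functor_data \<Rightarrow> ('p, 'n, 'o, 'm) functor_data \<Rightarrow> bool"
where
  "adjoint_functors C C' F G \<longleftrightarrow> is_functor C C' F \<and> is_functor C' C G \<and>
     (\<exists>\<phi>. (\<forall>X\<in>Obj C. \<forall>Y\<in>Obj C'. bij_betw (\<phi> X Y) (Mor C' (fst F X) Y) (Mor C X (fst G Y))) \<and>
          (\<forall>X\<in>Obj C. \<forall>X'\<in>Obj C. \<forall>Y\<in>Obj C'. \<forall>u\<in>Mor C X' X. \<forall>h\<in>Mor C' (fst F X) Y.
             \<phi> X' Y (Comp C' (fst F X') (fst F X) Y h (snd F X' X u))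
             = Comp C X' X (fst G Y) (\<phi> X Y h) u) \<and>
          (\<forall>X\<in>Obj C. \<forall>Y\<in>Obj C'. \<forall>Y'\<in>Obj C'. \<forall>v\<in>Mor C' Y Y'. \<forall>h\<in>Mor C' (fst F X) Y.
             \<phi> X Y' (Comp C' (fst F X) Y Y' v h)
             = Comp C X (fst G Y) (fst G Y') (snd G Y Y' v) (\<phi> X Y h)))"

definition embedding :: "('o, 'm, 'o, 'm) functor_data" where
  "embedding = ((\<lambda>X. X), (\<lambda>X Y f. f))"


section \<open>Triangulated categories\<close>

text \<open>A candidate triangle \<open>X \<rightarrow> Y \<rightarrow> Z \<rightarrow> X[1]\<close> with
  morphisms \<open>f\<close>, \<open>g\<close>, \<open>h\<close> is the tuple \<open>(X, Y, Z, f, g, h)\<close>.\<close>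

record ('o, 'm) tricat = "('o, 'm) precat" +
  Shift :: "'o \<Rightarrow> 'o"
  ShiftM :: "'o \<Rightarrow> 'o \<Rightarrow> 'm \<Rightarrow> 'm"
  Tri :: "('o \<times> 'o \<times> 'o \<times> 'm \<times> 'm \<times> 'm) set"

text \<open>The axioms of Verdier; the shift is an automorphism of the category.\<close>

locale triangulated_category = additive_category D
  for D :: "('o, 'm, 'x) tricat_scheme" +
  assumes Shift_functor: "is_functor D D (Shift D, ShiftM D)"
    and Shift_bij: "bij_betw (Shift D) (Obj D) (Obj D)"
    and ShiftM_bij:
      "\<lbrakk>X \<in> Obj D; Y \<in> Obj D\<rbrakk>
        \<Longrightarrow> bij_betw (ShiftM D X Y) (Mor D X Y) (Mor D (Shift D X) (Shift D Y))"
    and ShiftM_add: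
      "\<lbrakk>X \<in> Obj D; Y \<in> Obj D; f \<in> Mor D X Y; g \<in> Mor D X Y\<rbrakk>
        \<Longrightarrow> ShiftM D X Y (f \<oplus>\<^bsub>Hom D X Y\<^esub> g)
            = ShiftM D X Y f \<oplus>\<^bsub>Hom D (Shift D X) (Shift D Y)\<^esub> ShiftM D X Y g"
    and Tri_closed:
      "(X, Y, Z, f, g, h) \<in> Tri D \<Longrightarrow>
        X \<in> Obj D \<and> Y \<in> Obj D \<and> Z \<in> Obj D \<and>
        f \<in> Mor D X Y \<and> g \<in> Mor D Y Z \<and> h \<in> Mor D Z (Shift D X)"
    and TR1_identity:
      "\<lbrakk>X \<in> Obj D; zero_object D Z\<rbrakk>
        \<Longrightarrow> (X, X, Z, Id D X, Zero D X Z, Zero D Z (Shift D X)) \<in> Tri D"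
    and TR1_isomorphic:
      "\<lbrakk>(X, Y, Z, f, g, h) \<in> Tri D; X' \<in> Obj D; Y' \<in> Obj D; Z' \<in> Obj D;
        f' \<in> Mor D X' Y'; g' \<in> Mor D Y' Z'; h' \<in> Mor D Z' (Shift D X');
        is_iso D X X' u; is_iso D Y Y' v; is_iso D Z Z' w;
        Comp D X X' Y' f' u = Comp D X Y Y' v f;
        Comp D Y Y' Z' g' v = Comp D Y Z Z' w g;
        Comp D Z Z' (Shift D X') h' w = Comp D Z (Shift D X) (Shift D X') (ShiftM D X X' u) h\<rbrakk>
        \<Longrightarrow> (X', Y', Z', f', g', h') \<in> Tri D"
    and TR1_cone:
      "\<lbrakk>X \<in> Obj D; Y \<in> Obj D; f \<in> Mor D X Y\<rbrakk> \<Longrightarrow> \<exists>Z g h. (X, Y, Z, f, g, h) \<in> Tri D"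
    and TR2:
      "\<lbrakk>X \<in> Obj D; Y \<in> Obj D; Z \<in> Obj D;
        f \<in> Mor D X Y; g \<in> Mor D Y Z; h \<in> Mor D Z (Shift D X)\<rbrakk>
        \<Longrightarrow> (X, Y, Z, f, g, h) \<in> Tri D \<longleftrightarrow>
            (Y, Z, Shift D X, g, h, \<ominus>\<^bsub>Hom D (Shift D X) (Shift D Y)\<^esub> ShiftM D X Y f) \<in> Tri D"
    and TR3:
      "\<lbrakk>(X, Y, Z, f, g, h) \<in> Tri D; (X', Y', Z', f', g', h') \<in> Tri D;
        u \<in> Mor D X X'; v \<in> Mor D Y Y';
        Comp D X X' Y' f' u = Comp D X Y Y' v f\<rbrakk>
        \<Longrightarrow> \<exists>w\<in>Mor D Z Z'.
              Comp D Y Y' Z' g' v = Comp D Y Z Z' w g \<and>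
              Comp D Z Z' (Shift D X') h' w
              = Comp D Z (Shift D X) (Shift D X') (ShiftM D X X' u) h"
    and TR4_octahedron:
      "\<lbrakk>(X, Y, Z', f, a, b) \<in> Tri D; (Y, Z, X', g, c, d) \<in> Tri D;
        (X, Z, Y', Comp D X Y Z g f, e, k) \<in> Tri D\<rbrakk>
        \<Longrightarrow> \<exists>u\<in>Mor D Z' Y'. \<exists>v\<in>Mor D Y' X'.
              (Z', Y', X', u, v, Comp D X' (Shift D Y) (Shift D Z') (ShiftM D Y Z' a) d) \<in> Tri D \<and>
              Comp D Y Z' Y' u a = Comp D Y Z Y' e g \<and>
              Comp D Z' Y' (Shift D X) k u = b \<and>
              Comp D Z Y' X' v e = c \<and>
              Comp D Y' X' (Shift D Y) d v
              = Comp D Y' (Shift D X) (Shift D Y) (ShiftM D X Y f) k"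

definition shift_by :: "('o, 'm, 'x) tricat_scheme \<Rightarrow> int \<Rightarrow> 'o \<Rightarrow> 'o" where
  "shift_by D n = (if 0 \<le> n then Shift D ^^ nat n else inv_into (Obj D) (Shift D) ^^ nat (- n))"

text \<open>Strictly full triangulated subcategories are identified with their sets of objects.\<close>

definition triangulated_subcategory :: "('o, 'm, 'x) tricat_scheme \<Rightarrow> 'o set \<Rightarrow> bool" where
  "triangulated_subcategory D S \<longleftrightarrow> strictly_full D S \<and>
     (\<forall>Z. zero_object D Z \<longrightarrow> Z \<in> S) \<and>
     (\<forall>X\<in>Obj D. Shift D X \<in> S \<longleftrightarrow> X \<in> S) \<and>
     (\<forall>X Y Z f g h. (X, Y, Z, f, g, h) \<in> Tri D \<and> X \<in> S \<and> Y \<in> S \<longrightarrow> Z \<in> S)"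

text \<open>Morphism sets of a category are sets, hence small.\<close>

definition locally_small :: "'u rel \<Rightarrow> ('o, 'm, 'x) precat_scheme \<Rightarrow> bool" where
  "locally_small \<kappa> C \<longleftrightarrow> (\<forall>X\<in>Obj C. \<forall>Y\<in>Obj C. small \<kappa> (Mor C X Y))"

text \<open>Every small set is in bijection with a set of elements of \<open>'u\<close>, so these suffice as index sets
  of small families.\<close>

definition has_small_coproducts :: "'u rel \<Rightarrow> ('o, 'm, 'x) precat_scheme \<Rightarrow> bool" where
  "has_small_coproducts \<kappa> C \<longleftrightarrow>
     (\<forall>(I :: 'u set) X. small \<kappa> I \<and> (\<forall>i\<in>I. X i \<in> Obj C) \<longrightarrow> (\<exists>P \<iota>. is_coproduct C I X P \<iota>))"

text \<open>\<open>D(M, -)\<close> respects small coproducts: the canonical map from the direct sum of the groups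
  \<open>D(M, X i)\<close> to \<open>D(M, P)\<close> is bijective.\<close>

definition compact_object :: "'u rel \<Rightarrow> ('o, 'm, 'x) precat_scheme \<Rightarrow> 'o \<Rightarrow> bool" where
  "compact_object \<kappa> C M \<longleftrightarrow> M \<in> Obj C \<and>
     (\<forall>(I :: 'u set) X P \<iota>. small \<kappa> I \<and> is_coproduct C I X P \<iota> \<longrightarrow>
        bij_betw (\<lambda>g. \<Oplus>\<^bsub>Hom C M P\<^esub>i\<in>{i \<in> I. g i \<noteq> Zero C M (X i)}. Comp C M (X i) P (\<iota> i) (g i))
          (carrier (sum_group I (\<lambda>i. add_monoid (Hom C M (X i)))))
          (Mor C M P))"

definition closed_under_coproducts :: "'u rel \<Rightarrow> ('o, 'm, 'x) precat_scheme \<Rightarrow> 'o set \<Rightarrow> bool" where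
  "closed_under_coproducts \<kappa> C S \<longleftrightarrow>
     (\<forall>(I :: 'u set) X P \<iota>. small \<kappa> I \<and> (\<forall>i\<in>I. X i \<in> S) \<and> is_coproduct C I X P \<iota> \<longrightarrow> P \<in> S)"

definition coprod_closure :: "'u rel \<Rightarrow> ('o, 'm, 'x) tricat_scheme \<Rightarrow> 'o set \<Rightarrow> 'o set" where
  "coprod_closure \<kappa> D T =
     \<Inter>{S. triangulated_subcategory D S \<and> closed_under_coproducts \<kappa> D S \<and> T \<subseteq> S}"

text \<open>In a locally small category only the isomorphism classes have to be counted.\<close>

definition essentially_small :: "'u rel \<Rightarrow> ('o, 'm, 'x) precat_scheme \<Rightarrow> 'o set \<Rightarrow> bool" where
  "essentially_small \<kappa> C T \<longleftrightarrow> (\<exists>S\<subseteq>T. small \<kappa> S \<and> (\<forall>X\<in>T. \<exists>Y\<in>S. isomorphic C X Y))"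


section \<open>Semi-orthogonal decompositions\<close>

definition orthogonal :: "('o, 'm, 'x) precat_scheme \<Rightarrow> 'o set \<Rightarrow> 'o set \<Rightarrow> bool" where
  "orthogonal C E E' \<longleftrightarrow> (\<forall>X\<in>E. \<forall>Y\<in>E'. Mor C X Y = {Zero C X Y})"

text \<open>\<open>right_perp D T' T\<close> is the right orthogonal of \<open>T\<close> inside \<open>T'\<close>.\<close>

definition right_perp :: "('o, 'm, 'x) precat_scheme \<Rightarrow> 'o set \<Rightarrow> 'o set \<Rightarrow> 'o set" where
  "right_perp C T' T = {Y \<in> T'. \<forall>X\<in>T. Mor C X Y = {Zero C X Y}}"

definition semiorthogonal_decomposition ::
  "('o, 'm, 'x) tricat_scheme \<Rightarrow> 'o set \<Rightarrow> 'o set \<times> 'o set \<Rightarrow> bool" where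
  "semiorthogonal_decomposition D T P \<longleftrightarrow>
     triangulated_subcategory D T \<and>
     triangulated_subcategory D (fst P) \<and> fst P \<subseteq> T \<and>
     triangulated_subcategory D (snd P) \<and> snd P \<subseteq> T \<and>
     orthogonal D (fst P) (snd P) \<and>
     (\<forall>M\<in>T. \<exists>L\<in>fst P. \<exists>R\<in>snd P. \<exists>f g h. (L, M, R, f, g, h) \<in> Tri D)"

definition couple_coprod ::
  "'u rel \<Rightarrow> ('o, 'm, 'x) tricat_scheme \<Rightarrow> 'o set \<times> 'o set \<Rightarrow> 'o set \<times> 'o set" where
  "couple_coprod \<kappa> D P = (coprod_closure \<kappa> D (fst P), coprod_closure \<kappa> D (snd P))"

definition couple_perp ::
  "('o, 'm, 'x) precat_scheme \<Rightarrow> 'o set \<Rightarrow> 'o set \<times> 'o set \<Rightarrow> 'o set \<times> 'o set" where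
  "couple_perp C T' P = (right_perp C T' (fst P), right_perp C T' (snd P))"

definition couple_restrict :: "'o set \<times> 'o set \<Rightarrow> 'o set \<Rightarrow> 'o set \<times> 'o set" where
  "couple_restrict P T' = (fst P \<inter> T', snd P \<inter> T')"

text \<open>The couple \<open>Q\<close> is \<open>D\<close>-adjacent to the decomposition \<open>P\<close> of
  \<open>T\<close>, as a decomposition of \<open>T'\<close>.\<close>

definition adjacent ::
  "('o, 'm, 'x) tricat_scheme \<Rightarrow> 'o set \<Rightarrow> 'o set \<times> 'o set \<Rightarrow> 'o set \<Rightarrow> 'o set \<times> 'o set \<Rightarrow> bool"
where
  "adjacent D T P T' Q \<longleftrightarrow>
     semiorthogonal_decomposition D T P \<and> triangulated_subcategory D T' \<and>
     Q = couple_perp D T' P \<and> semiorthogonal_decomposition D T' Q"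

definition restricts_to :: "('o, 'm, 'x) tricat_scheme \<Rightarrow> 'o set \<times> 'o set \<Rightarrow> 'o set \<Rightarrow> bool" where
  "restricts_to D P T' \<longleftrightarrow>
     semiorthogonal_decomposition D (Obj D) P \<and> triangulated_subcategory D T' \<and>
     semiorthogonal_decomposition D T' (couple_restrict P T')"

text \<open>The functors \<open>R_D\<close> and \<open>L_D\<close> of a decomposition \<open>P\<close> of
  \<open>T\<close> are a chosen right adjoint of the embedding of \<open>fst P\<close> and a chosen left
  adjoint of the embedding of \<open>snd P\<close> into \<open>T\<close>; adjoints are unique up to isomorphism.\<close>

definition sod_right_functor ::
  "('o, 'm, 'x) tricat_scheme \<Rightarrow> 'o set \<Rightarrow> 'o set \<times> 'o set \<Rightarrow> ('o, 'm, 'o, 'm) functor_data" where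
  "sod_right_functor D T P =
     (SOME F. adjoint_functors (full_sub D (fst P)) (full_sub D T) embedding F)"

definition sod_left_functor ::
  "('o, 'm, 'x) tricat_scheme \<Rightarrow> 'o set \<Rightarrow> 'o set \<times> 'o set \<Rightarrow> ('o, 'm, 'o, 'm) functor_data" where
  "sod_left_functor D T P =
     (SOME F. adjoint_functors (full_sub D T) (full_sub D (snd P)) F embedding)"


section \<open>Linear structures and graded modules\<close>

text \<open>\<open>s X Y\<close> is the scalar multiplication on the morphisms from \<open>X\<close> to
  \<open>Y\<close>.\<close>

definition Hom_module ::
  "('o, 'm, 'x) precat_scheme \<Rightarrow> ('o \<Rightarrow> 'o \<Rightarrow> 'r \<Rightarrow> 'm \<Rightarrow> 'm) \<Rightarrow> 'o \<Rightarrow> 'o \<Rightarrow> ('r, 'm) module" where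
  "Hom_module C s X Y = ring.extend (Hom C X Y) (module.fields (s X Y))"

text \<open>Composition is \<open>R\<close>-bilinear and, as usual for triangulated categories, the shift functor is
  \<open>R\<close>-linear.\<close>

definition linear_triangulated ::
  "('r, 'q) ring_scheme \<Rightarrow> ('o, 'm, 'x) tricat_scheme \<Rightarrow> ('o \<Rightarrow> 'o \<Rightarrow> 'r \<Rightarrow> 'm \<Rightarrow> 'm) \<Rightarrow> bool" where
  "linear_triangulated R D s \<longleftrightarrow>
     (\<forall>X\<in>Obj D. \<forall>Y\<in>Obj D. module R (Hom_module D s X Y)) \<and>
     (\<forall>X\<in>Obj D. \<forall>Y\<in>Obj D. \<forall>Z\<in>Obj D. \<forall>r\<in>carrier R. \<forall>f\<in>Mor D X Y. \<forall>g\<in>Mor D Y Z.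
        Comp D X Y Z (s Y Z r g) f = s X Z r (Comp D X Y Z g f) \<and>
        Comp D X Y Z g (s X Y r f) = s X Z r (Comp D X Y Z g f)) \<and>
     (\<forall>X\<in>Obj D. \<forall>Y\<in>Obj D. \<forall>r\<in>carrier R. \<forall>f\<in>Mor D X Y.
        ShiftM D X Y (s X Y r f) = s (Shift D X) (Shift D Y) r (ShiftM D X Y f))"

definition linear_map ::
  "('r, 'q) ring_scheme \<Rightarrow> ('r, 'a, 'x) module_scheme \<Rightarrow> ('r, 'b, 'y) module_scheme \<Rightarrow> ('a \<Rightarrow> 'b) \<Rightarrow> bool"
where
  "linear_map R M N f \<longleftrightarrow>
     f \<in> carrier M \<rightarrow> carrier N \<and>
     (\<forall>x\<in>carrier M. \<forall>y\<in>carrier M. f (x \<oplus>\<^bsub>M\<^esub> y) = f x \<oplus>\<^bsub>N\<^esub> f y) \<and>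
     (\<forall>r\<in>carrier R. \<forall>x\<in>carrier M. f (r \<odot>\<^bsub>M\<^esub> x) = r \<odot>\<^bsub>N\<^esub> f x)"

text \<open>A graded module is the family of its homogeneous components.\<close>

type_synonym ('r, 'a) graded_module = "int \<Rightarrow> ('r, 'a) module"

definition graded_module_iso ::
  "('r, 'q) ring_scheme \<Rightarrow> ('r, 'a) graded_module \<Rightarrow> ('r, 'b) graded_module \<Rightarrow> bool" where
  "graded_module_iso R G H \<longleftrightarrow>
     (\<forall>i. \<exists>f. linear_map R (G i) (H i) f \<and> bij_betw f (carrier (G i)) (carrier (H i)))"

text \<open>
  The category of graded \<open>R\<close>-modules: up to isomorphism, every small graded module
  is carried by sets of elements of \<open>'u\<close>. Morphisms are families of linear maps, made unique
  as functions by being \<open>extensional\<close>.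
\<close>

definition graded_modules ::
  "'u rel \<Rightarrow> ('r, 'q) ring_scheme \<Rightarrow> (('r, 'u) graded_module, int \<Rightarrow> 'u \<Rightarrow> 'u) precat" where
  "graded_modules \<kappa> R =
     \<lparr>Obj = {G. \<forall>i. module R (G i) \<and> small \<kappa> (carrier (G i))},
      Hom = (\<lambda>G H.
        \<lparr>carrier = {f. \<forall>i. linear_map R (G i) (H i) (f i) \<and> f i \<in> extensional (carrier (G i))},
         monoid.mult = undefined,
         one = undefined,
         zero = (\<lambda>i. \<lambda>x\<in>carrier (G i). \<zero>\<^bsub>H i\<^esub>),
         add = (\<lambda>f g i. \<lambda>x\<in>carrier (G i). f i x \<oplus>\<^bsub>H i\<^esub> g i x)\<rparr>),
      Id = (\<lambda>G i. \<lambda>x\<in>carrier (G i). x),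
      Comp = (\<lambda>G H K g f i. compose (carrier (G i)) (g i) (f i))\<rparr>"

definition shift_stable ::
  "'u rel \<Rightarrow> ('r, 'q) ring_scheme \<Rightarrow> ('r, 'u) graded_module set \<Rightarrow> bool" where
  "shift_stable \<kappa> R A \<longleftrightarrow>
     (\<forall>G\<in>Obj (graded_modules \<kappa> R). G \<in> A \<longleftrightarrow> (\<lambda>i. G (i + 1)) \<in> A)"

text \<open>The graded module \<open>S_N(M)\<close> has the component \<open>D(M[-j], N)\<close> in degree
  \<open>j\<close>.\<close>

definition graded_Hom ::
  "('o, 'm, 'x) tricat_scheme \<Rightarrow> ('o \<Rightarrow> 'o \<Rightarrow> 'r \<Rightarrow> 'm \<Rightarrow> 'm) \<Rightarrow> 'o \<Rightarrow> 'o \<Rightarrow> ('r, 'm) graded_module" where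
  "graded_Hom D s N M = (\<lambda>j. Hom_module D s (shift_by D (- j) M) N)"

text \<open>The full subcategory of those \<open>N\<close> with \<open>S_N(M)\<close> in \<open>A\<close> for all
  \<open>M\<close> in \<open>T\<close>. As \<open>A\<close> is closed under isomorphisms and its members are
  carried by \<open>'u\<close>, membership in \<open>A\<close> means being isomorphic to a member.\<close>

definition objects_with_values_in ::
  "('r, 'q) ring_scheme \<Rightarrow> ('o, 'm, 'x) tricat_scheme \<Rightarrow> ('o \<Rightarrow> 'o \<Rightarrow> 'r \<Rightarrow> 'm \<Rightarrow> 'm) \<Rightarrow>
   'o set \<Rightarrow> ('r, 'u) graded_module set \<Rightarrow> 'o set" where
  "objects_with_values_in R D s T A =
     {N \<in> Obj D. \<forall>M\<in>T. \<exists>G\<in>A. graded_module_iso R (graded_Hom D s N M) G}"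

end

theory Submission
  imports Defs
begin

text \<open>
  Since the objects of \<open>LO\<close> are compact, the right orthogonal of \<open>LO\<close> is closed under coproducts, so the localizing
  subcategories generated by \<open>LO\<close> and \<open>RO\<close> are orthogonal. For orthogonal localizing \<open>P\<close>, \<open>Q\<close> the objects \<open>M\<close>
  in a triangle \<open>L \<rightarrow> M \<rightarrow> R\<close> with \<open>L \<in> P\<close>, \<open>R \<in> Q\<close> form again a localizing subcategory; as it contains \<open>T\<close>
  (respectively \<open>T0\<close>), this yields I.1 and I.3. In I.2 the right orthogonal of \<open>LO\<close> is generated by \<open>RO\<close>, and the
  decomposition \<open>A \<rightarrow> M \<rightarrow> B\<close> is obtained from a homotopy colimit \<open>A\<close> of objects over \<open>M\<close>, in each of which
  the maps from \<open>RO\<close> that vanish in \<open>M\<close> have been killed.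

  For II, let \<open>A \<rightarrow> N \<rightarrow> B\<close> be this decomposition of \<open>N\<close> and \<open>L \<rightarrow> M \<rightarrow> R\<close> that of \<open>M \<in> T\<close>. Then
  \<open>D(M, B) \<cong> D(L, B) \<cong> D(L, N)\<close> and \<open>D(M, A) \<cong> D(R, A) \<cong> D(R, N)\<close>, so the values of \<open>A\<close> and \<open>B\<close> on \<open>T\<close>
  are values of \<open>N\<close>. Closure under extensions is used only for cones, through the five-term exact sequence.
\<close>

text \<open>The closure under coproducts is an intersection of localizing classes, so the only
  handle on it is minimality: statements about it are put as inclusions into classes that are shown
  to be localizing. This is why coproducts of triangles have to be understood. The equality of the
  right orthogonal of \<open>LO\<close> with the closure of \<open>RO\<close> follows from I.1,
  since a decomposition determines its second half as an orthogonal. It reduces I.2 to one Bousfield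
  localization, at the compact objects of \<open>RO\<close>. A countable tower suffices there,
  because a map from a compact object to a homotopy colimit comes from a finite stage; essential
  smallness and small morphism sets keep the coproducts in the tower small. In II the obstacle is
  one of encoding: morphism groups and members of \<open>A\<close> live over different types, and
  the hypothesis on \<open>A\<close> is categorical, so kernels and cokernels have to be turned into
  statements on elements and back. The adjoints are arbitrary choices, known only up to
  isomorphism.\<close>

lemma (in abelian_group) add_minus_cancel:
  assumes "x \<in> carrier G" "y \<in> carrier G"
  shows "y \<oplus> (x \<ominus> y) = x"
proof -
  have "y \<oplus> (x \<ominus> y) = x \<oplus> (y \<oplus> \<ominus> y)"
    unfolding a_minus_def using assms by (intro a_lcomm) auto
  then show ?thesis using assms by (simp add: r_neg)
qed

lemma (in abelian_group) minus_eq_zero_iff: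
  assumes "x \<in> carrier G" "y \<in> carrier G"
  shows "x \<ominus> y = \<zero> \<longleftrightarrow> x = y"
  using add_minus_cancel[OF assms] assms by (auto simp: a_minus_def r_neg)

section \<open>Calculus of morphisms in a preadditive category\<close>

context preadditive_category
begin

text \<open>The typing of an arrow carries the membership of both its ends, so that most laws need
  only typings of arrows as side conditions.\<close>

definition Ar :: "'o \<Rightarrow> 'o \<Rightarrow> 'm set" where
  "Ar X Y = {f. X \<in> Obj C \<and> Y \<in> Obj C \<and> f \<in> Mor C X Y}"

abbreviation diff :: "'o \<Rightarrow> 'o \<Rightarrow> 'm \<Rightarrow> 'm \<Rightarrow> 'm" where
  "diff X Y f g \<equiv> f \<ominus>\<^bsub>Hom C X Y\<^esub> g"

abbreviation plus :: "'o \<Rightarrow> 'o \<Rightarrow> 'm \<Rightarrow> 'm \<Rightarrow> 'm" where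
  "plus X Y f g \<equiv> f \<oplus>\<^bsub>Hom C X Y\<^esub> g"

abbreviation neg :: "'o \<Rightarrow> 'o \<Rightarrow> 'm \<Rightarrow> 'm" where
  "neg X Y f \<equiv> \<ominus>\<^bsub>Hom C X Y\<^esub> f"

lemma Ar_obj: "f \<in> Ar X Y \<Longrightarrow> X \<in> Obj C \<and> Y \<in> Obj C"
  by (simp add: Ar_def)

lemma Ar_Mor: "X \<in> Obj C \<Longrightarrow> Y \<in> Obj C \<Longrightarrow> Mor C X Y = Ar X Y"
  by (auto simp: Ar_def)

lemma Ar_abelian: "f \<in> Ar X Y \<Longrightarrow> abelian_group (Hom C X Y)"
  by (simp add: Ar_def Hom_abelian_group)

lemma Zero_Ar [simp, intro]: "X \<in> Obj C \<Longrightarrow> Y \<in> Obj C \<Longrightarrow> Zero C X Y \<in> Ar X Y"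
  using Hom_abelian_group[of X Y] by (simp add: Ar_def abelian_group.axioms(1) abelian_monoid.zero_closed)

lemma Id_Ar [simp, intro]: "X \<in> Obj C \<Longrightarrow> Id C X \<in> Ar X X"
  by (simp add: Ar_def Id_closed)

lemma comp_Ar [simp, intro]: "f \<in> Ar X Y \<Longrightarrow> g \<in> Ar Y Z \<Longrightarrow> Comp C X Y Z g f \<in> Ar X Z"
  by (simp add: Ar_def Comp_closed)

lemma plus_Ar [simp, intro]: "f \<in> Ar X Y \<Longrightarrow> g \<in> Ar X Y \<Longrightarrow> plus X Y f g \<in> Ar X Y"
  by (simp add: Ar_def Hom_abelian_group abelian_group.axioms(1) abelian_monoid.a_closed)

lemma neg_Ar [simp, intro]: "f \<in> Ar X Y \<Longrightarrow> neg X Y f \<in> Ar X Y"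
  by (simp add: Ar_def Hom_abelian_group abelian_group.a_inv_closed)

lemma diff_Ar [simp, intro]: "f \<in> Ar X Y \<Longrightarrow> g \<in> Ar X Y \<Longrightarrow> diff X Y f g \<in> Ar X Y"
  by (simp add: Ar_def Hom_abelian_group abelian_group.minus_closed)

lemma comp_Id_left [simp]: "f \<in> Ar X Y \<Longrightarrow> Comp C X Y Y (Id C Y) f = f"
  by (simp add: Ar_def Comp_Id_left)

lemma comp_Id_right [simp]: "f \<in> Ar X Y \<Longrightarrow> Comp C X X Y f (Id C X) = f"
  by (simp add: Ar_def Comp_Id_right)

lemma assoc: "f \<in> Ar W X \<Longrightarrow> g \<in> Ar X Y \<Longrightarrow> h \<in> Ar Y Z \<Longrightarrow>
  Comp C W X Z (Comp C X Y Z h g) f = Comp C W Y Z h (Comp C W X Y g f)"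
  by (simp add: Ar_def Comp_assoc)

lemma comp_plus_left: "f \<in> Ar X Y \<Longrightarrow> g \<in> Ar Y Z \<Longrightarrow> g' \<in> Ar Y Z \<Longrightarrow>
  Comp C X Y Z (plus Y Z g g') f = plus X Z (Comp C X Y Z g f) (Comp C X Y Z g' f)"
  by (simp add: Ar_def Comp_add_left)

lemma comp_plus_right: "f \<in> Ar X Y \<Longrightarrow> f' \<in> Ar X Y \<Longrightarrow> g \<in> Ar Y Z \<Longrightarrow>
  Comp C X Y Z g (plus X Y f f') = plus X Z (Comp C X Y Z g f) (Comp C X Y Z g f')"
  by (simp add: Ar_def Comp_add_right)

lemma plus_zero [simp]: "f \<in> Ar X Y \<Longrightarrow> plus X Y f (Zero C X Y) = f"
  "f \<in> Ar X Y \<Longrightarrow> plus X Y (Zero C X Y) f = f"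
  by (simp_all add: Ar_def Hom_abelian_group abelian_group.axioms(1)
      abelian_monoid.l_zero abelian_monoid.r_zero)

text \<open>An additive map sends zero to an element equal to its own double; this is how
  composition and the shift are shown to preserve zero.\<close>

lemma plus_idem_zero: "f \<in> Ar X Y \<Longrightarrow> plus X Y f f = f \<Longrightarrow> f = Zero C X Y"
proof -
  assume f: "f \<in> Ar X Y" and e: "plus X Y f f = f"
  interpret abelian_group "Hom C X Y" by (rule Ar_abelian[OF f])
  show ?thesis using f e unfolding Ar_def
    by (metis (no_types, lifting) add.r_cancel_one mem_Collect_eq)
qed

lemma comp_zero_left [simp]:
  assumes "f \<in> Ar X Y" "Z \<in> Obj C" shows "Comp C X Y Z (Zero C Y Z) f = Zero C X Z"
proof -
  have "Y \<in> Obj C" using assms Ar_obj by blast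
  then have z: "Zero C Y Z \<in> Ar Y Z" using assms by simp
  show ?thesis
    using comp_plus_left[OF assms(1) z z] z assms by (intro plus_idem_zero comp_Ar) auto
qed

lemma comp_zero_right [simp]:
  assumes "g \<in> Ar Y Z" "X \<in> Obj C" shows "Comp C X Y Z g (Zero C X Y) = Zero C X Z"
proof -
  have "Y \<in> Obj C" using assms Ar_obj by blast
  then have z: "Zero C X Y \<in> Ar X Y" using assms by simp
  show ?thesis
    using comp_plus_right[OF z z assms(1)] z assms by (intro plus_idem_zero comp_Ar) auto
qed

lemma neg_unique:
  assumes "f \<in> Ar X Y" "g \<in> Ar X Y" "plus X Y f g = Zero C X Y"
  shows "g = neg X Y f"
proof -
  interpret abelian_group "Hom C X Y" by (rule Ar_abelian[OF assms(1)])
  have fg: "f \<in> carrier (Hom C X Y)" "g \<in> carrier (Hom C X Y)" using assms by (auto simp: Ar_def)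
  have "plus X Y g f = Zero C X Y" using a_comm[OF fg] assms(3) by simp
  from minus_equality[OF this fg] show ?thesis by simp
qed

lemma plus_neg [simp]: "f \<in> Ar X Y \<Longrightarrow> plus X Y f (neg X Y f) = Zero C X Y"
  by (simp add: Ar_def Hom_abelian_group abelian_group.r_neg)

lemma diff_plus_neg: "diff X Y f g = plus X Y f (neg X Y g)"
  by (simp add: a_minus_def)

lemma comp_neg_left:
  assumes "f \<in> Ar X Y" "g \<in> Ar Y Z"
  shows "Comp C X Y Z (neg Y Z g) f = neg X Z (Comp C X Y Z g f)"
proof -
  have "X \<in> Obj C" "Y \<in> Obj C" "Z \<in> Obj C" using assms Ar_obj by auto
  then show ?thesis using assms
    by (intro neg_unique) (auto simp: comp_plus_left[symmetric])
qed

lemma comp_neg_right: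
  assumes "f \<in> Ar X Y" "g \<in> Ar Y Z"
  shows "Comp C X Y Z g (neg X Y f) = neg X Z (Comp C X Y Z g f)"
proof -
  have "X \<in> Obj C" "Y \<in> Obj C" "Z \<in> Obj C" using assms Ar_obj by auto
  then show ?thesis using assms
    by (intro neg_unique) (auto simp: comp_plus_right[symmetric])
qed

lemma comp_diff_left: "f \<in> Ar X Y \<Longrightarrow> g \<in> Ar Y Z \<Longrightarrow> g' \<in> Ar Y Z \<Longrightarrow>
  Comp C X Y Z (diff Y Z g g') f = diff X Z (Comp C X Y Z g f) (Comp C X Y Z g' f)"
  by (simp add: diff_plus_neg comp_plus_left comp_neg_left)

lemma comp_diff_right: "f \<in> Ar X Y \<Longrightarrow> f' \<in> Ar X Y \<Longrightarrow> g \<in> Ar Y Z \<Longrightarrow>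
  Comp C X Y Z g (diff X Y f f') = diff X Z (Comp C X Y Z g f) (Comp C X Y Z g f')"
  by (simp add: diff_plus_neg comp_plus_right comp_neg_right)

lemma diff_eq_zero [simp]:
  assumes "f \<in> Ar X Y" "g \<in> Ar X Y"
  shows "diff X Y f g = Zero C X Y \<longleftrightarrow> f = g"
proof -
  interpret abelian_group "Hom C X Y" by (rule Ar_abelian[OF assms(1)])
  show ?thesis using assms unfolding Ar_def by (intro minus_eq_zero_iff) auto
qed

lemma neg_zero_iff [simp]:
  assumes "f \<in> Ar X Y" shows "neg X Y f = Zero C X Y \<longleftrightarrow> f = Zero C X Y"
proof -
  have o: "X \<in> Obj C" "Y \<in> Obj C" using assms Ar_obj by auto
  have "plus X Y (Zero C X Y) (Zero C X Y) = Zero C X Y" using o by simp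
  then have "neg X Y (Zero C X Y) = Zero C X Y"
    using neg_unique[of "Zero C X Y" X Y "Zero C X Y"] o by simp
  moreover have "f = Zero C X Y" if "neg X Y f = Zero C X Y"
    using plus_neg[OF assms] that assms by simp
  ultimately show ?thesis by blast
qed

lemma neg_zero [simp]: "X \<in> Obj C \<Longrightarrow> Y \<in> Obj C \<Longrightarrow> neg X Y (Zero C X Y) = Zero C X Y"
  by simp

lemma neg_neg [simp]: "f \<in> Ar X Y \<Longrightarrow> neg X Y (neg X Y f) = f"
  by (simp add: Ar_def Hom_abelian_group abelian_group.minus_minus)

lemma plus_diff_cancel: "f \<in> Ar X Y \<Longrightarrow> g \<in> Ar X Y \<Longrightarrow> plus X Y g (diff X Y f g) = f"
  by (simp add: Ar_def Hom_abelian_group abelian_group.add_minus_cancel)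

lemma Mor_zero_iff:
  "X \<in> Obj C \<Longrightarrow> Y \<in> Obj C \<Longrightarrow> Mor C X Y = {Zero C X Y} \<longleftrightarrow> (\<forall>f\<in>Ar X Y. f = Zero C X Y)"
  using Zero_Ar[of X Y] by (auto simp: Ar_def)

lemma is_iso_Ar: "X \<in> Obj C \<Longrightarrow> Y \<in> Obj C \<Longrightarrow> is_iso C X Y f \<longleftrightarrow> f \<in> Ar X Y \<and>
     (\<exists>g\<in>Ar Y X. Comp C X Y X g f = Id C X \<and> Comp C Y X Y f g = Id C Y)"
  by (auto simp: is_iso_def Ar_def)

lemma is_isoI: "f \<in> Ar X Y \<Longrightarrow> g \<in> Ar Y X \<Longrightarrow> Comp C X Y X g f = Id C X \<Longrightarrow>
    Comp C Y X Y f g = Id C Y \<Longrightarrow> is_iso C X Y f"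
  by (auto simp: is_iso_def Ar_def)

lemma Id_iso: "X \<in> Obj C \<Longrightarrow> is_iso C X X (Id C X)"
  by (rule is_isoI[of _ _ _ "Id C X"]) auto

text \<open>Meant for triangles, where the two one-sided inverses come from different exact
  sequences and are not given as the same morphism.\<close>

lemma iso_left_right_inverse:
  assumes "f \<in> Ar X Y" "g \<in> Ar Y X" "g' \<in> Ar Y X"
    "Comp C X Y X g f = Id C X" "Comp C Y X Y f g' = Id C Y"
  shows "is_iso C X Y f"
proof -
  have "g = g'"
    using assoc[OF assms(3,1,2)] assms by simp
  then show ?thesis using assms is_isoI by blast
qed

lemma isomorphic_sym:
  assumes "X \<in> Obj C" "Y \<in> Obj C" "isomorphic C X Y" shows "isomorphic C Y X"
  using assms by (auto simp: isomorphic_def is_iso_Ar)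

lemma zero_object_Ar: "zero_object C Z \<longleftrightarrow> Z \<in> Obj C \<and>
   (\<forall>X\<in>Obj C. (\<forall>f\<in>Ar X Z. f = Zero C X Z) \<and> (\<forall>f\<in>Ar Z X. f = Zero C Z X))"
  unfolding zero_object_def using Mor_zero_iff by metis

lemma zero_objectI:
  assumes "Z \<in> Obj C" "Id C Z = Zero C Z Z" shows "zero_object C Z"
  unfolding zero_object_Ar
proof (intro conjI ballI)
  fix X f assume X: "X \<in> Obj C"
  show "f = Zero C X Z" if f: "f \<in> Ar X Z"
    using comp_Id_left[OF f] assms X f by simp
  show "f = Zero C Z X" if f: "f \<in> Ar Z X"
    using comp_Id_right[OF f] assms X f by simp
qed (fact assms)

section \<open>Coproducts\<close>

lemma coproduct_Ar:
  assumes "is_coproduct C I X P \<iota>"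
  shows "P \<in> Obj C" "i \<in> I \<Longrightarrow> \<iota> i \<in> Ar (X i) P"
  using assms by (auto simp: is_coproduct_def Ar_def)

lemma coproduct_exists_map:
  assumes "is_coproduct C I X P \<iota>" "Y \<in> Obj C" "\<And>i. i \<in> I \<Longrightarrow> f i \<in> Ar (X i) Y"
  shows "\<exists>h\<in>Ar P Y. \<forall>i\<in>I. Comp C (X i) P Y h (\<iota> i) = f i"
proof -
  have "\<forall>i\<in>I. f i \<in> Mor C (X i) Y" using assms by (auto simp: Ar_def)
  then obtain h where "h \<in> Mor C P Y" "\<forall>i\<in>I. Comp C (X i) P Y h (\<iota> i) = f i"
    using assms(1,2) unfolding is_coproduct_def by metis
  then show ?thesis using assms(2) coproduct_Ar[OF assms(1)] by (auto simp: Ar_def)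
qed

lemma coproduct_map_eq:
  assumes c: "is_coproduct C I X P \<iota>" and h: "h \<in> Ar P Y" "h' \<in> Ar P Y"
    and eq: "\<And>i. i \<in> I \<Longrightarrow> Comp C (X i) P Y h (\<iota> i) = Comp C (X i) P Y h' (\<iota> i)"
  shows "h = h'"
proof -
  have Y: "Y \<in> Obj C" "h \<in> Mor C P Y" "h' \<in> Mor C P Y" using h by (auto simp: Ar_def)
  have "Comp C (X i) P Y h (\<iota> i) \<in> Ar (X i) Y" if "i \<in> I" for i
    using coproduct_Ar(2)[OF c that] h(1) by (rule comp_Ar)
  then have f: "\<forall>i\<in>I. Comp C (X i) P Y h (\<iota> i) \<in> Mor C (X i) Y"
    by (simp add: Ar_def)
  have "\<exists>!k. k \<in> Mor C P Y \<and> (\<forall>i\<in>I. Comp C (X i) P Y k (\<iota> i) = Comp C (X i) P Y h (\<iota> i))"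
    using c f Y(1) unfolding is_coproduct_def by (elim conjE) (drule (1) bspec, drule spec, erule (1) mp)
  moreover have "h \<in> Mor C P Y \<and> (\<forall>i\<in>I. Comp C (X i) P Y h (\<iota> i) = Comp C (X i) P Y h (\<iota> i))"
    using Y by simp
  moreover have "h' \<in> Mor C P Y \<and> (\<forall>i\<in>I. Comp C (X i) P Y h' (\<iota> i) = Comp C (X i) P Y h (\<iota> i))"
    using Y eq by simp
  ultimately show ?thesis by (blast elim: ex1E)
qed

lemma is_coproductI:
  assumes "P \<in> Obj C" "\<And>i. i \<in> I \<Longrightarrow> \<iota> i \<in> Ar (X i) P"
    and ex: "\<And>Y f. Y \<in> Obj C \<Longrightarrow> (\<And>i. i \<in> I \<Longrightarrow> f i \<in> Ar (X i) Y) \<Longrightarrow>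
      \<exists>h\<in>Ar P Y. \<forall>i\<in>I. Comp C (X i) P Y h (\<iota> i) = f i"
    and un: "\<And>Y h h'. h \<in> Ar P Y \<Longrightarrow> h' \<in> Ar P Y \<Longrightarrow>
      (\<And>i. i \<in> I \<Longrightarrow> Comp C (X i) P Y h (\<iota> i) = Comp C (X i) P Y h' (\<iota> i)) \<Longrightarrow> h = h'"
  shows "is_coproduct C I X P \<iota>"
  unfolding is_coproduct_def
proof (intro conjI allI impI ballI)
  fix Y f assume Y: "Y \<in> Obj C" and f: "\<forall>i\<in>I. f i \<in> Mor C (X i) Y"
  have "\<And>i. i \<in> I \<Longrightarrow> f i \<in> Ar (X i) Y" using f assms(2) Y by (auto simp: Ar_def)
  from ex[OF Y this] obtain h where h: "h \<in> Ar P Y" "\<forall>i\<in>I. Comp C (X i) P Y h (\<iota> i) = f i" by blast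
  show "\<exists>!h. h \<in> Mor C P Y \<and> (\<forall>i\<in>I. Comp C (X i) P Y h (\<iota> i) = f i)"
  proof (intro ex1I conjI)
    show "h \<in> Mor C P Y" using h by (simp add: Ar_def)
    fix k assume k: "k \<in> Mor C P Y \<and> (\<forall>i\<in>I. Comp C (X i) P Y k (\<iota> i) = f i)"
    then have "k \<in> Ar P Y" using assms(1) Y by (simp add: Ar_def)
    then show "k = h" using un[of k Y h] h k by auto
  qed (use h in auto)
qed (use assms in \<open>auto simp: Ar_def\<close>)

text \<open>Small coproducts and compactness are defined with index sets in \<open>'u\<close>. This
  lemma and its converse carry coproducts over sets of other types, such as natural numbers or pairs
  of an object and a map, to such index sets and back.\<close>

lemma coproduct_reindex:
  assumes "is_coproduct C I X P \<iota>" "inj_on e I"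
  shows "is_coproduct C (e ` I) (\<lambda>j. X (inv_into I e j)) P (\<lambda>j. \<iota> (inv_into I e j))"
proof (rule is_coproductI)
  show "P \<in> Obj C" by (rule coproduct_Ar[OF assms(1)])
  show "\<iota> (inv_into I e i) \<in> Ar (X (inv_into I e i)) P" if "i \<in> e ` I" for i
    using that coproduct_Ar(2)[OF assms(1)] by (simp add: inv_into_into)
  show "\<exists>h\<in>Ar P Y. \<forall>i\<in>e ` I. Comp C (X (inv_into I e i)) P Y h (\<iota> (inv_into I e i)) = f i"
    if Y: "Y \<in> Obj C" and f: "\<And>i. i \<in> e ` I \<Longrightarrow> f i \<in> Ar (X (inv_into I e i)) Y" for Y f
  proof -
    have "f (e i) \<in> Ar (X i) Y" if "i \<in> I" for i
      using f[of "e i"] that assms(2) by simp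
    then obtain h where "h \<in> Ar P Y" "\<forall>i\<in>I. Comp C (X i) P Y h (\<iota> i) = f (e i)"
      using coproduct_exists_map[OF assms(1) Y, of "\<lambda>i. f (e i)"] by blast
    then show ?thesis using assms(2) by auto
  qed
  show "h = h'" if "h \<in> Ar P Y" "h' \<in> Ar P Y"
    "\<And>i. i \<in> e ` I \<Longrightarrow> Comp C (X (inv_into I e i)) P Y h (\<iota> (inv_into I e i))
       = Comp C (X (inv_into I e i)) P Y h' (\<iota> (inv_into I e i))" for Y h h'
  proof (rule coproduct_map_eq[OF assms(1) that(1,2)])
    show "Comp C (X i) P Y h (\<iota> i) = Comp C (X i) P Y h' (\<iota> i)" if "i \<in> I" for i
      using \<open>\<And>i. i \<in> e ` I \<Longrightarrow> Comp C _ P Y h _ = _\<close>[of "e i"] that assms(2) by simp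
  qed
qed

lemma coproduct_reindex_inverse:
  assumes "is_coproduct C (e ` I) (\<lambda>j. X (inv_into I e j)) P \<iota>" "inj_on e I"
  shows "is_coproduct C I X P (\<lambda>i. \<iota> (e i))"
proof (rule is_coproductI)
  show "P \<in> Obj C" by (rule coproduct_Ar[OF assms(1)])
  show "\<iota> (e i) \<in> Ar (X i) P" if "i \<in> I" for i
    using that coproduct_Ar(2)[OF assms(1), of "e i"] assms(2) by simp
  show "\<exists>h\<in>Ar P Y. \<forall>i\<in>I. Comp C (X i) P Y h (\<iota> (e i)) = f i"
    if Y: "Y \<in> Obj C" and f: "\<And>i. i \<in> I \<Longrightarrow> f i \<in> Ar (X i) Y" for Y f
  proof -
    have "f (inv_into I e i) \<in> Ar (X (inv_into I e i)) Y" if "i \<in> e ` I" for i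
      using f that by (simp add: inv_into_into)
    then obtain h where "h \<in> Ar P Y"
      "\<forall>i\<in>e ` I. Comp C (X (inv_into I e i)) P Y h (\<iota> i) = f (inv_into I e i)"
      using coproduct_exists_map[OF assms(1) Y, of "\<lambda>i. f (inv_into I e i)"] by blast
    then show ?thesis using assms(2) by auto
  qed
  show "h = h'" if "h \<in> Ar P Y" "h' \<in> Ar P Y"
    "\<And>i. i \<in> I \<Longrightarrow> Comp C (X i) P Y h (\<iota> (e i)) = Comp C (X i) P Y h' (\<iota> (e i))" for Y h h'
  proof (rule coproduct_map_eq[OF assms(1) that(1,2)])
    show "Comp C (X (inv_into I e j)) P Y h (\<iota> j) = Comp C (X (inv_into I e j)) P Y h' (\<iota> j)"
      if "j \<in> e ` I" for j
      using \<open>\<And>i. i \<in> I \<Longrightarrow> Comp C _ P Y h _ = _\<close>[of "inv_into I e j"] that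
      by (simp add: inv_into_into f_inv_into_f)
  qed
qed

end

section \<open>Exact sequences in triangulated categories\<close>

context triangulated_category
begin

abbreviation S :: "'o \<Rightarrow> 'o" where "S \<equiv> Shift D"
abbreviation SM :: "'o \<Rightarrow> 'o \<Rightarrow> 'm \<Rightarrow> 'm" where "SM \<equiv> ShiftM D"
abbreviation tsub :: "'o set \<Rightarrow> bool" where "tsub \<equiv> triangulated_subcategory D"
abbreviation rperp :: "'o set \<Rightarrow> 'o set" where "rperp \<equiv> right_perp D (Obj D)"
abbreviation sod :: "'o set \<Rightarrow> 'o set \<times> 'o set \<Rightarrow> bool" where "sod \<equiv> semiorthogonal_decomposition D"

lemma Shift_obj [simp, intro]: "X \<in> Obj D \<Longrightarrow> S X \<in> Obj D"
  using Shift_bij by (auto simp: bij_betw_def)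

lemma Shift_surj: "Y \<in> Obj D \<Longrightarrow> \<exists>X\<in>Obj D. S X = Y"
  using Shift_bij by (metis bij_betw_def imageE)

lemma SM_Ar [simp, intro]: "f \<in> Ar X Y \<Longrightarrow> SM X Y f \<in> Ar (S X) (S Y)"
  using ShiftM_bij[of X Y] by (auto simp: Ar_def bij_betw_def)

lemma SM_inj: "f \<in> Ar X Y \<Longrightarrow> g \<in> Ar X Y \<Longrightarrow> SM X Y f = SM X Y g \<longleftrightarrow> f = g"
  using ShiftM_bij[of X Y] by (auto simp: Ar_def bij_betw_def dest: inj_onD)

lemma SM_surj:
  assumes "k \<in> Ar (S X) (S Y)" "X \<in> Obj D" "Y \<in> Obj D" shows "\<exists>f\<in>Ar X Y. SM X Y f = k"
proof -
  have "k \<in> SM X Y ` Mor D X Y"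
    using ShiftM_bij[OF assms(2,3)] assms(1) by (auto simp: Ar_def bij_betw_def)
  then show ?thesis using assms by (auto simp: Ar_def)
qed

lemma SM_Id [simp]: "X \<in> Obj D \<Longrightarrow> SM X X (Id D X) = Id D (S X)"
  using Shift_functor by (simp add: is_functor_def)

lemma SM_comp: "f \<in> Ar X Y \<Longrightarrow> g \<in> Ar Y Z \<Longrightarrow>
  SM X Z (Comp D X Y Z g f) = Comp D (S X) (S Y) (S Z) (SM Y Z g) (SM X Y f)"
  using Shift_functor by (simp add: is_functor_def Ar_def)

lemma SM_plus: "f \<in> Ar X Y \<Longrightarrow> g \<in> Ar X Y \<Longrightarrow>
  SM X Y (plus X Y f g) = plus (S X) (S Y) (SM X Y f) (SM X Y g)"
  by (simp add: Ar_def ShiftM_add)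

lemma SM_zero [simp]: "X \<in> Obj D \<Longrightarrow> Y \<in> Obj D \<Longrightarrow> SM X Y (Zero D X Y) = Zero D (S X) (S Y)"
  using SM_plus[of "Zero D X Y" X Y "Zero D X Y"] by (intro plus_idem_zero) auto

lemma SM_eq_zero: "f \<in> Ar X Y \<Longrightarrow> SM X Y f = Zero D (S X) (S Y) \<longleftrightarrow> f = Zero D X Y"
  using SM_inj[of f X Y "Zero D X Y"] Ar_obj[of f X Y] by simp

lemma Tri_Ar:
  assumes "(X, Y, Z, f, g, h) \<in> Tri D"
  shows "f \<in> Ar X Y" "g \<in> Ar Y Z" "h \<in> Ar Z (S X)"
  using Tri_closed[OF assms] by (auto simp: Ar_def)

lemma Tri_obj:
  assumes "(X, Y, Z, f, g, h) \<in> Tri D"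
  shows "X \<in> Obj D" "Y \<in> Obj D" "Z \<in> Obj D"
  using Tri_closed[OF assms] by auto

lemma rotate:
  assumes "(X, Y, Z, f, g, h) \<in> Tri D"
  shows "(Y, Z, S X, g, h, neg (S X) (S Y) (SM X Y f)) \<in> Tri D"
  using TR2[of X Y Z f g h] Tri_closed[OF assms] assms by simp

lemma rotate_inverse:
  assumes "(X, Y, Z, f, g, h) \<in> Tri D"
  shows "\<exists>W k. S W = Z \<and> (W, X, Y, k, f, g) \<in> Tri D"
proof -
  note t = Tri_closed[OF assms] Tri_Ar[OF assms]
  obtain W where W: "W \<in> Obj D" "S W = Z" using Shift_surj t by blast
  \<comment> \<open>The sign is chosen against the one in TR2: rotating the new triangle must return
    \<open>h\<close> itself, so \<open>k\<close> desuspends the negative of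
    \<open>h\<close>.\<close>
  have "neg (S W) (S X) h \<in> Ar (S W) (S X)" using t W by auto
  then obtain k where k: "k \<in> Ar W X" "SM W X k = neg (S W) (S X) h"
    using SM_surj[of _ W X] W t by blast
  have "(W, X, Y, k, f, g) \<in> Tri D \<longleftrightarrow> (X, Y, S W, f, g, neg (S W) (S X) (SM W X k)) \<in> Tri D"
    using W k t by (intro TR2) (auto simp: Ar_def)
  moreover have "neg (S W) (S X) (SM W X k) = h"
    unfolding k using t W by simp
  ultimately show ?thesis using assms W by auto
qed

lemma zero_object_Shift: assumes "zero_object D Z" shows "zero_object D (S Z)"
proof -
  have Z: "Z \<in> Obj D" using assms by (simp add: zero_object_def)
  then have "Id D Z = Zero D Z Z" using assms by (simp add: zero_object_Ar)
  then have "SM Z Z (Id D Z) = SM Z Z (Zero D Z Z)" by simp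
  then show ?thesis using Z by (intro zero_objectI) auto
qed

lemma Tri_identity_rotated:
  assumes "W \<in> Obj D" "zero_object D Z0"
  shows "(Z0, W, W, Zero D Z0 W, Id D W, Zero D W (S Z0)) \<in> Tri D"
proof -
  have Z: "Z0 \<in> Obj D" using assms by (simp add: zero_object_def)
  have "(W, W, S Z0, Id D W, Zero D W (S Z0), Zero D (S Z0) (S W)) \<in> Tri D"
    using TR1_identity[OF assms(1) zero_object_Shift[OF assms(2)]] .
  moreover have "neg (S Z0) (S W) (SM Z0 W (Zero D Z0 W)) = Zero D (S Z0) (S W)"
    using Z assms by simp
  ultimately show ?thesis
    using TR2[of Z0 W W "Zero D Z0 W" "Id D W" "Zero D W (S Z0)"] Z assms Zero_Ar Id_Ar
    by (simp add: Ar_Mor)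
qed

text \<open>Exactness of \<open>D(W, -)\<close> at \<open>Y\<close>. TR3 maps the rotated trivial
  triangle from \<open>W\<close> through zero to \<open>S W\<close> into the rotated given one; its
  fill-in from \<open>S W\<close> to \<open>S X\<close> desuspends to the lift, and the signs of the
  two rotations cancel.\<close>

lemma Tri_lift:
  assumes t: "(X, Y, Z, f, g, h) \<in> Tri D"
    and y: "y \<in> Ar W Y" and gy: "Comp D W Y Z g y = Zero D W Z"
  shows "\<exists>x\<in>Ar W X. Comp D W X Y f x = y"
proof -
  obtain Z0 where Z0: "zero_object D Z0" using zero_object_exists by blast
  then have Z0o: "Z0 \<in> Obj D" by (simp add: zero_object_def)
  have W: "W \<in> Obj D" using y Ar_obj by blast
  note o = Tri_obj[OF t] and a = Tri_Ar[OF t]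
  have "\<exists>w\<in>Mor D (S W) (S X).
      Comp D Z0 Z (S X) h (Zero D Z0 Z) = Comp D Z0 (S W) (S X) w (Zero D Z0 (S W)) \<and>
      Comp D (S W) (S X) (S Y) (neg (S X) (S Y) (SM X Y f)) w
      = Comp D (S W) (S W) (S Y) (SM W Y y) (neg (S W) (S W) (SM W W (Id D W)))"
    using TR3[OF rotate[OF TR1_identity[OF W Z0]] rotate[OF t], of y "Zero D Z0 Z"]
      y gy o W Z0o Zero_Ar by (simp add: Ar_Mor)
  then obtain w where w: "w \<in> Ar (S W) (S X)"
    "Comp D (S W) (S X) (S Y) (neg (S X) (S Y) (SM X Y f)) w
      = Comp D (S W) (S W) (S Y) (SM W Y y) (neg (S W) (S W) (SM W W (Id D W)))"
    using W o by (auto simp: Ar_Mor)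
  obtain x where x: "x \<in> Ar W X" "SM W X x = w" using SM_surj[OF w(1)] W o by blast
  have "neg (S W) (S Y) (SM W Y (Comp D W X Y f x)) = neg (S W) (S Y) (SM W Y y)"
    using w(2)[folded x(2)] a x(1) y W by (simp add: comp_neg_left comp_neg_right SM_comp)
  then have "SM W Y (Comp D W X Y f x) = SM W Y y"
    using neg_neg[of "SM W Y (Comp D W X Y f x)" "S W" "S Y"] neg_neg[of "SM W Y y" "S W" "S Y"]
      x y a by (metis SM_Ar comp_Ar)
  then have "Comp D W X Y f x = y" using SM_inj[of "Comp D W X Y f x" W Y y] x y a by auto
  then show ?thesis using x by blast
qed

text \<open>Exactness of \<open>D(-, W)\<close> at \<open>Y\<close>. Here TR3 maps the given
  triangle to the trivial one from zero to \<open>W\<close> to \<open>W\<close>, and the fill-in is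
  directly the extension.\<close>

lemma Tri_extend:
  assumes t: "(X, Y, Z, f, g, h) \<in> Tri D"
    and y: "y \<in> Ar Y W" and yf: "Comp D X Y W y f = Zero D X W"
  shows "\<exists>z\<in>Ar Z W. Comp D Y Z W z g = y"
proof -
  obtain Z0 where Z0: "zero_object D Z0" using zero_object_exists by blast
  then have Z0o: "Z0 \<in> Obj D" by (simp add: zero_object_def)
  have W: "W \<in> Obj D" using y Ar_obj by blast
  note o = Tri_obj[OF t] and a = Tri_Ar[OF t]
  have "\<exists>w\<in>Mor D Z W. Comp D Y W W (Id D W) y = Comp D Y Z W w g"
    using TR3[OF t Tri_identity_rotated[OF W Z0], of "Zero D X Z0" y]
      y yf o W Z0o Zero_Ar by (auto simp: Ar_Mor)
  then show ?thesis using y W o by (auto simp: Ar_Mor)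
qed

text \<open>TR3 maps the trivial triangle on \<open>X\<close> into the given one, so that the
  composite of \<open>f\<close> and \<open>g\<close> factors through a zero object. The other two
  composites are the same fact for rotated triangles.\<close>

lemma Tri_comp_zero:
  assumes t: "(X, Y, Z, f, g, h) \<in> Tri D"
  shows "Comp D X Y Z g f = Zero D X Z"
    and "Comp D Y Z (S X) h g = Zero D Y (S X)"
    and "Comp D Z (S X) (S Y) (SM X Y f) h = Zero D Z (S Y)"
proof -
  have *: "Comp D X Y Z g f = Zero D X Z" if t: "(X, Y, Z, f, g, h) \<in> Tri D" for X Y Z f g h
  proof -
    obtain Z0 where Z0: "zero_object D Z0" using zero_object_exists by blast
    then have Z0o: "Z0 \<in> Obj D" by (simp add: zero_object_def)
    note o = Tri_obj[OF t] and a = Tri_Ar[OF t]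
    have "\<exists>w\<in>Mor D Z0 Z. Comp D X Y Z g f = Comp D X Z0 Z w (Zero D X Z0)"
      using TR3[OF TR1_identity[OF o(1) Z0] t, of "Id D X" f] a o by (auto simp: Ar_Mor)
    then show ?thesis using o Z0o by (auto simp: Ar_Mor)
  qed
  show "Comp D X Y Z g f = Zero D X Z" by (rule *[OF t])
  show "Comp D Y Z (S X) h g = Zero D Y (S X)" by (rule *[OF rotate[OF t]])
  show "Comp D Z (S X) (S Y) (SM X Y f) h = Zero D Z (S Y)"
    using *[OF rotate[OF rotate[OF t]]] Tri_Ar[OF t] by (simp add: comp_neg_left)
qed

lemma Tri_lift3:
  assumes t: "(X, Y, Z, f, g, h) \<in> Tri D"
    and y: "y \<in> Ar W Z" and gy: "Comp D W Z (S X) h y = Zero D W (S X)"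
  shows "\<exists>x\<in>Ar W Y. Comp D W Y Z g x = y"
  using Tri_lift[OF rotate[OF t] y gy] .

lemma Tri_lift4:
  assumes t: "(X, Y, Z, f, g, h) \<in> Tri D"
    and y: "y \<in> Ar W (S X)" and gy: "Comp D W (S X) (S Y) (SM X Y f) y = Zero D W (S Y)"
  shows "\<exists>x\<in>Ar W Z. Comp D W Z (S X) h x = y"
proof -
  have "Comp D W (S X) (S Y) (neg (S X) (S Y) (SM X Y f)) y = Zero D W (S Y)"
    using y gy Tri_Ar[OF t] Ar_obj[OF y] Tri_obj[OF t] by (simp add: comp_neg_left)
  from Tri_lift[OF rotate[OF rotate[OF t]] y this] show ?thesis .
qed

lemma Tri_extend3:
  assumes t: "(X, Y, Z, f, g, h) \<in> Tri D"
    and y: "y \<in> Ar Z W" and "Comp D Y Z W y g = Zero D Y W"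
  shows "\<exists>z\<in>Ar (S X) W. Comp D Z (S X) W z h = y"
  using Tri_extend[OF rotate[OF t] y assms(3)] .

lemma Tri_extend4:
  assumes t: "(X, Y, Z, f, g, h) \<in> Tri D"
    and y: "y \<in> Ar (S X) W" and 0: "Comp D Z (S X) W y h = Zero D Z W"
  shows "\<exists>z\<in>Ar (S Y) W. Comp D (S X) (S Y) W z (SM X Y f) = y"
proof -
  note a = Tri_Ar[OF t]
  from Tri_extend[OF rotate[OF rotate[OF t]] y 0]
  obtain z where z: "z \<in> Ar (S Y) W" "Comp D (S X) (S Y) W z (neg (S X) (S Y) (SM X Y f)) = y" by blast
  then have "Comp D (S X) (S Y) W (neg (S Y) W z) (SM X Y f) = y"
    using a by (simp add: comp_neg_left comp_neg_right)
  then show ?thesis using z neg_Ar by blast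
qed

text \<open>Exactness of \<open>D(Y, -)\<close> yields a right inverse. The left inverse comes from
  exactness of \<open>D(-, S X)\<close> after a shift, because \<open>X\<close> is the first term of
  the triangle, and is then desuspended.\<close>

lemma Tri_iso_of_zero_cone:
  assumes t: "(X, Y, Z, f, g, h) \<in> Tri D" and Z: "zero_object D Z"
  shows "is_iso D X Y f"
proof -
  note o = Tri_obj[OF t] and a = Tri_Ar[OF t]
  have g: "g = Zero D Y Z" and h: "h = Zero D Z (S X)"
    using Z a o by (auto simp: zero_object_Ar)
  obtain x where x: "x \<in> Ar Y X" "Comp D Y X Y f x = Id D Y"
    using Tri_lift[OF t, of "Id D Y" Y] g o by auto
  obtain s where s: "s \<in> Ar (S Y) (S X)" "Comp D (S X) (S Y) (S X) s (SM X Y f) = Id D (S X)"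
    using Tri_extend4[OF t, of "Id D (S X)" "S X"] h o by auto
  obtain r where r: "r \<in> Ar Y X" "SM Y X r = s" using SM_surj[OF s(1)] o by blast
  have "SM X X (Comp D X Y X r f) = SM X X (Id D X)"
    using s r a o by (simp add: SM_comp)
  then have "Comp D X Y X r f = Id D X"
    using SM_inj[of "Comp D X Y X r f" X X "Id D X"] r a o by auto
  then show ?thesis by (rule iso_left_right_inverse[OF a(1) r(1) x(1) _ x(2)])
qed

section \<open>Triangulated subcategories and their orthogonals\<close>

lemma tsub_obj: "tsub T \<Longrightarrow> X \<in> T \<Longrightarrow> X \<in> Obj D"
  unfolding triangulated_subcategory_def strictly_full_def by blast

lemma tsub_subset: "tsub T \<Longrightarrow> T \<subseteq> Obj D"
  unfolding triangulated_subcategory_def strictly_full_def by blast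

lemma tsub_iso: "tsub T \<Longrightarrow> X \<in> T \<Longrightarrow> Y \<in> Obj D \<Longrightarrow> isomorphic D X Y \<Longrightarrow> Y \<in> T"
  unfolding triangulated_subcategory_def strictly_full_def by blast

lemma tsub_zero: "tsub T \<Longrightarrow> zero_object D Z \<Longrightarrow> Z \<in> T"
  unfolding triangulated_subcategory_def by blast

lemma tsub_shift: "tsub T \<Longrightarrow> X \<in> Obj D \<Longrightarrow> S X \<in> T \<longleftrightarrow> X \<in> T"
  unfolding triangulated_subcategory_def by blast

lemma tsub_cone: "tsub T \<Longrightarrow> (X, Y, Z, f, g, h) \<in> Tri D \<Longrightarrow> X \<in> T \<Longrightarrow> Y \<in> T \<Longrightarrow> Z \<in> T"
  unfolding triangulated_subcategory_def by blast

lemma tsub_unshift: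
  assumes "tsub T" "X \<in> T"
  shows "\<exists>W\<in>T. S W = X"
  using Shift_surj[OF tsub_obj[OF assms]] tsub_shift[OF assms(1)] assms(2) by blast

lemma tsub_fiber:
  assumes "tsub T" "(X, Y, Z, f, g, h) \<in> Tri D" "Y \<in> T" "Z \<in> T"
  shows "X \<in> T"
  using tsub_cone[OF assms(1) rotate[OF assms(2)] assms(3,4)] tsub_shift[OF assms(1)] Tri_obj[OF assms(2)]
  by blast

lemma triangulated_subcategoryI:
  assumes "T \<subseteq> Obj D"
    and "\<And>X Y. X \<in> T \<Longrightarrow> Y \<in> Obj D \<Longrightarrow> isomorphic D X Y \<Longrightarrow> Y \<in> T"
    and "\<And>Z. zero_object D Z \<Longrightarrow> Z \<in> T"
    and "\<And>X. X \<in> Obj D \<Longrightarrow> S X \<in> T \<longleftrightarrow> X \<in> T"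
    and "\<And>X Y Z f g h. (X, Y, Z, f, g, h) \<in> Tri D \<Longrightarrow> X \<in> T \<Longrightarrow> Y \<in> T \<Longrightarrow> Z \<in> T"
  shows "tsub T"
  unfolding triangulated_subcategory_def strictly_full_def using assms by blast

lemma tsub_Obj: "tsub (Obj D)"
  by (rule triangulated_subcategoryI) (auto simp: zero_object_def dest: Tri_obj Shift_surj)

lemma tsub_Inter:
  assumes "\<And>T. T \<in> F \<Longrightarrow> tsub T" "F \<noteq> {}"
  shows "tsub (\<Inter>F)"
proof (rule triangulated_subcategoryI)
  show "\<Inter>F \<subseteq> Obj D" using assms tsub_subset by blast
  show "Y \<in> \<Inter>F" if "X \<in> \<Inter>F" "Y \<in> Obj D" "isomorphic D X Y" for X Y
    using that assms(1) tsub_iso by blast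
  show "Z \<in> \<Inter>F" if "zero_object D Z" for Z
    using that assms(1) tsub_zero by blast
  show "S X \<in> \<Inter>F \<longleftrightarrow> X \<in> \<Inter>F" if "X \<in> Obj D" for X
    using that assms(1) tsub_shift by blast
  show "Z \<in> \<Inter>F" if "(X, Y, Z, f, g, h) \<in> Tri D" "X \<in> \<Inter>F" "Y \<in> \<Inter>F" for X Y Z f g h
    using that(2,3) tsub_cone[OF assms(1) that(1)] by blast
qed

lemma tsub_Int:
  "tsub T \<Longrightarrow> tsub T' \<Longrightarrow> tsub (T \<inter> T')"
  using tsub_Inter[of "{T, T'}"] by auto

lemma right_perp_iff: "T \<subseteq> Obj D \<Longrightarrow> Y \<in> rperp T \<longleftrightarrow> Y \<in> Obj D \<and> (\<forall>X\<in>T. \<forall>f\<in>Ar X Y. f = Zero D X Y)"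
  unfolding right_perp_def using Mor_zero_iff by blast

lemma right_perp_Int: "T \<subseteq> Obj D \<Longrightarrow> right_perp D T L = rperp L \<inter> T"
  by (auto simp: right_perp_def)

lemma Ar_Shift_vanish:
  assumes "X \<in> Obj D" "Y \<in> Obj D"
  shows "(\<forall>f\<in>Ar (S X) (S Y). f = Zero D (S X) (S Y)) \<longleftrightarrow> (\<forall>f\<in>Ar X Y. f = Zero D X Y)"
  using SM_surj[OF _ assms] SM_eq_zero[of _ X Y] SM_Ar[of _ X Y] by metis

text \<open>A triangulated subcategory is the class of shifts of its own objects; this makes both
  orthogonals invariant under the shift in both directions.\<close>

lemma ball_tsub_Shift:
  assumes T: "tsub T"
  shows "(\<forall>W\<in>T. Q W) \<longleftrightarrow> (\<forall>W\<in>T. Q (S W))"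
  using tsub_shift[OF T tsub_obj[OF T]] tsub_unshift[OF T] by metis

lemma tsub_right_perp:
  assumes T: "tsub T"
  shows "tsub (rperp T)"
proof (rule triangulated_subcategoryI)
  let ?P = "rperp T"
  note iff = right_perp_iff[OF tsub_subset[OF T]]
  show "?P \<subseteq> Obj D" by (auto simp: right_perp_def)
  show "Y \<in> ?P" if X: "X \<in> ?P" and Y: "Y \<in> Obj D" and i: "isomorphic D X Y" for X Y
    unfolding iff
  proof (intro conjI ballI Y)
    fix W f assume W: "W \<in> T" and f: "f \<in> Ar W Y"
    obtain u v where u: "u \<in> Ar X Y" "v \<in> Ar Y X" "Comp D Y X Y u v = Id D Y"
      using i X Y by (auto simp: isomorphic_def iff is_iso_Ar)
    have "Comp D W Y X v f = Zero D W X" using X W f u by (auto simp: iff)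
    then show "f = Zero D W Y"
      using assoc[OF f u(2,1)] u f Ar_obj[OF f] by simp
  qed
  show "Z \<in> ?P" if "zero_object D Z" for Z
    using that tsub_obj[OF T] by (auto simp: iff zero_object_Ar)
  show *: "S X \<in> ?P \<longleftrightarrow> X \<in> ?P" if X: "X \<in> Obj D" for X
    unfolding iff ball_tsub_Shift[OF T, of "\<lambda>W. \<forall>f\<in>Ar W (S X). f = Zero D W (S X)"]
    using X Ar_Shift_vanish[OF tsub_obj[OF T] X] by blast
  show "Z \<in> ?P" if t: "(X, Y, Z, f, g, h) \<in> Tri D" and XY: "X \<in> ?P" "Y \<in> ?P" for X Y Z f g h
    unfolding iff
  proof (intro conjI ballI)
    note o = Tri_obj[OF t] and a = Tri_Ar[OF t]
    show "Z \<in> Obj D" by fact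
    fix W k assume W: "W \<in> T" and k: "k \<in> Ar W Z"
    have "S X \<in> ?P" using * XY o by blast
    then have "Comp D W Z (S X) h k = Zero D W (S X)" using W k a by (auto simp: iff)
    then obtain y where y: "y \<in> Ar W Y" "Comp D W Y Z g y = k" using Tri_lift3[OF t k] by blast
    then have "y = Zero D W Y" using XY W by (auto simp: iff)
    then show "k = Zero D W Z" using y a tsub_obj[OF T W] by auto
  qed
qed

text \<open>Orthogonality of two classes is from here on an inclusion into this set, so that it
  extends to closures by minimality. The set is closed under coproducts for every \<open>T\<close>,
  whereas \<open>rperp T\<close> is so for compact \<open>T\<close>.\<close>

definition left_perp :: "'o set \<Rightarrow> 'o set" where
  "left_perp T = {X \<in> Obj D. \<forall>Y\<in>T. \<forall>f\<in>Ar X Y. f = Zero D X Y}"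

lemma left_perp_obj: "X \<in> left_perp T \<Longrightarrow> X \<in> Obj D"
  by (simp add: left_perp_def)

lemma tsub_left_perp:
  assumes T: "tsub T"
  shows "tsub (left_perp T)"
proof (rule triangulated_subcategoryI)
  show "left_perp T \<subseteq> Obj D" by (auto simp: left_perp_def)
  show "Y \<in> left_perp T" if X: "X \<in> left_perp T" and Y: "Y \<in> Obj D" and i: "isomorphic D X Y" for X Y
    unfolding left_perp_def
  proof (intro CollectI conjI ballI Y)
    fix W f assume W: "W \<in> T" and f: "f \<in> Ar Y W"
    obtain u v where u: "u \<in> Ar X Y" "v \<in> Ar Y X" "Comp D Y X Y u v = Id D Y"
      using i X Y left_perp_obj[OF X] by (auto simp: isomorphic_def is_iso_Ar)
    have "Comp D X Y W f u = Zero D X W" using X W f u by (auto simp: left_perp_def)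
    then show "f = Zero D Y W"
      using assoc[OF u(2,1) f] u f Ar_obj[OF f] by simp
  qed
  show "Z \<in> left_perp T" if "zero_object D Z" for Z
    using that tsub_obj[OF T] by (auto simp: left_perp_def zero_object_Ar)
  show *: "S X \<in> left_perp T \<longleftrightarrow> X \<in> left_perp T" if X: "X \<in> Obj D" for X
    unfolding left_perp_def mem_Collect_eq ball_tsub_Shift[OF T, of "\<lambda>W. \<forall>f\<in>Ar (S X) W. f = Zero D (S X) W"]
    using X Ar_Shift_vanish[OF X tsub_obj[OF T]] by blast
  show "Z \<in> left_perp T" if t: "(X, Y, Z, f, g, h) \<in> Tri D" and XY: "X \<in> left_perp T" "Y \<in> left_perp T"
    for X Y Z f g h
    unfolding left_perp_def
  proof (intro CollectI conjI ballI)
    note o = Tri_obj[OF t] and a = Tri_Ar[OF t]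
    show "Z \<in> Obj D" by fact
    fix W k assume W: "W \<in> T" and k: "k \<in> Ar Z W"
    have SX: "S X \<in> left_perp T" using * XY o by blast
    have "Comp D Y Z W k g = Zero D Y W" using W k a XY by (auto simp: left_perp_def)
    then obtain y where y: "y \<in> Ar (S X) W" "Comp D Z (S X) W y h = k" using Tri_extend3[OF t k] by blast
    then have "y = Zero D (S X) W" using SX W by (auto simp: left_perp_def)
    then show "k = Zero D Z W" using y a tsub_obj[OF T W] by auto
  qed
qed

lemma orthogonal_left_perp:
  assumes "P \<subseteq> Obj D" "Q \<subseteq> Obj D"
  shows "orthogonal D P Q \<longleftrightarrow> P \<subseteq> left_perp Q"
  unfolding orthogonal_def left_perp_def using assms Mor_zero_iff by blast

lemma orthogonal_right_perp:
  assumes "P \<subseteq> Obj D" "Q \<subseteq> Obj D"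
  shows "orthogonal D P Q \<longleftrightarrow> Q \<subseteq> rperp P"
  using assms by (auto simp: orthogonal_def right_perp_def)

end

section \<open>Coproducts of triangles and extensions\<close>

lemma small_natural: "smallness_cardinal \<kappa> \<Longrightarrow> small \<kappa> (UNIV :: nat set)"
  unfolding smallness_cardinal_def small_def
  using card_of_nat ordIso_ordLess_trans by blast

lemma small_subset: "small \<kappa> B \<Longrightarrow> A \<subseteq> B \<Longrightarrow> small \<kappa> A"
  unfolding small_def using card_of_mono1 ordLeq_ordLess_trans by blast

lemma small_image: "small \<kappa> A \<Longrightarrow> small \<kappa> (f ` A)"
  unfolding small_def using card_of_image ordLeq_ordLess_trans by blast

text \<open>Regularity of the cardinal is what bounds a small union of small sets.\<close>

lemma small_Sigma:
  assumes "smallness_cardinal \<kappa>" "small \<kappa> A" "\<And>x. x \<in> A \<Longrightarrow> small \<kappa> (B x)"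
  shows "small \<kappa> (Sigma A B)"
proof -
  have "Card_order \<kappa>" "natLeq <o \<kappa>" "regularCard \<kappa>"
    using assms(1) by (auto simp: smallness_cardinal_def)
  moreover have "infinite (Field \<kappa>)"
    using \<open>natLeq <o \<kappa>\<close> \<open>Card_order \<kappa>\<close> cinfinite_def natLeq_ordLeq_cinfinite
      cinfinite_mono ordLess_imp_ordLeq natLeq_cinfinite by blast
  ultimately have "stable \<kappa>" by (intro regularCard_stable)
  then show ?thesis using assms stable_elim unfolding small_def by blast
qed

text \<open>Places a small set inside \<open>'u\<close>, the type of index sets and of elements of
  graded modules.\<close>

lemma small_inj:
  fixes \<kappa> :: "'u rel"
  assumes "smallness_cardinal \<kappa>" "small \<kappa> A"
  shows "\<exists>e :: 'a \<Rightarrow> 'u. inj_on e A"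
proof -
  have "|A| \<le>o |Field \<kappa>|"
    using assms card_of_Field_ordIso ordLess_imp_ordLeq ordLeq_ordIso_trans ordIso_symmetric
    unfolding small_def smallness_cardinal_def by blast
  then show ?thesis using card_of_ordLeq[of A "Field \<kappa>"] by blast
qed

context triangulated_category
begin

text \<open>The shift is an automorphism, so the universal property can be tested after desuspending
  the target.\<close>

lemma coproduct_Shift:
  assumes c: "is_coproduct D I X P \<iota>"
  shows "is_coproduct D I (\<lambda>i. S (X i)) (S P) (\<lambda>i. SM (X i) P (\<iota> i))"
proof (rule is_coproductI)
  note a = coproduct_Ar[OF c]
  show "S P \<in> Obj D" using a by blast
  show "SM (X i) P (\<iota> i) \<in> Ar (S (X i)) (S P)" if "i \<in> I" for i
    using a that by blast
  show "\<exists>h\<in>Ar (S P) Y. \<forall>i\<in>I. Comp D (S (X i)) (S P) Y h (SM (X i) P (\<iota> i)) = f i"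
    if Y: "Y \<in> Obj D" and f: "\<And>i. i \<in> I \<Longrightarrow> f i \<in> Ar (S (X i)) Y" for Y f
  proof -
    obtain V where V: "V \<in> Obj D" "S V = Y" using Shift_surj Y by blast
    have "\<exists>k\<in>Ar (X i) V. SM (X i) V k = f i" if "i \<in> I" for i
      using SM_surj[of "f i" "X i" V] f[OF that] V Ar_obj[OF a(2)[OF that]] by blast
    then obtain k where k: "\<And>i. i \<in> I \<Longrightarrow> k i \<in> Ar (X i) V \<and> SM (X i) V (k i) = f i" by metis
    obtain h where h: "h \<in> Ar P V" "\<forall>i\<in>I. Comp D (X i) P V h (\<iota> i) = k i"
      using coproduct_exists_map[OF c V(1), of k] k by blast
    have "Comp D (S (X i)) (S P) Y (SM P V h) (SM (X i) P (\<iota> i)) = f i" if i: "i \<in> I" for i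
      using SM_comp[OF a(2)[OF i] h(1)] h(2) k[OF i] i V by simp
    moreover have "SM P V h \<in> Ar (S P) Y" using h V by auto
    ultimately show ?thesis by blast
  qed
  show "h = h'" if h: "h \<in> Ar (S P) Y" "h' \<in> Ar (S P) Y"
    and eq: "\<And>i. i \<in> I \<Longrightarrow> Comp D (S (X i)) (S P) Y h (SM (X i) P (\<iota> i))
      = Comp D (S (X i)) (S P) Y h' (SM (X i) P (\<iota> i))" for Y h h'
  proof -
    obtain V where V: "V \<in> Obj D" "S V = Y" using Shift_surj Ar_obj[OF h(1)] by blast
    obtain k where k: "k \<in> Ar P V" "SM P V k = h" using SM_surj[of h P V] h V a by blast
    obtain k' where k': "k' \<in> Ar P V" "SM P V k' = h'" using SM_surj[of h' P V] h V a by blast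
    have "k = k'"
    proof (rule coproduct_map_eq[OF c k(1) k'(1)])
      fix i assume i: "i \<in> I"
      have "SM (X i) V (Comp D (X i) P V k (\<iota> i)) = SM (X i) V (Comp D (X i) P V k' (\<iota> i))"
        using eq[OF i] SM_comp[OF a(2)[OF i] k(1)] SM_comp[OF a(2)[OF i] k'(1)] k(2) k'(2) V(2) by simp
      then show "Comp D (X i) P V k (\<iota> i) = Comp D (X i) P V k' (\<iota> i)"
        using SM_inj[OF comp_Ar[OF a(2)[OF i] k(1)] comp_Ar[OF a(2)[OF i] k'(1)]] by blast
    qed
    then show ?thesis using k k' by simp
  qed
qed

lemma coproduct_map_of_family:
  assumes "is_coproduct D I X P a" "is_coproduct D I Y Q b" "\<And>i. i \<in> I \<Longrightarrow> f i \<in> Ar (X i) (Y i)"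
  shows "\<exists>F\<in>Ar P Q. \<forall>i\<in>I. Comp D (X i) P Q F (a i) = Comp D (X i) (Y i) Q (b i) (f i)"
  using coproduct_exists_map[OF assms(1) coproduct_Ar(1)[OF assms(2)], of "\<lambda>i. Comp D (X i) (Y i) Q (b i) (f i)"]
    assms(3) coproduct_Ar(2)[OF assms(2)] comp_Ar by blast

lemma coproduct_map_comp:
  assumes c: "is_coproduct D I X P a" and b: "i \<in> I" "b \<in> Ar Y Q" and f: "f \<in> Ar (X i) Y"
    and F: "F \<in> Ar P Q" "Comp D (X i) P Q F (a i) = Comp D (X i) Y Q b f" and y: "y \<in> Ar Q W"
  shows "Comp D (X i) P W (Comp D P Q W y F) (a i) = Comp D (X i) Y W (Comp D Y Q W y b) f"
  using assoc[OF coproduct_Ar(2)[OF c b(1)] F(1) y] assoc[OF f b(2) y] F(2) by simp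

text \<open>The product over \<open>i\<close> of the exact sequences \<open>D(Z i, W) \<rightarrow> D(Y i, W) \<rightarrow> D(X i, W)\<close> is exact.\<close>

lemma coproduct_exact:
  assumes a: "is_coproduct D I X PX a" and b: "is_coproduct D I Y PY b" and c: "is_coproduct D I Z PZ c"
    and f: "\<And>i. i \<in> I \<Longrightarrow> f i \<in> Ar (X i) (Y i)" and g: "\<And>i. i \<in> I \<Longrightarrow> g i \<in> Ar (Y i) (Z i)"
    and F: "F \<in> Ar PX PY" "\<And>i. i \<in> I \<Longrightarrow> Comp D (X i) PX PY F (a i) = Comp D (X i) (Y i) PY (b i) (f i)"
    and G: "G \<in> Ar PY PZ" "\<And>i. i \<in> I \<Longrightarrow> Comp D (Y i) PY PZ G (b i) = Comp D (Y i) (Z i) PZ (c i) (g i)"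
    and ex: "\<And>i y. i \<in> I \<Longrightarrow> y \<in> Ar (Y i) W \<Longrightarrow> Comp D (X i) (Y i) W y (f i) = Zero D (X i) W \<Longrightarrow>
       \<exists>z\<in>Ar (Z i) W. Comp D (Y i) (Z i) W z (g i) = y"
    and y: "y \<in> Ar PY W" "Comp D PX PY W y F = Zero D PX W"
  shows "\<exists>z\<in>Ar PZ W. Comp D PY PZ W z G = y"
proof -
  have W: "W \<in> Obj D" using y Ar_obj by blast
  have "\<exists>z\<in>Ar (Z i) W. Comp D (Y i) (Z i) W z (g i) = Comp D (Y i) PY W y (b i)" if i: "i \<in> I" for i
  proof (rule ex[OF i])
    show "Comp D (Y i) PY W y (b i) \<in> Ar (Y i) W" using coproduct_Ar(2)[OF b i] y by blast
    have "Comp D (X i) (Y i) W (Comp D (Y i) PY W y (b i)) (f i) = Comp D (X i) PX W (Comp D PX PY W y F) (a i)"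
      using coproduct_map_comp[OF a i coproduct_Ar(2)[OF b i] f[OF i] F(1) F(2)[OF i] y(1)] by simp
    also have "\<dots> = Zero D (X i) W" using y(2) coproduct_Ar(2)[OF a i] W by simp
    finally show "Comp D (X i) (Y i) W (Comp D (Y i) PY W y (b i)) (f i) = Zero D (X i) W" .
  qed
  then obtain z where z: "\<And>i. i \<in> I \<Longrightarrow> z i \<in> Ar (Z i) W \<and> Comp D (Y i) (Z i) W (z i) (g i) = Comp D (Y i) PY W y (b i)"
    by metis
  obtain k where k: "k \<in> Ar PZ W" "\<forall>i\<in>I. Comp D (Z i) PZ W k (c i) = z i"
    using coproduct_exists_map[OF c W, of z] z by blast
  have "Comp D PY PZ W k G = y"
  proof (rule coproduct_map_eq[OF b])
    show "Comp D (Y i) PY W (Comp D PY PZ W k G) (b i) = Comp D (Y i) PY W y (b i)" if i: "i \<in> I" for i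
      using coproduct_map_comp[OF b i coproduct_Ar(2)[OF c i] g[OF i] G(1) G(2)[OF i] k(1)] k(2) z[OF i] i
      by simp
  qed (use k G y in auto)
  then show ?thesis using k by blast
qed

text \<open>Fill-ins from TR3 glue to a comparison map \<open>w\<close> from the coproduct of the
  third terms to the cone of \<open>F\<close>. Precomposition with \<open>w\<close> is bijective on
  maps to every \<open>W\<close> by a five lemma argument, as products of exact sequences are exact
  (\<open>coproduct_exact\<close>); hence \<open>w\<close> is invertible.\<close>

lemma coproduct_Tri:
  assumes t: "\<And>i. i \<in> I \<Longrightarrow> (X i, Y i, Z i, f i, g i, h i) \<in> Tri D"
    and a: "is_coproduct D I X PX a" and b: "is_coproduct D I Y PY b" and c: "is_coproduct D I Z PZ c"
  shows "\<exists>C F p q. (PX, PY, C, F, p, q) \<in> Tri D \<and> isomorphic D PZ C"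
proof -
  note ta = Tri_Ar[OF t] and aA = coproduct_Ar[OF a] and bA = coproduct_Ar[OF b] and cA = coproduct_Ar[OF c]
  note Sa = coproduct_Shift[OF a] and Sb = coproduct_Shift[OF b]
  note SaA = coproduct_Ar[OF Sa] and SbA = coproduct_Ar[OF Sb]
  obtain F where F: "F \<in> Ar PX PY" "\<And>i. i \<in> I \<Longrightarrow> Comp D (X i) PX PY F (a i) = Comp D (X i) (Y i) PY (b i) (f i)"
    using coproduct_map_of_family[OF a b, of f] ta(1) by blast
  obtain G where G: "G \<in> Ar PY PZ" "\<And>i. i \<in> I \<Longrightarrow> Comp D (Y i) PY PZ G (b i) = Comp D (Y i) (Z i) PZ (c i) (g i)"
    using coproduct_map_of_family[OF b c, of g] ta(2) by blast
  obtain H where H: "H \<in> Ar PZ (S PX)"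
    "\<And>i. i \<in> I \<Longrightarrow> Comp D (Z i) PZ (S PX) H (c i) = Comp D (Z i) (S (X i)) (S PX) (SM (X i) PX (a i)) (h i)"
    using coproduct_map_of_family[OF c Sa, of h] ta(3) by blast
  have SF: "SM PX PY F \<in> Ar (S PX) (S PY)"
    "\<And>i. i \<in> I \<Longrightarrow> Comp D (S (X i)) (S PX) (S PY) (SM PX PY F) (SM (X i) PX (a i)) =
       Comp D (S (X i)) (S (Y i)) (S PY) (SM (Y i) PY (b i)) (SM (X i) (Y i) (f i))"
    using SM_comp[OF aA(2) F(1)] SM_comp[OF ta(1) bA(2)] F by auto
  have Sf: "SM (X i) (Y i) (f i) \<in> Ar (S (X i)) (S (Y i))" if "i \<in> I" for i using ta(1)[OF that] by blast
  obtain C p q where C: "(PX, PY, C, F, p, q) \<in> Tri D"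
    using TR1_cone[of PX PY F] F aA(1) bA(1) by (auto simp: Ar_def)
  note CA = Tri_Ar[OF C] and Co = Tri_obj[OF C]
  have "\<exists>w\<in>Ar (Z i) C. Comp D (Y i) PY C p (b i) = Comp D (Y i) (Z i) C w (g i) \<and>
      Comp D (Z i) C (S PX) q w = Comp D (Z i) (S (X i)) (S PX) (SM (X i) PX (a i)) (h i)" if i: "i \<in> I" for i
    using TR3[OF t[OF i] C, of "a i" "b i"] F(2)[OF i] aA(2)[OF i] bA(2)[OF i] Co Tri_obj[OF t[OF i]]
    by (simp add: Ar_Mor)
  then obtain w' where w': "\<And>i. i \<in> I \<Longrightarrow> w' i \<in> Ar (Z i) C \<and> Comp D (Y i) PY C p (b i) = Comp D (Y i) (Z i) C (w' i) (g i) \<and>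
      Comp D (Z i) C (S PX) q (w' i) = Comp D (Z i) (S (X i)) (S PX) (SM (X i) PX (a i)) (h i)" by metis
  obtain w where w: "w \<in> Ar PZ C" "\<forall>i\<in>I. Comp D (Z i) PZ C w (c i) = w' i"
    using coproduct_exists_map[OF c Co(3), of w'] w' by blast
  have wG: "Comp D PY PZ C w G = p"
  proof (rule coproduct_map_eq[OF b])
    show "Comp D (Y i) PY C (Comp D PY PZ C w G) (b i) = Comp D (Y i) PY C p (b i)" if i: "i \<in> I" for i
      using coproduct_map_comp[OF b i cA(2)[OF i] ta(2)[OF i] G(1) G(2)[OF i] w(1)] w(2) w'[OF i] i by simp
  qed (use w G CA in auto)
  have qw: "Comp D PZ C (S PX) q w = H"
  proof (rule coproduct_map_eq[OF c])
    show "Comp D (Z i) PZ (S PX) (Comp D PZ C (S PX) q w) (c i) = Comp D (Z i) PZ (S PX) H (c i)" if i: "i \<in> I" for i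
      using assoc[OF cA(2)[OF i] w(1) CA(3)] w(2) w'[OF i] H(2)[OF i] i by simp
  qed (use w H CA in auto)
  \<comment> \<open>Injective half of the five lemma: the difference \<open>u\<close> dies on
    \<open>PY\<close>, so it factors as \<open>s\<close> after \<open>q\<close>. Then
    \<open>s\<close> composes with \<open>H\<close> to zero and extends along the shift of
    \<open>F\<close>, which composes with \<open>q\<close> to zero.\<close>
  have inj: "z = z'" if z: "z \<in> Ar C W" "z' \<in> Ar C W" and eq: "Comp D PZ C W z w = Comp D PZ C W z' w" for z z' W
  proof -
    define u where "u = diff C W z z'"
    have W: "W \<in> Obj D" using Ar_obj[OF z(1)] by blast
    have u: "u \<in> Ar C W" "Comp D PZ C W u w = Zero D PZ W"
      using z eq w by (auto simp: u_def comp_diff_left)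
    have "Comp D PY C W u p = Comp D PY PZ W (Comp D PZ C W u w) G"
      using assoc[OF G(1) w(1) u(1)] wG by simp
    then have "Comp D PY C W u p = Zero D PY W" using u G W by simp
    then obtain s where s: "s \<in> Ar (S PX) W" "Comp D C (S PX) W s q = u"
      using Tri_extend3[OF C u(1)] by blast
    have sH: "Comp D PZ (S PX) W s H = Zero D PZ W"
      using assoc[OF w(1) CA(3) s(1)] qw s(2) u(2) by simp
    have "\<exists>r\<in>Ar (S PY) W. Comp D (S PX) (S PY) W r (SM PX PY F) = s"
      by (rule coproduct_exact[OF c Sa Sb ta(3) Sf H SF _ s(1) sH]) (use Tri_extend4[OF t] in auto)
    then obtain r where r: "r \<in> Ar (S PY) W" "Comp D (S PX) (S PY) W r (SM PX PY F) = s" by blast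
    have "u = Zero D C W"
      using assoc[OF CA(3) SF(1) r(1)] r s Tri_comp_zero(3)[OF C] Co by simp
    then show ?thesis using z by (simp add: u_def)
  qed
  \<comment> \<open>Surjective half: \<open>z\<close> matches \<open>x\<close> after composition
    with \<open>G\<close>. The error \<open>v\<close> then dies on \<open>PY\<close>, so it factors
    through \<open>H\<close>, which is \<open>q\<close> after \<open>w\<close>, and \<open>z\<close>
    can be corrected by a map factoring through \<open>q\<close>.\<close>
  have surj: "\<exists>z\<in>Ar C W. Comp D PZ C W z w = x" if x: "x \<in> Ar PZ W" for x W
  proof -
    have W: "W \<in> Obj D" using Ar_obj[OF x] by blast
    have GF: "Comp D PX PY PZ G F = Zero D PX PZ"
    proof (rule coproduct_map_eq[OF a])
      show "Comp D (X i) PX PZ (Comp D PX PY PZ G F) (a i) = Comp D (X i) PX PZ (Zero D PX PZ) (a i)"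
        if i: "i \<in> I" for i
        using coproduct_map_comp[OF a i bA(2)[OF i] ta(1)[OF i] F(1) F(2)[OF i] G(1)] G(2)[OF i]
          assoc[OF ta(1)[OF i] ta(2)[OF i] cA(2)[OF i]] Tri_comp_zero(1)[OF t[OF i]] aA(2)[OF i] cA
          Ar_obj[OF aA(2)[OF i]] cA(2)[OF i] by simp
    qed (use F G aA cA in auto)
    have "Comp D PX PY W (Comp D PY PZ W x G) F = Zero D PX W"
      using assoc[OF F(1) G(1) x] GF x aA by simp
    then obtain z where z: "z \<in> Ar C W" "Comp D PY C W z p = Comp D PY PZ W x G"
      using Tri_extend[OF C, of "Comp D PY PZ W x G" W] x G by blast
    define v where "v = diff PZ W x (Comp D PZ C W z w)"
    have v: "v \<in> Ar PZ W" using x z w by (auto simp: v_def)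
    have "Comp D PY PZ W v G = Zero D PY W"
      using x z w G assoc[OF G(1) w(1) z(1)] wG unfolding v_def by (subst comp_diff_left) auto
    then have "\<exists>s\<in>Ar (S PX) W. Comp D PZ (S PX) W s H = v"
      by (intro coproduct_exact[OF b c Sa ta(2,3) G H _ v]) (use Tri_extend3[OF t] in auto)
    then obtain s where s: "s \<in> Ar (S PX) W" "Comp D PZ (S PX) W s H = v" by blast
    have "Comp D PZ C W (plus C W z (Comp D C (S PX) W s q)) w = plus PZ W (Comp D PZ C W z w) v"
      using z s w CA assoc[OF w(1) CA(3) s(1)] qw by (subst comp_plus_left) auto
    also have "\<dots> = x" unfolding v_def using x z w by (intro plus_diff_cancel) auto
    finally show ?thesis using z s CA by blast
  qed
  obtain v where v: "v \<in> Ar C PZ" "Comp D PZ C PZ v w = Id D PZ" using surj[of "Id D PZ" PZ] cA by auto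
  have "Comp D C PZ C w v = Id D C"
    by (rule inj) (use v w Co assoc[OF w(1) v(1) w(1)] in auto)
  then have "is_iso D PZ C w" using is_isoI[OF w(1) v(1)] v by blast
  then show ?thesis using C by (auto simp: isomorphic_def)
qed

text \<open>The class often written \<open>P * Q\<close>.\<close>

definition extensions :: "'o set \<Rightarrow> 'o set \<Rightarrow> 'o set" where
  "extensions P Q = {M. \<exists>L\<in>P. \<exists>R\<in>Q. \<exists>f g h. (L, M, R, f, g, h) \<in> Tri D}"

lemma extensions_obj: "M \<in> extensions P Q \<Longrightarrow> M \<in> Obj D"
  unfolding extensions_def using Tri_obj by blast

lemma Tri_replace_middle:
  assumes t: "(X, Y, Z, f, g, h) \<in> Tri D" and Y': "Y' \<in> Obj D" and i: "isomorphic D Y Y'"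
  shows "\<exists>f g. (X, Y', Z, f, g, h) \<in> Tri D"
proof -
  note o = Tri_obj[OF t] and a = Tri_Ar[OF t]
  obtain u v where u: "u \<in> Ar Y Y'" "v \<in> Ar Y' Y" "Comp D Y Y' Y v u = Id D Y" "is_iso D Y Y' u"
    using i o Y' by (auto simp: isomorphic_def is_iso_Ar)
  have "(X, Y', Z, Comp D X Y Y' u f, Comp D Y' Y Z g v, h) \<in> Tri D"
  proof (rule TR1_isomorphic[OF t])
    show "is_iso D X X (Id D X)" "is_iso D Z Z (Id D Z)" by (rule Id_iso, fact)+
    show "Comp D Y Y' Z (Comp D Y' Y Z g v) u = Comp D Y Z Z (Id D Z) g"
      using assoc[OF u(1,2) a(2)] u a by simp
  qed (use u a o Y' in \<open>auto simp: Ar_Mor\<close>)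
  then show ?thesis by blast
qed

lemma Shift_inj: "X \<in> Obj D \<Longrightarrow> Y \<in> Obj D \<Longrightarrow> S X = S Y \<Longrightarrow> X = Y"
  using Shift_bij by (auto simp: bij_betw_def dest: inj_onD)

text \<open>Three rotations shift a triangle up to the signs of its maps; only existence of the maps
  is asserted, so the signs need not be tracked.\<close>

lemma Tri_Shift:
  assumes "(X, Y, Z, f, g, h) \<in> Tri D"
  shows "\<exists>f g h. (S X, S Y, S Z, f, g, h) \<in> Tri D"
  using rotate[OF rotate[OF rotate[OF assms]]] by blast

lemma Tri_Shift_inverse:
  assumes "(S X, S Y, S Z, f, g, h) \<in> Tri D" "X \<in> Obj D" "Y \<in> Obj D" "Z \<in> Obj D"
  shows "\<exists>f g h. (X, Y, Z, f, g, h) \<in> Tri D"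
proof -
  obtain Z' k where Z': "S Z' = S Z" "(Z', S X, S Y, k, f, g) \<in> Tri D" using rotate_inverse[OF assms(1)] by blast
  then obtain Y' k' where Y': "S Y' = S Y" "(Y', Z', S X, k', k, f) \<in> Tri D" using rotate_inverse by blast
  then obtain X' k'' where X': "S X' = S X" "(X', Y', Z', k'', k', k) \<in> Tri D" using rotate_inverse by blast
  have "X' = X" "Y' = Y" "Z' = Z" using Shift_inj Tri_obj[OF X'(2)] assms X'(1) Y'(1) Z'(1) by blast+
  then show ?thesis using X' by blast
qed

lemma octahedron:
  assumes "(X, Y, Z', f, a, b) \<in> Tri D" "(Y, Z, X', g, c, d) \<in> Tri D"
    "(X, Z, Y', Comp D X Y Z g f, e, k) \<in> Tri D"
  shows "\<exists>u v w. (Z', Y', X', u, v, w) \<in> Tri D"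
  using TR4_octahedron[OF assms] by blast

lemma cone_exists: "f \<in> Ar X Y \<Longrightarrow> \<exists>Z g h. (X, Y, Z, f, g, h) \<in> Tri D"
  using TR1_cone[of X Y f] by (auto simp: Ar_def)

text \<open>
  Three octahedra: the cone of \<open>L \<rightarrow> M\<close> with \<open>L \<in> P\<close> is handled by factoring through the \<open>P\<close>-part of
  \<open>M\<close>, the cone of \<open>R \<rightarrow> M\<close> with \<open>R \<in> Q\<close> by composing with the \<open>Q\<close>-part of \<open>M\<close>, and a general cone
  is a cone of the second kind on a cone of the first kind.
\<close>

lemma tsub_extensions:
  assumes P: "tsub P" and Q: "tsub Q"
    and orth: "P \<subseteq> left_perp Q"
  shows "tsub (extensions P Q)"
proof (rule triangulated_subcategoryI)
  let ?E = "extensions P Q"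
  show "?E \<subseteq> Obj D" using extensions_obj by blast
  show "Y \<in> ?E" if "X \<in> ?E" "Y \<in> Obj D" "isomorphic D X Y" for X Y
    using that Tri_replace_middle unfolding extensions_def by blast
  show "Z \<in> ?E" if Z: "zero_object D Z" for Z
    using TR1_identity[OF _ Z, of Z] tsub_zero[OF P Z] tsub_zero[OF Q Z] tsub_obj[OF P]
    unfolding extensions_def by blast
  show "S X \<in> ?E \<longleftrightarrow> X \<in> ?E" if X: "X \<in> Obj D" for X
  proof
    assume "X \<in> ?E"
    then obtain L R f g h where t: "L \<in> P" "R \<in> Q" "(L, X, R, f, g, h) \<in> Tri D"
      unfolding extensions_def by blast
    then have "S L \<in> P" "S R \<in> Q" using tsub_shift[OF P] tsub_shift[OF Q] tsub_obj[OF P] tsub_obj[OF Q] by auto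
    then show "S X \<in> ?E" using Tri_Shift[OF t(3)] unfolding extensions_def by blast
  next
    assume "S X \<in> ?E"
    then obtain L R f g h where t: "L \<in> P" "R \<in> Q" "(L, S X, R, f, g, h) \<in> Tri D"
      unfolding extensions_def by blast
    obtain L' R' where "L' \<in> P" "S L' = L" "R' \<in> Q" "S R' = R"
      using tsub_unshift[OF P t(1)] tsub_unshift[OF Q t(2)] by blast
    then show "X \<in> ?E" using Tri_Shift_inverse[of L' X R'] t(3) X tsub_obj[OF P] tsub_obj[OF Q]
      unfolding extensions_def by blast
  qed
  have coneL: "C \<in> ?E" if L: "L \<in> P" and M: "M \<in> ?E" and t: "(L, M, C, f, g, h) \<in> Tri D" for L M C f g h
  proof -
    obtain L1 R1 i p d where s: "L1 \<in> P" "R1 \<in> Q" "(L1, M, R1, i, p, d) \<in> Tri D"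
      using M unfolding extensions_def by blast
    note a = Tri_Ar[OF s(3)] and b = Tri_Ar[OF t]
    have "Comp D L M R1 p f \<in> Ar L R1" using a b by blast
    \<comment> \<open>The place where orthogonality enters: it makes \<open>f\<close> factor through
      the \<open>P\<close>-part of \<open>M\<close>.\<close>
    then have "Comp D L M R1 p f = Zero D L R1" using orth L s(2) unfolding left_perp_def by blast
    then obtain l where l: "l \<in> Ar L L1" "Comp D L L1 M i l = f" using Tri_lift[OF s(3) b(1)] by blast
    obtain C1 g1 h1 where c: "(L, L1, C1, l, g1, h1) \<in> Tri D" using cone_exists[OF l(1)] by blast
    have "C1 \<in> P" using tsub_cone[OF P c L s(1)] .
    moreover have "\<exists>u v w. (C1, C, R1, u, v, w) \<in> Tri D"
      using octahedron[OF c s(3)] t unfolding l(2) by blast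
    ultimately show ?thesis using s(2) unfolding extensions_def by blast
  qed
  have coneR: "C \<in> ?E" if R: "R \<in> Q" and M: "M \<in> ?E" and t: "(R, M, C, f, g, h) \<in> Tri D" for R M C f g h
  proof -
    obtain L1 R1 i p d where s: "L1 \<in> P" "R1 \<in> Q" "(L1, M, R1, i, p, d) \<in> Tri D"
      using M unfolding extensions_def by blast
    note a = Tri_Ar[OF s(3)] and b = Tri_Ar[OF t]
    have pf: "Comp D R M R1 p f \<in> Ar R R1" using a b by blast
    obtain C1 g1 h1 where c: "(R, R1, C1, Comp D R M R1 p f, g1, h1) \<in> Tri D"
      using cone_exists[OF pf] by blast
    have C1: "C1 \<in> Q" using tsub_cone[OF Q c R s(2)] .
    \<comment> \<open>The octahedron on the composite from \<open>R\<close> to \<open>R1\<close> has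
      \<open>S L1\<close> as its last term; rotating back exhibits \<open>C\<close> as an extension
      with \<open>L1\<close> on the left and \<open>C1\<close> on the right.\<close>
    obtain u v w where "(C, C1, S L1, u, v, w) \<in> Tri D"
      using octahedron[OF t rotate[OF s(3)] c] by blast
    then obtain W k where "S W = S L1" "(W, C, C1, k, u, v) \<in> Tri D" using rotate_inverse by blast
    moreover from this have "W = L1" using Shift_inj Tri_obj(1) tsub_obj[OF P s(1)] by blast
    ultimately show ?thesis using s(1) C1 unfolding extensions_def by blast
  qed
  show "C \<in> ?E" if t: "(M1, M2, C, f, g, h) \<in> Tri D" and M: "M1 \<in> ?E" "M2 \<in> ?E" for M1 M2 C f g h
  proof -
    obtain L1 R1 i p d where s: "L1 \<in> P" "R1 \<in> Q" "(L1, M1, R1, i, p, d) \<in> Tri D"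
      using M unfolding extensions_def by blast
    note a = Tri_Ar[OF s(3)] and b = Tri_Ar[OF t]
    have fi: "Comp D L1 M1 M2 f i \<in> Ar L1 M2" using a b by blast
    obtain C1 g1 h1 where c: "(L1, M2, C1, Comp D L1 M1 M2 f i, g1, h1) \<in> Tri D"
      using cone_exists[OF fi] by blast
    have "C1 \<in> ?E" by (rule coneL[OF s(1) M(2) c])
    moreover obtain u v w where "(R1, C1, C, u, v, w) \<in> Tri D" using octahedron[OF s(3) t c] by blast
    ultimately show ?thesis using coneR[OF s(2)] by blast
  qed
qed


section \<open>Semi-orthogonal decompositions and their maximality\<close>

lemma sod_iff:
  "sod T (P, Q) \<longleftrightarrow>
     tsub T \<and> tsub P \<and> tsub Q \<and>
     P \<subseteq> T \<and> Q \<subseteq> T \<and> P \<subseteq> left_perp Q \<and> T \<subseteq> extensions P Q"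
  using orthogonal_left_perp[OF tsub_subset tsub_subset, of P Q]
  unfolding semiorthogonal_decomposition_def extensions_def subset_iff by auto

lemma zero_object_left_perp: "X \<in> left_perp Q \<Longrightarrow> X \<in> Q \<Longrightarrow> zero_object D X"
  by (rule zero_objectI) (auto simp: left_perp_def)

text \<open>For \<open>M\<close> in \<open>P'\<close> the \<open>Q\<close>-part of its triangle lies
  in both \<open>P'\<close> and \<open>Q'\<close>, hence is zero, and \<open>M\<close> is isomorphic
  to its \<open>P\<close>-part; dually for \<open>Q'\<close>. This upgrades inclusions between
  orthogonal pairs to equalities.\<close>

lemma sod_maximal:
  assumes sod: "sod T (P, Q)"
    and P': "tsub P'" "P \<subseteq> P'"
    and Q': "tsub Q'" "Q \<subseteq> Q'"
    and orth: "P' \<subseteq> left_perp Q'"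
  shows "P' \<inter> T = P" "Q' \<inter> T = Q"
proof -
  note s = sod[unfolded sod_iff]
  have P: "tsub P" and Q: "tsub Q" using s by auto
  have dec: "\<exists>L\<in>P. \<exists>R\<in>Q. \<exists>f g h. (L, M, R, f, g, h) \<in> Tri D" if "M \<in> T" for M
    using that s unfolding extensions_def by blast
  have "M \<in> P" if M: "M \<in> P'" "M \<in> T" for M
  proof -
    obtain L R f g h where t: "L \<in> P" "R \<in> Q" "(L, M, R, f, g, h) \<in> Tri D" using dec M by blast
    have "R \<in> P'" using tsub_cone[OF P'(1) t(3)] t(1) P'(2) M by blast
    then have "zero_object D R" using zero_object_left_perp orth Q'(2) t(2) by blast
    then have "isomorphic D L M" using Tri_iso_of_zero_cone[OF t(3)] unfolding isomorphic_def by blast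
    then show ?thesis using tsub_iso[OF P t(1)] Tri_obj[OF t(3)] by blast
  qed
  then show "P' \<inter> T = P" using P' s by blast
  have "M \<in> Q" if M: "M \<in> Q'" "M \<in> T" for M
  proof -
    obtain L R f g h where t: "L \<in> P" "R \<in> Q" "(L, M, R, f, g, h) \<in> Tri D" using dec M by blast
    have "L \<in> Q'" using tsub_fiber[OF Q'(1) t(3)] t(2) Q'(2) M by blast
    then have "zero_object D L" using zero_object_left_perp orth P'(2) t(1) by blast
    then have "isomorphic D M R"
      using Tri_iso_of_zero_cone[OF rotate[OF t(3)]] zero_object_Shift unfolding isomorphic_def by blast
    then show ?thesis using tsub_iso[OF Q t(2)] isomorphic_sym Tri_obj[OF t(3)] by blast
  qed
  then show "Q' \<inter> T = Q" using Q' s by blast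
qed

text \<open>\<open>rperp P\<close> contains \<open>Q\<close> and is still orthogonal to
  \<open>P\<close>, so maximality applies with the first half unchanged.\<close>

lemma sod_right_perp:
  assumes "sod (Obj D) (P, Q)"
  shows "rperp P = Q"
proof -
  note s = assms[unfolded sod_iff]
  have o: "P \<subseteq> Obj D" "Q \<subseteq> Obj D" using s by auto
  have r: "rperp P \<subseteq> Obj D" by (auto simp: right_perp_def)
  have "rperp P \<inter> Obj D = Q"
    by (rule sod_maximal(2)[OF assms])
      (use s orthogonal_left_perp[OF o] orthogonal_right_perp[OF o]
        orthogonal_left_perp[OF o(1) r] orthogonal_right_perp[OF o(1) r] tsub_right_perp in auto)
  then show ?thesis using r by blast
qed

end

section \<open>Compact objects\<close>

locale triangulated_with_coproducts = triangulated_category D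
  for D :: "('o, 'm, 'x) tricat_scheme" +
  fixes \<kappa> :: "'u rel"
  assumes smallness: "smallness_cardinal \<kappa>"
    and small_coproducts: "has_small_coproducts \<kappa> D"
begin

abbreviation Loc :: "'o set \<Rightarrow> 'o set" where "Loc \<equiv> coprod_closure \<kappa> D"
abbreviation closed_coproducts :: "'o set \<Rightarrow> bool" where "closed_coproducts \<equiv> closed_under_coproducts \<kappa> D"

lemma coproduct_exists:
  assumes I: "small \<kappa> I" and X: "\<And>i. i \<in> I \<Longrightarrow> X i \<in> Obj D"
  shows "\<exists>P \<iota>. is_coproduct D I X P \<iota>"
proof -
  obtain e where e: "inj_on e I" "small \<kappa> (e ` I :: 'u set)"
    using small_inj[OF smallness I] small_image[OF I] by blast
  obtain P \<iota> where "is_coproduct D (e ` I) (\<lambda>j. X (inv_into I e j)) P \<iota>"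
    using small_coproducts e(2) X unfolding has_small_coproducts_def by (metis inv_into_into)
  from coproduct_reindex_inverse[OF this e(1)] show ?thesis by blast
qed

lemma closed_coproduct:
  assumes cl: "closed_coproducts T" and I: "small \<kappa> I"
    and X: "\<And>i. i \<in> I \<Longrightarrow> X i \<in> T" and c: "is_coproduct D I X P \<iota>"
  shows "P \<in> T"
proof -
  obtain e where e: "inj_on e I" "small \<kappa> (e ` I :: 'u set)"
    using small_inj[OF smallness I] small_image[OF I] by blast
  have "\<forall>j\<in>e ` I. X (inv_into I e j) \<in> T" using X by (simp add: inv_into_into)
  then show ?thesis using e(2) coproduct_reindex[OF c e(1)]
      cl[unfolded closed_under_coproducts_def, rule_format, of "e ` I" "\<lambda>j. X (inv_into I e j)" P]
    by blast
qed

text \<open>Compactness as an induction principle: a map from \<open>M\<close> to the coproduct is a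
  finite sum of maps through single summands. A property that holds for those and for zero, and that
  survives sums, therefore holds for all maps.\<close>

lemma compact_object_induct:
  assumes M: "compact_object \<kappa> D M" and I: "small \<kappa> I" and c: "is_coproduct D I X P \<iota>"
    and zero: "Q (Zero D M P)"
    and plus: "\<And>f g. f \<in> Ar M P \<Longrightarrow> g \<in> Ar M P \<Longrightarrow> Q f \<Longrightarrow> Q g \<Longrightarrow> Q (plus M P f g)"
    and inc: "\<And>i g. i \<in> I \<Longrightarrow> g \<in> Ar M (X i) \<Longrightarrow> Q (Comp D M (X i) P (\<iota> i) g)"
    and y: "y \<in> Ar M P"
  shows "Q y"
proof -
  obtain e where e: "inj_on e I" "small \<kappa> (e ` I :: 'u set)"
    using small_inj[OF smallness I] small_image[OF I] by blast
  define J where "J = e ` I"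
  define Y where "Y = (\<lambda>j. X (inv_into I e j))"
  define \<iota>' where "\<iota>' = (\<lambda>j. \<iota> (inv_into I e j))"
  have c': "is_coproduct D J Y P \<iota>'"
    unfolding J_def Y_def \<iota>'_def by (rule coproduct_reindex[OF c e(1)])
  have o: "M \<in> Obj D" "P \<in> Obj D" using y Ar_obj by auto
  interpret H: abelian_group "Hom D M P" by (rule Hom_abelian_group[OF o])
  have "bij_betw (\<lambda>g. \<Oplus>\<^bsub>Hom D M P\<^esub>i\<in>{i \<in> J. g i \<noteq> Zero D M (Y i)}. Comp D M (Y i) P (\<iota>' i) (g i))
          (carrier (sum_group J (\<lambda>i. add_monoid (Hom D M (Y i))))) (Mor D M P)"
    using M e(2) c' unfolding compact_object_def J_def by blast
  then have "y \<in> (\<lambda>g. \<Oplus>\<^bsub>Hom D M P\<^esub>i\<in>{i \<in> J. g i \<noteq> Zero D M (Y i)}. Comp D M (Y i) P (\<iota>' i) (g i)) `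
          carrier (sum_group J (\<lambda>i. add_monoid (Hom D M (Y i))))"
    using y unfolding bij_betw_def Ar_def by blast
  then obtain g where g: "g \<in> carrier (sum_group J (\<lambda>i. add_monoid (Hom D M (Y i))))"
    and yg: "y = (\<Oplus>\<^bsub>Hom D M P\<^esub>i\<in>{i \<in> J. g i \<noteq> Zero D M (Y i)}. Comp D M (Y i) P (\<iota>' i) (g i))"
    by blast
  have Yo: "Y i \<in> Obj D" if "i \<in> J" for i using coproduct_Ar(2)[OF c' that] Ar_obj by blast
  have "group (add_monoid (Hom D M (Y i)))" if "i \<in> J" for i
    using Hom_abelian_group[OF o(1) Yo[OF that]] abelian_group.a_group by blast
  then have "g \<in> {x \<in> \<Pi>\<^sub>E i\<in>J. carrier (add_monoid (Hom D M (Y i))).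
      finite {i \<in> J. x i \<noteq> \<one>\<^bsub>add_monoid (Hom D M (Y i))\<^esub>}}"
    using g carrier_sum_group[of J "\<lambda>i. add_monoid (Hom D M (Y i))"] by blast
  then have fin: "finite {i \<in> J. g i \<noteq> Zero D M (Y i)}" and gi: "\<And>i. i \<in> J \<Longrightarrow> g i \<in> Ar M (Y i)"
    using o Yo by (auto simp: Ar_def PiE_iff)
  have Qi: "Q (Comp D M (Y i) P (\<iota>' i) (g i))" if "i \<in> J" for i
    using that inc gi[OF that] unfolding J_def Y_def \<iota>'_def by (simp add: inv_into_into)
  have Ci: "Comp D M (Y i) P (\<iota>' i) (g i) \<in> Ar M P" if "i \<in> J" for i
    using gi[OF that] coproduct_Ar(2)[OF c' that] by blast
  have "F \<subseteq> J \<Longrightarrow> (\<Oplus>\<^bsub>Hom D M P\<^esub>i\<in>F. Comp D M (Y i) P (\<iota>' i) (g i)) \<in> Ar M P \<and>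
     Q (\<Oplus>\<^bsub>Hom D M P\<^esub>i\<in>F. Comp D M (Y i) P (\<iota>' i) (g i))" if "finite F" for F
    using that
  proof (induction F)
    case empty
    then show ?case using zero o by simp
  next
    case (insert i F)
    have "(\<Oplus>\<^bsub>Hom D M P\<^esub>i\<in>insert i F. Comp D M (Y i) P (\<iota>' i) (g i)) =
      plus M P (Comp D M (Y i) P (\<iota>' i) (g i)) (\<Oplus>\<^bsub>Hom D M P\<^esub>i\<in>F. Comp D M (Y i) P (\<iota>' i) (g i))"
      using insert Ci by (intro H.finsum_insert) (auto simp: Ar_def)
    then show ?case using insert plus Qi Ci by auto
  qed
  then show ?thesis using fin yg by auto
qed

text \<open>A map out of a coproduct is determined by its components.\<close>

lemma closed_left_perp: "closed_coproducts (left_perp Q)"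
  unfolding closed_under_coproducts_def
proof (intro allI impI, elim conjE)
  fix I :: "'u set" and X P \<iota>
  assume X: "\<forall>i\<in>I. X i \<in> left_perp Q" and c: "is_coproduct D I X P \<iota>"
  show "P \<in> left_perp Q"
    unfolding left_perp_def
  proof (intro CollectI conjI ballI)
    show P: "P \<in> Obj D" by (rule coproduct_Ar[OF c])
    fix Y f assume Y: "Y \<in> Q" and f: "f \<in> Ar P Y"
    show "f = Zero D P Y"
    proof (rule coproduct_map_eq[OF c f])
      show "Zero D P Y \<in> Ar P Y" using P f Ar_obj by blast
      fix i assume i: "i \<in> I"
      have a: "\<iota> i \<in> Ar (X i) P" using coproduct_Ar(2)[OF c i] .
      have "Comp D (X i) P Y f (\<iota> i) = Zero D (X i) Y"
        using X i Y comp_Ar[OF a f] unfolding left_perp_def by blast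
      then show "Comp D (X i) P Y f (\<iota> i) = Comp D (X i) P Y (Zero D P Y) (\<iota> i)"
        using a f Ar_obj[OF f] by simp
    qed
  qed
qed

lemma closed_right_perp:
  assumes T: "\<forall>M\<in>T. compact_object \<kappa> D M"
  shows "closed_coproducts (rperp T)"
  unfolding closed_under_coproducts_def
proof (intro allI impI, elim conjE)
  fix I :: "'u set" and X P \<iota>
  assume I: "small \<kappa> I" and X: "\<forall>i\<in>I. X i \<in> rperp T" and c: "is_coproduct D I X P \<iota>"
  have To: "T \<subseteq> Obj D" using T by (auto simp: compact_object_def)
  note iff = right_perp_iff[OF To]
  show "P \<in> rperp T" unfolding iff
  proof (intro conjI ballI)
    show P: "P \<in> Obj D" by (rule coproduct_Ar[OF c])
    fix M f assume M: "M \<in> T" and f: "f \<in> Ar M P"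
    have Mo: "M \<in> Obj D" using M To by blast
    show "f = Zero D M P"
    proof (rule compact_object_induct[where Q="\<lambda>f. f = Zero D M P", OF _ I c _ _ _ f])
      show "Comp D M (X i) P (\<iota> i) g = Zero D M P" if i: "i \<in> I" and g: "g \<in> Ar M (X i)" for i g
      proof -
        have "g = Zero D M (X i)" using X i g M by (simp add: iff)
        then show ?thesis using coproduct_Ar(2)[OF c i] Mo by simp
      qed
    qed (use T M Mo P in auto)
  qed
qed

lemma closed_Obj: "closed_coproducts (Obj D)"
  unfolding closed_under_coproducts_def using coproduct_Ar(1) by blast

text \<open>The third term of the coproduct triangle is known only up to isomorphism; closure of
  \<open>Q\<close> under isomorphism absorbs this.\<close>

lemma closed_extensions:
  assumes P: "closed_coproducts P" "P \<subseteq> Obj D"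
    and Q: "closed_coproducts Q" "tsub Q"
  shows "closed_coproducts (extensions P Q)"
  unfolding closed_under_coproducts_def
proof (intro allI impI, elim conjE)
  fix I :: "'u set" and M PM \<iota>
  assume I: "small \<kappa> I" and M: "\<forall>i\<in>I. M i \<in> extensions P Q" and c: "is_coproduct D I M PM \<iota>"
  have "\<forall>i\<in>I. \<exists>L R f g h. L \<in> P \<and> R \<in> Q \<and> (L, M i, R, f, g, h) \<in> Tri D"
    using M unfolding extensions_def by blast
  then obtain L R f g h where t: "\<And>i. i \<in> I \<Longrightarrow> L i \<in> P \<and> R i \<in> Q \<and> (L i, M i, R i, f i, g i, h i) \<in> Tri D"
    by metis
  obtain PL a where L: "is_coproduct D I L PL a" using coproduct_exists[OF I, of L] t P by blast
  obtain PR b where R: "is_coproduct D I R PR b" using coproduct_exists[OF I, of R] t tsub_obj[OF Q(2)] by blast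
  have "PL \<in> P" "PR \<in> Q" using closed_coproduct[OF P(1) I _ L] closed_coproduct[OF Q(1) I _ R] t by auto
  obtain C F p q where C: "(PL, PM, C, F, p, q) \<in> Tri D" "isomorphic D PR C"
    using coproduct_Tri[of I L M R f g h, OF _ L c R] t by blast
  have "C \<in> Q" using tsub_iso[OF Q(2) \<open>PR \<in> Q\<close> _ C(2)] Tri_obj[OF C(1)] by blast
  then show "PM \<in> extensions P Q" using \<open>PL \<in> P\<close> C(1) unfolding extensions_def by blast
qed

lemma coprod_closure_least:
  "tsub U \<Longrightarrow> closed_coproducts U \<Longrightarrow> T \<subseteq> U \<Longrightarrow> Loc T \<subseteq> U"
  unfolding coprod_closure_def by blast

lemma coprod_closure_extensive: "T \<subseteq> Loc T"
  unfolding coprod_closure_def by blast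

lemma closed_coprod_closure: "closed_coproducts (Loc T)"
  unfolding closed_under_coproducts_def
proof (intro allI impI)
  fix I :: "'u set" and X P \<iota>
  assume a: "small \<kappa> I \<and> (\<forall>i\<in>I. X i \<in> Loc T) \<and> is_coproduct D I X P \<iota>"
  show "P \<in> Loc T"
    unfolding coprod_closure_def
  proof (intro InterI)
    fix U assume U: "U \<in> {S. tsub S \<and> closed_coproducts S \<and> T \<subseteq> S}"
    then have "Loc T \<subseteq> U" using coprod_closure_least by blast
    then show "P \<in> U" using U a unfolding closed_under_coproducts_def by blast
  qed
qed

lemma tsub_coprod_closure: "T \<subseteq> Obj D \<Longrightarrow> tsub (Loc T)"
  unfolding coprod_closure_def by (rule tsub_Inter) (use tsub_Obj closed_Obj in auto)

lemma coprod_closure_mono: "T \<subseteq> T' \<Longrightarrow> Loc T \<subseteq> Loc T'"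
  unfolding coprod_closure_def by blast

lemma coprod_closure_obj: "T \<subseteq> Obj D \<Longrightarrow> Loc T \<subseteq> Obj D"
  by (rule coprod_closure_least[OF tsub_Obj closed_Obj])

lemma left_perp_antimono: "Q \<subseteq> Q' \<Longrightarrow> left_perp Q' \<subseteq> left_perp Q"
  unfolding left_perp_def by blast

text \<open>Orthogonality of the closures is a separate hypothesis because it has two sources:
  compactness for the decomposition of the whole category, and an ambient decomposition for
  restrictions.\<close>

lemma sod_coprod_closure:
  assumes sod: "sod T (P, Q)"
    and orth: "Loc P \<subseteq> left_perp (Loc Q)"
  shows "sod (Loc T) (Loc P, Loc Q)"
proof -
  note s = sod[unfolded sod_iff]
  have o: "T \<subseteq> Obj D" "P \<subseteq> Obj D" "Q \<subseteq> Obj D" using s tsub_subset by auto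
  note P = tsub_coprod_closure[OF o(2)] and Q = tsub_coprod_closure[OF o(3)]
  let ?E = "extensions (Loc P) (Loc Q)"
  have "T \<subseteq> ?E" using s coprod_closure_extensive unfolding extensions_def by blast
  then have "Loc T \<subseteq> ?E"
    by (intro coprod_closure_least tsub_extensions P Q orth closed_extensions closed_coprod_closure
        coprod_closure_obj o)
  then show ?thesis
    unfolding sod_iff using s orth P Q tsub_coprod_closure[OF o(1)] coprod_closure_mono by auto
qed

text \<open>The order matters: \<open>Q\<close> is enlarged first, while the objects on the left are
  still compact; then \<open>P\<close> is enlarged, since left orthogonals are always
  localizing.\<close>

lemma orthogonal_coprod_closure:
  assumes P: "tsub P" "\<forall>M\<in>P. compact_object \<kappa> D M"
    and Q: "Q \<subseteq> Obj D" and orth: "P \<subseteq> left_perp Q"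
  shows "Loc P \<subseteq> left_perp (Loc Q)"
proof -
  let ?R = "rperp P" and ?Q = "Loc Q"
  note Po = tsub_subset[OF P(1)] and Qo = coprod_closure_obj[OF Q]
  have "Q \<subseteq> ?R" using orthogonal_left_perp[OF Po Q] orthogonal_right_perp[OF Po Q] orth by blast
  then have "?Q \<subseteq> ?R"
    by (intro coprod_closure_least tsub_right_perp P closed_right_perp)
  then have "P \<subseteq> left_perp ?Q"
    using orthogonal_left_perp[OF Po Qo] orthogonal_right_perp[OF Po Qo] by blast
  then show ?thesis
    by (intro coprod_closure_least tsub_left_perp tsub_coprod_closure Q closed_left_perp)
qed

text \<open>
  The homotopy colimit of \<open>A 0 \<rightarrow> A 1 \<rightarrow> \<dots>\<close>. That a map \<open>X \<rightarrow> B\<close> lifts to \<open>K\<close> amounts to \<open>id - s\<close> being injective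
  on \<open>D(X, K)\<close>: with \<open>e n\<close> the projection to the first \<open>n\<close> summands, \<open>e (Suc n) s = s (e n)\<close>, so \<open>s y = y\<close>
  forces \<open>e n y = 0\<close> for all \<open>n\<close>, while \<open>e n y = y\<close> for large \<open>n\<close> by compactness.
\<close>

lemma telescope:
  assumes A: "\<And>n. t n \<in> Ar (A n) (A (Suc n))" and c: "is_coproduct D (UNIV :: nat set) A K \<iota>"
    and P: "tsub P" "\<forall>M\<in>P. compact_object \<kappa> D M"
  shows "\<exists>B j \<phi> p d. (K, K, B, \<phi>, p, d) \<in> Tri D \<and> (\<forall>n. j n \<in> Ar (A n) B) \<and>
    (\<forall>n. Comp D (A n) (A (Suc n)) B (j (Suc n)) (t n) = j n) \<and>
    (\<forall>M a. (\<forall>n. a n \<in> Ar (A n) M \<and> Comp D (A n) (A (Suc n)) M (a (Suc n)) (t n) = a n) \<longrightarrow>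
        (\<exists>b\<in>Ar B M. \<forall>n. Comp D (A n) B M b (j n) = a n)) \<and>
    (\<forall>X\<in>P. \<forall>y\<in>Ar X B. \<exists>n. \<exists>g\<in>Ar X (A n). y = Comp D X (A n) B (j n) g)"
proof -
  have Ao: "A n \<in> Obj D" for n using A[of n] Ar_obj by blast
  have K: "K \<in> Obj D" and i: "\<And>n. \<iota> n \<in> Ar (A n) K" using coproduct_Ar[OF c] by auto
  have "\<And>n. Comp D (A n) (A (Suc n)) K (\<iota> (Suc n)) (t n) \<in> Ar (A n) K" using i A by blast
  then obtain s where s: "s \<in> Ar K K" "\<And>n. Comp D (A n) K K s (\<iota> n) = Comp D (A n) (A (Suc n)) K (\<iota> (Suc n)) (t n)"
    using coproduct_exists_map[OF c K, of "\<lambda>n. Comp D (A n) (A (Suc n)) K (\<iota> (Suc n)) (t n)"] by auto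
  define \<phi> where "\<phi> = diff K K (Id D K) s"
  have \<phi>: "\<phi> \<in> Ar K K" unfolding \<phi>_def using s K by blast
  obtain B p d where B: "(K, K, B, \<phi>, p, d) \<in> Tri D" using cone_exists[OF \<phi>] by blast
  note a = Tri_Ar[OF B]
  have Bo: "B \<in> Obj D" using Tri_obj[OF B] by blast
  have "Comp D K K B p \<phi> = diff K B p (Comp D K K B p s)"
    unfolding \<phi>_def using s a K by (subst comp_diff_right) auto
  then have ps: "Comp D K K B p s = p"
    using Tri_comp_zero(1)[OF B] diff_eq_zero[OF a(2) comp_Ar[OF s(1) a(2)]] by simp
  define j where "j n = Comp D (A n) K B p (\<iota> n)" for n
  have j: "j n \<in> Ar (A n) B" for n unfolding j_def using i a by blast
  have jt: "Comp D (A n) (A (Suc n)) B (j (Suc n)) (t n) = j n" for n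
    unfolding j_def using assoc[OF A[of n] i[of "Suc n"] a(2)] assoc[OF i[of n] s(1) a(2)] s(2)[of n] ps by simp
  \<comment> \<open>A compatible family assembles to a map on \<open>K\<close> that is invariant
    under \<open>s\<close>, hence killed by \<open>\<phi>\<close>, hence extends to the cone. Only
    existence is obtained: \<open>B\<close> is a weak colimit.\<close>
  have ext: "\<exists>b\<in>Ar B M. \<forall>n. Comp D (A n) B M b (j n) = m n"
    if m: "\<And>n. m n \<in> Ar (A n) M \<and> Comp D (A n) (A (Suc n)) M (m (Suc n)) (t n) = m n" for M m
  proof -
    have M: "M \<in> Obj D" using m Ar_obj by blast
    obtain r where r: "r \<in> Ar K M" "\<And>n. Comp D (A n) K M r (\<iota> n) = m n"
      using coproduct_exists_map[OF c M, of m] m by auto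
    have "Comp D K K M r s = r"
    proof (rule coproduct_map_eq[OF c])
      show "Comp D (A n) K M (Comp D K K M r s) (\<iota> n) = Comp D (A n) K M r (\<iota> n)" for n
        using assoc[OF i s(1) r(1)] s(2)[of n] assoc[OF A[of n] i[of "Suc n"] r(1)] r(2) m[of n] by simp
    qed (use r s in auto)
    then have "Comp D K K M r \<phi> = Zero D K M"
      unfolding \<phi>_def using s r K M by (subst comp_diff_right) auto
    then obtain b where b: "b \<in> Ar B M" "Comp D K B M b p = r" using Tri_extend[OF B r(1)] by blast
    have "Comp D (A n) B M b (j n) = m n" for n
      unfolding j_def using assoc[OF i[of n] a(2) b(1)] b(2) r(2) by simp
    then show ?thesis using b by blast
  qed
  have inj: "y = Zero D X K" if X: "X \<in> P" and y: "y \<in> Ar X K" and 0: "Comp D X K K \<phi> y = Zero D X K" for X y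
  proof -
    have Xo: "X \<in> Obj D" using y Ar_obj by blast
    have ys: "Comp D X K K s y = y"
      using 0 comp_diff_left[OF y Id_Ar[OF K] s(1)] diff_eq_zero[OF y comp_Ar[OF y s(1)]] y
      unfolding \<phi>_def by simp
    have "\<exists>e\<in>Ar K K. \<forall>i. Comp D (A i) K K e (\<iota> i) = (if i < n then \<iota> i else Zero D (A i) K)" for n
      using coproduct_exists_map[OF c K, of "\<lambda>i. if i < n then \<iota> i else Zero D (A i) K"] i Ao K by auto
    then obtain e where e: "\<And>n. e n \<in> Ar K K"
      "\<And>n i. Comp D (A i) K K (e n) (\<iota> i) = (if i < n then \<iota> i else Zero D (A i) K)" by metis
    have e0: "e 0 = Zero D K K"
      by (rule coproduct_map_eq[OF c]) (use e i K in auto)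
    \<comment> \<open>\<open>s\<close> raises the index of a summand by one. On \<open>A k\<close>
      both sides vanish unless \<open>k < n\<close>, that is \<open>Suc k < Suc n\<close>, which
      explains the shifted index on the left.\<close>
    have es: "Comp D K K K (e (Suc n)) s = Comp D K K K s (e n)" for n
    proof (rule coproduct_map_eq[OF c])
      fix k :: nat
      have "Comp D (A k) K K (Comp D K K K (e (Suc n)) s) (\<iota> k)
          = Comp D (A k) (A (Suc k)) K (Comp D (A (Suc k)) K K (e (Suc n)) (\<iota> (Suc k))) (t k)"
        using assoc[OF i[of k] s(1) e(1)[of "Suc n"]] s(2)[of k] assoc[OF A[of k] i[of "Suc k"] e(1)[of "Suc n"]] by simp
      also have "\<dots> = Comp D (A k) K K s (Comp D (A k) K K (e n) (\<iota> k))"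
        using e(2) s A[of k] K Ao by simp
      finally show "Comp D (A k) K K (Comp D K K K (e (Suc n)) s) (\<iota> k) = Comp D (A k) K K (Comp D K K K s (e n)) (\<iota> k)"
        using assoc[OF i[of k] e(1)[of n] s(1)] by simp
    qed (use e s in auto)
    have z: "Comp D X K K (e n) y = Zero D X K" for n
    proof (induction n)
      case 0
      then show ?case using e0 y K by simp
    next
      case (Suc n)
      have "Comp D X K K (e (Suc n)) y = Comp D X K K (Comp D K K K (e (Suc n)) s) y"
        using assoc[OF y s(1) e(1)] ys by simp
      also have "\<dots> = Comp D X K K s (Comp D X K K (e n) y)" unfolding es using assoc[OF y e(1) s(1)] .
      finally show ?case using Suc s Xo by simp
    qed
    have "\<exists>n. \<forall>m\<ge>n. Comp D X K K (e m) y = y"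
    proof (rule compact_object_induct[where Q="\<lambda>y. \<exists>n. \<forall>m\<ge>n. Comp D X K K (e m) y = y",
          OF _ small_natural[OF smallness] c _ _ _ y])
      show "compact_object \<kappa> D X" using P X by blast
      show "\<exists>n. \<forall>m\<ge>n. Comp D X K K (e m) (Zero D X K) = Zero D X K" using e Xo by auto
    next
      fix f g assume f: "f \<in> Ar X K" and g: "g \<in> Ar X K"
        and "\<exists>n. \<forall>m\<ge>n. Comp D X K K (e m) f = f" "\<exists>n. \<forall>m\<ge>n. Comp D X K K (e m) g = g"
      then obtain n n' where "\<forall>m\<ge>n. Comp D X K K (e m) f = f" "\<forall>m\<ge>n'. Comp D X K K (e m) g = g" by blast
      then have "\<forall>m\<ge>max n n'. Comp D X K K (e m) (plus X K f g) = plus X K f g"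
        using comp_plus_right[OF f g e(1)] by simp
      then show "\<exists>n. \<forall>m\<ge>n. Comp D X K K (e m) (plus X K f g) = plus X K f g" by blast
    next
      fix k g assume g: "g \<in> Ar X (A k)"
      have "Comp D X K K (e m) (Comp D X (A k) K (\<iota> k) g) = Comp D X (A k) K (\<iota> k) g" if "m \<ge> Suc k" for m
        using assoc[OF g i[of k] e(1)[of m]] e(2)[of k m] that by simp
      then show "\<exists>n. \<forall>m\<ge>n. Comp D X K K (e m) (Comp D X (A k) K (\<iota> k) g) = Comp D X (A k) K (\<iota> k) g" by blast
    qed
    then show ?thesis using z by auto
  qed
  have fac: "\<exists>n. \<exists>g\<in>Ar X (A n). y = Comp D X (A n) B (j n) g" if X: "X \<in> P" and y: "y \<in> Ar X B" for X y
  proof -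
    \<comment> \<open>The connecting map of \<open>y\<close> has target \<open>S K\<close>, so
      injectivity is applied to its desuspension, a map out of \<open>X'\<close>.\<close>
    obtain X' where X': "X' \<in> P" "S X' = X" using tsub_unshift[OF P(1) X] by blast
    have Xo: "X \<in> Obj D" "X' \<in> Obj D" using tsub_obj[OF P(1)] X X' by auto
    have "Comp D X B (S K) d y \<in> Ar (S X') (S K)" using a y X' by auto
    then obtain k where k: "k \<in> Ar X' K" "SM X' K k = Comp D X B (S K) d y" using SM_surj Xo K by metis
    have "SM X' K (Comp D X' K K \<phi> k) = Comp D X (S K) (S K) (SM K K \<phi>) (Comp D X B (S K) d y)"
      using SM_comp[OF k(1) \<phi>] k(2) X' by simp
    also have "\<dots> = Comp D X B (S K) (Comp D B (S K) (S K) (SM K K \<phi>) d) y"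
      using assoc[OF y a(3) SM_Ar[OF \<phi>]] by simp
    also have "\<dots> = Zero D X (S K)" using Tri_comp_zero(3)[OF B] y K by simp
    finally have "Comp D X' K K \<phi> k = Zero D X' K" using SM_eq_zero[of "Comp D X' K K \<phi> k" X' K] k \<phi> X' by auto
    then have "k = Zero D X' K" using inj X'(1) k(1) by blast
    then have "Comp D X B (S K) d y = Zero D X (S K)" using k X' Xo K by auto
    then obtain x where x: "x \<in> Ar X K" "Comp D X K B p x = y" using Tri_lift3[OF B y] by blast
    \<comment> \<open>A factorization through all late stages, rather than through some stage, so
      that the factorizations of two maps meet at a common stage and can be added.\<close>
    let ?Q = "\<lambda>x. \<exists>N. \<forall>n\<ge>N. \<exists>g\<in>Ar X (A n). Comp D X K B p x = Comp D X (A n) B (j n) g"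
    have "?Q x"
    proof (rule compact_object_induct[where Q="?Q", OF _ small_natural[OF smallness] c _ _ _ x(1)])
      show "compact_object \<kappa> D X" using P X by blast
      have "Comp D X K B p (Zero D X K) = Comp D X (A n) B (j n) (Zero D X (A n))" for n
        using j[of n] a Xo by simp
      then show "?Q (Zero D X K)" using Xo Ao by blast
    next
      fix f g assume f: "f \<in> Ar X K" and g: "g \<in> Ar X K" and "?Q f" "?Q g"
      then obtain N N' where N: "\<And>n. n \<ge> N \<Longrightarrow> \<exists>h\<in>Ar X (A n). Comp D X K B p f = Comp D X (A n) B (j n) h"
        "\<And>n. n \<ge> N' \<Longrightarrow> \<exists>h\<in>Ar X (A n). Comp D X K B p g = Comp D X (A n) B (j n) h" by blast
      have "\<exists>h\<in>Ar X (A n). Comp D X K B p (plus X K f g) = Comp D X (A n) B (j n) h" if n: "n \<ge> max N N'" for n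
      proof -
        obtain h h' where h: "h \<in> Ar X (A n)" "Comp D X K B p f = Comp D X (A n) B (j n) h"
          "h' \<in> Ar X (A n)" "Comp D X K B p g = Comp D X (A n) B (j n) h'"
          using N(1)[of n] N(2)[of n] n by auto
        have "Comp D X K B p (plus X K f g) = Comp D X (A n) B (j n) (plus X (A n) h h')"
          using comp_plus_right[OF f g a(2)] comp_plus_right[OF h(1,3) j] h(2,4) by simp
        then show ?thesis using h by blast
      qed
      then show "?Q (plus X K f g)" by blast
    next
      fix k g assume g: "g \<in> Ar X (A k)"
      have "\<exists>h\<in>Ar X (A n). Comp D X (A k) B (j k) g = Comp D X (A n) B (j n) h" if "n \<ge> k" for n
        using that
      proof (induction n rule: dec_induct)
        case base
        then show ?case using g by blast
      next
        case (step n)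
        then obtain h where h: "h \<in> Ar X (A n)" "Comp D X (A k) B (j k) g = Comp D X (A n) B (j n) h" by blast
        have "Comp D X (A n) B (j n) h = Comp D X (A (Suc n)) B (j (Suc n)) (Comp D X (A n) (A (Suc n)) (t n) h)"
          using assoc[OF h(1) A[of n] j[of "Suc n"]] jt[of n] by simp
        then show ?case using h A by (metis comp_Ar)
      qed
      moreover have "Comp D X K B p (Comp D X (A k) K (\<iota> k) g) = Comp D X (A k) B (j k) g"
        unfolding j_def using assoc[OF g i[of k] a(2)] by simp
      ultimately show "?Q (Comp D X (A k) K (\<iota> k) g)" by auto
    qed
    then show ?thesis using x(2) by blast
  qed
  show ?thesis using B j jt ext fac by blast
qed


text \<open>\<open>K\<close> is the coproduct of the sources of all admissible maps to
  \<open>A\<close>, one copy for each map, with sources in a small set of representatives; local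
  smallness bounds the index set. Stability of \<open>Q\<close> under precomposition moves a map
  from any object of \<open>P\<close> to a representative. \<open>Q\<close> will be trivial at the
  first stage of the tower and mean being killed in \<open>M\<close> at the later ones.\<close>

lemma weak_cover:
  assumes ls: "locally_small \<kappa> D" and P: "P \<subseteq> Obj D" and es: "essentially_small \<kappa> D P"
    and U: "tsub U" "closed_coproducts U" "P \<subseteq> U"
    and A: "A \<in> Obj D"
    and Q: "\<And>X Y f w. Q X f \<Longrightarrow> f \<in> Ar X A \<Longrightarrow> w \<in> Ar Y X \<Longrightarrow> Q Y (Comp D Y X A f w)"
  shows "\<exists>K\<in>U. \<exists>u\<in>Ar K A.
    (\<forall>X\<in>P. \<forall>f\<in>Ar X A. Q X f \<longrightarrow> (\<exists>x\<in>Ar X K. Comp D X K A u x = f)) \<and>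
    (\<forall>M. \<forall>a\<in>Ar A M. (\<forall>X\<in>P. \<forall>f\<in>Ar X A. Q X f \<longrightarrow> Comp D X A M a f = Zero D X M) \<longrightarrow>
      Comp D K A M a u = Zero D K M)"
proof -
  obtain S0 where S0: "S0 \<subseteq> P" "small \<kappa> S0" "\<forall>X\<in>P. \<exists>Y\<in>S0. isomorphic D X Y"
    using es unfolding essentially_small_def by blast
  define I where "I = Sigma S0 (\<lambda>X. {f \<in> Ar X A. Q X f})"
  have "small \<kappa> (Ar X A)" if "X \<in> S0" for X
    using ls that S0(1) P A by (auto simp: locally_small_def Ar_Mor[symmetric])
  then have I: "small \<kappa> I"
    unfolding I_def by (intro small_Sigma[OF smallness S0(2)]) (auto intro: small_subset)
  have fst_I: "fst i \<in> P" and snd_I: "snd i \<in> Ar (fst i) A" "Q (fst i) (snd i)" if "i \<in> I" for i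
    using that S0(1) unfolding I_def by auto
  then obtain K \<iota> where c: "is_coproduct D I fst K \<iota>"
    using coproduct_exists[OF I, of fst] P by blast
  have K: "K \<in> U" using closed_coproduct[OF U(2) I _ c] fst_I U(3) by blast
  note Ko = coproduct_Ar[OF c]
  obtain u where u: "u \<in> Ar K A" "\<forall>i\<in>I. Comp D (fst i) K A u (\<iota> i) = snd i"
    using coproduct_exists_map[OF c A, of snd] snd_I by blast
  have "\<exists>x\<in>Ar X K. Comp D X K A u x = f" if X: "X \<in> P" and f: "f \<in> Ar X A" and Qf: "Q X f" for X f
  proof -
    have Xo: "X \<in> Obj D" using f Ar_obj by blast
    obtain Y where Y: "Y \<in> S0" "isomorphic D X Y" using S0(3) X by blast
    have Yo: "Y \<in> Obj D" using Y S0(1) P by blast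
    obtain v w where v: "v \<in> Ar X Y" "w \<in> Ar Y X" "Comp D X Y X w v = Id D X"
      using Y(2) Xo Yo by (auto simp: isomorphic_def is_iso_Ar)
    have i: "(Y, Comp D Y X A f w) \<in> I" (is "?i \<in> I")
      unfolding I_def using Y(1) f v Q[OF Qf f v(2)] by blast
    have iA: "\<iota> ?i \<in> Ar Y K" using Ko(2)[OF i] by simp
    have "Comp D Y K A u (\<iota> ?i) = Comp D Y X A f w" using u(2) i by auto
    then have "Comp D X K A u (Comp D X Y K (\<iota> ?i) v) = f"
      using assoc[OF v(1) iA u(1)] assoc[OF v(1,2) f] v(3) f by simp
    moreover have "Comp D X Y K (\<iota> ?i) v \<in> Ar X K" using iA v by blast
    ultimately show ?thesis by blast
  qed
  moreover have "Comp D K A M a u = Zero D K M"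
    if a: "a \<in> Ar A M" and 0: "\<forall>X\<in>P. \<forall>f\<in>Ar X A. Q X f \<longrightarrow> Comp D X A M a f = Zero D X M" for M a
  proof (rule coproduct_map_eq[OF c])
    have M: "M \<in> Obj D" using a Ar_obj by blast
    show "Comp D K A M a u \<in> Ar K M" "Zero D K M \<in> Ar K M" using a u M Ko by auto
    fix i assume i: "i \<in> I"
    have "Comp D (fst i) K M (Comp D K A M a u) (\<iota> i) = Zero D (fst i) M"
      using assoc[OF Ko(2)[OF i] u(1) a] u(2) i fst_I[OF i] snd_I[OF i] 0 by auto
    then show "Comp D (fst i) K M (Comp D K A M a u) (\<iota> i) = Comp D (fst i) K M (Zero D K M) (\<iota> i)"
      using Ko(2)[OF i] M by simp
  qed
  ultimately show ?thesis using K u(1) by blast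
qed

text \<open>\<open>A'\<close> is the cone of the cover \<open>u\<close> of the maps killed by
  \<open>a\<close>: every such map factors through \<open>u\<close> and so dies in the cone, while
  \<open>a\<close> extends to the cone because it kills \<open>u\<close>.\<close>

lemma kill_maps:
  assumes ls: "locally_small \<kappa> D" and P: "P \<subseteq> Obj D" and es: "essentially_small \<kappa> D P"
    and U: "tsub U" "closed_coproducts U" "P \<subseteq> U"
    and A: "A \<in> U" and a: "a \<in> Ar A M"
  shows "\<exists>A' t a'. A' \<in> U \<and> t \<in> Ar A A' \<and> a' \<in> Ar A' M \<and> Comp D A A' M a' t = a \<and>
    (\<forall>X\<in>P. \<forall>f\<in>Ar X A. Comp D X A M a f = Zero D X M \<longrightarrow> Comp D X A A' t f = Zero D X A')"
proof -
  have Ao: "A \<in> Obj D" "M \<in> Obj D" using a Ar_obj by auto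
  have "Comp D Y A M a (Comp D Y X A f w) = Zero D Y M"
    if "Comp D X A M a f = Zero D X M" "f \<in> Ar X A" "w \<in> Ar Y X" for X Y f w
    using assoc[OF that(3,2) a] that Ao by simp
  note cover = weak_cover[OF ls P es U Ao(1), of "\<lambda>X f. Comp D X A M a f = Zero D X M", OF this]
  obtain K u where K: "K \<in> U" "u \<in> Ar K A"
    and lift: "\<forall>X\<in>P. \<forall>f\<in>Ar X A. Comp D X A M a f = Zero D X M \<longrightarrow> (\<exists>x\<in>Ar X K. Comp D X K A u x = f)"
    and 0: "Comp D K A M a u = Zero D K M"
    using cover a by blast
  obtain A' t h where t: "(K, A, A', u, t, h) \<in> Tri D" using cone_exists[OF K(2)] by blast
  obtain a' where a': "a' \<in> Ar A' M" "Comp D A A' M a' t = a" using Tri_extend[OF t a 0] by blast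
  have "Comp D X A A' t f = Zero D X A'"
    if f: "X \<in> P" "f \<in> Ar X A" "Comp D X A M a f = Zero D X M" for X f
  proof -
    obtain x where x: "x \<in> Ar X K" "Comp D X K A u x = f" using lift f by blast
    then show ?thesis
      using assoc[OF x(1) K(2) Tri_Ar(2)[OF t]] Tri_comp_zero(1)[OF t] Tri_obj[OF t] by simp
  qed
  moreover have "A' \<in> U" using tsub_cone[OF U(1) t K(1) A] .
  ultimately show ?thesis using Tri_Ar[OF t] a' by blast
qed

text \<open>For \<open>X\<close> in \<open>P\<close> the map from \<open>D(X, B)\<close> to
  \<open>D(X, M)\<close> is bijective. It is onto because the first stage already covers
  \<open>M\<close>; it is injective because a map to \<open>B\<close> that dies in \<open>M\<close>
  comes from some stage and is killed at the next. Hence the cone \<open>N\<close> is right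
  orthogonal to \<open>P\<close>.\<close>

lemma localization_sod:
  assumes ls: "locally_small \<kappa> D" and P: "tsub P" "\<forall>M\<in>P. compact_object \<kappa> D M"
    and es: "essentially_small \<kappa> D P"
  shows "sod (Obj D) (Loc P, rperp P)"
proof -
  let ?U = "Loc P" and ?R = "rperp P"
  note Po = tsub_subset[OF P(1)]
  note U = tsub_coprod_closure[OF Po] closed_coprod_closure[of P] coprod_closure_extensive[of P]
  note R = tsub_right_perp[OF P(1)]
  have PR: "P \<subseteq> left_perp ?R"
    using orthogonal_left_perp[OF Po, of ?R] orthogonal_right_perp[OF Po, of ?R] tsub_subset[OF R] by blast
  have UR: "?U \<subseteq> left_perp ?R"
    by (intro coprod_closure_least tsub_left_perp R closed_left_perp PR)
  have "M \<in> extensions ?U ?R" if M: "M \<in> Obj D" for M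
  proof -
    \<comment> \<open>The clause for \<open>n = 0\<close> records that the first stage receives
      lifts of all maps from \<open>P\<close> to \<open>M\<close>; \<open>B\<close> inherits this
      through \<open>j 0\<close>.\<close>
    define ok where "ok = (\<lambda>n :: nat. \<lambda>(A, a). A \<in> ?U \<and> a \<in> Ar A M \<and>
       (n = 0 \<longrightarrow> (\<forall>X\<in>P. \<forall>m\<in>Ar X M. \<exists>x\<in>Ar X A. Comp D X A M a x = m)))"
    define step where "step = (\<lambda>n :: nat. \<lambda>(A, a) (A', a'). \<exists>t\<in>Ar A A'. Comp D A A' M a' t = a \<and>
       (\<forall>X\<in>P. \<forall>f\<in>Ar X A. Comp D X A M a f = Zero D X M \<longrightarrow> Comp D X A A' t f = Zero D X A'))"
    have base: "\<exists>x. ok 0 x"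
      using weak_cover[OF ls Po es U M, of "\<lambda>X f. True"] unfolding ok_def by fastforce
    have next_ex: "\<exists>y. ok (Suc n) y \<and> step n x y" if "ok n x" for n x
    proof -
      obtain A a where x: "x = (A, a)" by force
      have "A \<in> ?U" "a \<in> Ar A M" using that unfolding ok_def x by auto
      from kill_maps[OF ls Po es U this] show ?thesis
        unfolding ok_def step_def x by fastforce
    qed
    have "\<exists>F. \<forall>n. ok n (F n) \<and> step n (F n) (F (Suc n))"
      by (rule dependent_nat_choice[of ok step, OF base next_ex])
    then obtain F where F: "\<And>n. ok n (F n)" "\<And>n. step n (F n) (F (Suc n))" by blast
    define A where "A n = fst (F n)" for n
    define a where "a n = snd (F n)" for n
    have A: "A n \<in> ?U" and a: "a n \<in> Ar (A n) M" for n
      using F(1)[of n] by (auto simp: ok_def A_def a_def split: prod.splits)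
    have a0: "\<exists>x\<in>Ar X (A 0). Comp D X (A 0) M (a 0) x = m" if "X \<in> P" "m \<in> Ar X M" for X m
      using F(1)[of 0] that by (auto simp: ok_def A_def a_def split: prod.splits)
    have "\<exists>t\<in>Ar (A n) (A (Suc n)). Comp D (A n) (A (Suc n)) M (a (Suc n)) t = a n \<and>
       (\<forall>X\<in>P. \<forall>f\<in>Ar X (A n). Comp D X (A n) M (a n) f = Zero D X M \<longrightarrow>
          Comp D X (A n) (A (Suc n)) t f = Zero D X (A (Suc n)))" for n
      using F(2)[of n] by (auto simp: step_def A_def a_def split: prod.splits)
    then obtain t where t: "\<And>n. t n \<in> Ar (A n) (A (Suc n))"
      "\<And>n. Comp D (A n) (A (Suc n)) M (a (Suc n)) (t n) = a n"
      "\<And>n X f. X \<in> P \<Longrightarrow> f \<in> Ar X (A n) \<Longrightarrow> Comp D X (A n) M (a n) f = Zero D X M \<Longrightarrow>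
          Comp D X (A n) (A (Suc n)) (t n) f = Zero D X (A (Suc n))" by metis
    obtain K \<iota> where c: "is_coproduct D UNIV A K \<iota>"
      using coproduct_exists[OF small_natural[OF smallness], of A] A tsub_obj[OF U(1)] by blast
    have K: "K \<in> ?U" using closed_coproduct[OF U(2) small_natural[OF smallness] _ c] A by blast
    obtain B j \<phi> p d where B: "(K, K, B, \<phi>, p, d) \<in> Tri D" and tel:
      "\<forall>n. j n \<in> Ar (A n) B"
      "\<forall>n. Comp D (A n) (A (Suc n)) B (j (Suc n)) (t n) = j n"
      "\<forall>M a. (\<forall>n. a n \<in> Ar (A n) M \<and> Comp D (A n) (A (Suc n)) M (a (Suc n)) (t n) = a n) \<longrightarrow>
        (\<exists>b\<in>Ar B M. \<forall>n. Comp D (A n) B M b (j n) = a n)"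
      "\<forall>X\<in>P. \<forall>y\<in>Ar X B. \<exists>n. \<exists>g\<in>Ar X (A n). y = Comp D X (A n) B (j n) g"
      using telescope[OF t(1) c P] by (elim exE conjE) (rule that; assumption)
    have j: "j n \<in> Ar (A n) B" and jt: "Comp D (A n) (A (Suc n)) B (j (Suc n)) (t n) = j n" for n
      using tel(1,2) by auto
    note fac = tel(4)[rule_format]
    have BU: "B \<in> ?U" by (rule tsub_cone[OF U(1) B K K])
    obtain b where b: "b \<in> Ar B M" "\<And>n. Comp D (A n) B M b (j n) = a n" using tel(3)[rule_format, of a M] a t(2) by blast
    have surj: "\<exists>x\<in>Ar X B. Comp D X B M b x = m" if X: "X \<in> P" and m: "m \<in> Ar X M" for X m
    proof -
      obtain x where x: "x \<in> Ar X (A 0)" "Comp D X (A 0) M (a 0) x = m" using a0[OF X m] by blast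
      then have "Comp D X B M b (Comp D X (A 0) B (j 0) x) = m"
        using assoc[OF x(1) j b(1)] b(2) by simp
      then show ?thesis using x j by blast
    qed
    have inj: "y = Zero D X B" if X: "X \<in> P" and y: "y \<in> Ar X B" and 0: "Comp D X B M b y = Zero D X M" for X y
    proof -
      obtain n g where g: "g \<in> Ar X (A n)" "y = Comp D X (A n) B (j n) g" using fac[OF X y] by blast
      have "Comp D X (A n) M (a n) g = Zero D X M"
        using assoc[OF g(1) j b(1)] b(2) 0 g(2) by simp
      then have "Comp D X (A n) (A (Suc n)) (t n) g = Zero D X (A (Suc n))" using t(3) X g(1) by blast
      then show ?thesis using assoc[OF g(1) t(1) j] jt[of n] g(2) j Ar_obj[OF g(1)] by simp
    qed
    obtain N q h where N: "(B, M, N, b, q, h) \<in> Tri D" using cone_exists[OF b(1)] by blast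
    note Na = Tri_Ar[OF N] and No = Tri_obj[OF N]
    have "N \<in> ?R" unfolding right_perp_iff[OF Po]
    proof (intro conjI ballI No)
      fix X z assume X: "X \<in> P" and z: "z \<in> Ar X N"
      \<comment> \<open>The connecting map of \<open>z\<close> lands in \<open>S B\<close>.
        Injectivity on maps out of the desuspension \<open>X'\<close> makes it vanish, and
        surjectivity on maps out of \<open>X\<close> then makes \<open>z\<close> zero.\<close>
      obtain X' where X': "X' \<in> P" "S X' = X" using tsub_unshift[OF P(1) X] by blast
      have Xo: "X \<in> Obj D" "X' \<in> Obj D" using X X' Po by auto
      obtain y where y: "y \<in> Ar X' B" "SM X' B y = Comp D X N (S B) h z"
        using SM_surj[of "Comp D X N (S B) h z" X' B] z Na X' Xo No by auto
      have "SM X' M (Comp D X' B M b y) = Comp D X N (S M) (Comp D N (S B) (S M) (SM B M b) h) z"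
        using SM_comp[OF y(1) b(1)] y(2) X' assoc[OF z Na(3) SM_Ar[OF b(1)]] by simp
      then have "SM X' M (Comp D X' B M b y) = Zero D (S X') (S M)"
        using Tri_comp_zero(3)[OF N] z X' No by simp
      then have "Comp D X' B M b y = Zero D X' M" using SM_eq_zero[OF comp_Ar[OF y(1) b(1)]] by blast
      then have "y = Zero D X' B" using inj X'(1) y(1) by blast
      then have "Comp D X N (S B) h z = Zero D X (S B)" using y(2) X' Xo No by auto
      then obtain m where m: "m \<in> Ar X M" "Comp D X M N q m = z" using Tri_lift3[OF N z] by blast
      obtain x where x: "x \<in> Ar X B" "Comp D X B M b x = m" using surj[OF X m(1)] by blast
      show "z = Zero D X N"
        using assoc[OF x(1) b(1) Na(2)] x m Tri_comp_zero(1)[OF N] No by auto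
    qed
    then show ?thesis using BU N unfolding extensions_def by blast
  qed
  then show ?thesis unfolding sod_iff using tsub_Obj U(1) R UR tsub_subset by blast
qed

end

section \<open>Bijections of morphism groups along decomposition triangles\<close>

context triangulated_category
begin

lemma bij_betwI_additive:
  assumes "\<And>v. v \<in> Ar X Y \<Longrightarrow> \<Phi> v \<in> Ar X' Y'"
    and "\<And>v w. v \<in> Ar X Y \<Longrightarrow> w \<in> Ar X Y \<Longrightarrow> \<Phi> (diff X Y v w) = diff X' Y' (\<Phi> v) (\<Phi> w)"
    and "\<And>v. v \<in> Ar X Y \<Longrightarrow> \<Phi> v = Zero D X' Y' \<Longrightarrow> v = Zero D X Y"
    and "\<And>u. u \<in> Ar X' Y' \<Longrightarrow> \<exists>v\<in>Ar X Y. \<Phi> v = u"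
  shows "bij_betw \<Phi> (Ar X Y) (Ar X' Y')"
proof (rule bij_betwI')
  show "\<Phi> v = \<Phi> w \<longleftrightarrow> v = w" if v: "v \<in> Ar X Y" and w: "w \<in> Ar X Y" for v w
    using assms(2)[OF v w] assms(3)[OF diff_Ar[OF v w]] diff_eq_zero[OF v w]
      diff_eq_zero[OF assms(1)[OF v] assms(1)[OF w]] by auto
qed (use assms in \<open>blast+\<close>)

text \<open>In the long exact sequence of \<open>D(-, B)\<close> the two neighbours of this map
  belong to \<open>Z\<close> and to its desuspension, and both vanish by orthogonality. This lemma
  and its three variants supply the adjunctions and the comparison of values in II.\<close>

lemma bij_precomp_first:
  assumes t: "(X, Y, Z, f, g, h) \<in> Tri D" and P: "tsub P"
    and orth: "P \<subseteq> left_perp Q" and Z: "Z \<in> P" and B: "B \<in> Q" "B \<in> Obj D"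
  shows "bij_betw (\<lambda>v. Comp D X Y B v f) (Ar Y B) (Ar X B)"
proof (rule bij_betwI_additive)
  note a = Tri_Ar[OF t]
  have z: "w = Zero D Z' B" if "Z' \<in> P" "w \<in> Ar Z' B" for Z' w
    using that orth B unfolding left_perp_def by blast
  show "Comp D X Y B v f \<in> Ar X B" if "v \<in> Ar Y B" for v using that a by blast
  show "Comp D X Y B (diff Y B v w) f = diff X B (Comp D X Y B v f) (Comp D X Y B w f)"
    if "v \<in> Ar Y B" "w \<in> Ar Y B" for v w using that a comp_diff_left by blast
  show "v = Zero D Y B" if v: "v \<in> Ar Y B" "Comp D X Y B v f = Zero D X B" for v
  proof -
    obtain w where w: "w \<in> Ar Z B" "Comp D Y Z B w g = v" using Tri_extend[OF t v] by blast
    then show ?thesis using z[OF Z w(1)] a B by auto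
  qed
  show "\<exists>v\<in>Ar Y B. Comp D X Y B v f = u" if u: "u \<in> Ar X B" for u
  proof -
    obtain W k where W: "S W = Z" "(W, X, Y, k, f, g) \<in> Tri D" using rotate_inverse[OF t] by blast
    then have "W \<in> P" using tsub_shift[OF P] Z Tri_obj[OF W(2)] by blast
    then have "Comp D W X B u k = Zero D W B" using z Tri_Ar[OF W(2)] u by blast
    then show ?thesis using Tri_extend[OF W(2) u] by blast
  qed
qed

lemma bij_precomp_second:
  assumes t: "(X, Y, Z, f, g, h) \<in> Tri D" and P: "tsub P"
    and orth: "P \<subseteq> left_perp Q" and X: "X \<in> P" and B: "B \<in> Q" "B \<in> Obj D"
  shows "bij_betw (\<lambda>v. Comp D Y Z B v g) (Ar Z B) (Ar Y B)"
  using bij_precomp_first[OF rotate[OF t] P orth _ B] tsub_shift[OF P] X Tri_obj[OF t] by blast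

lemma bij_postcomp_first:
  assumes t: "(X, Y, Z, f, g, h) \<in> Tri D" and Q: "tsub Q"
    and orth: "P \<subseteq> left_perp Q" and Z: "Z \<in> Q" and W: "W \<in> P"
  shows "bij_betw (\<lambda>v. Comp D W X Y f v) (Ar W X) (Ar W Y)"
proof (rule bij_betwI_additive)
  note a = Tri_Ar[OF t]
  have z: "w = Zero D W Z'" if "Z' \<in> Q" "w \<in> Ar W Z'" for Z' w
    using that orth W unfolding left_perp_def by blast
  have Wo: "W \<in> Obj D" using W orth left_perp_obj by blast
  show "Comp D W X Y f v \<in> Ar W Y" if "v \<in> Ar W X" for v using that a by blast
  show "Comp D W X Y f (diff W X v w) = diff W Y (Comp D W X Y f v) (Comp D W X Y f w)"
    if "v \<in> Ar W X" "w \<in> Ar W X" for v w using that a comp_diff_right by blast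
  show "v = Zero D W X" if v: "v \<in> Ar W X" "Comp D W X Y f v = Zero D W Y" for v
  proof -
    obtain V k where V: "S V = Z" "(V, X, Y, k, f, g) \<in> Tri D" using rotate_inverse[OF t] by blast
    then have VQ: "V \<in> Q" using tsub_shift[OF Q] Z Tri_obj[OF V(2)] by blast
    obtain w where w: "w \<in> Ar W V" "Comp D W V X k w = v" using Tri_lift[OF V(2) v] by blast
    then show ?thesis using z[OF VQ w(1)] Tri_Ar[OF V(2)] Wo by auto
  qed
  show "\<exists>v\<in>Ar W X. Comp D W X Y f v = u" if u: "u \<in> Ar W Y" for u
    using Tri_lift[OF t u] z[OF Z comp_Ar[OF u a(2)]] by blast
qed

lemma bij_postcomp_second:
  assumes t: "(X, Y, Z, f, g, h) \<in> Tri D" and Q: "tsub Q"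
    and orth: "P \<subseteq> left_perp Q" and X: "X \<in> Q" and W: "W \<in> P"
  shows "bij_betw (\<lambda>v. Comp D W Y Z g v) (Ar W Y) (Ar W Z)"
  using bij_postcomp_first[OF rotate[OF t] Q orth _ W] tsub_shift[OF Q] X Tri_obj[OF t] by blast

end

section \<open>Adjoints of the embeddings\<close>

lemma full_sub_simps [simp]:
  "Obj (full_sub C Q) = Q" "Hom (full_sub C Q) = Hom C" "Id (full_sub C Q) = Id C" "Comp (full_sub C Q) = Comp C"
  by (simp_all add: full_sub_def)

lemma bij_betw_preimage: "bij_betw \<Phi> A B \<Longrightarrow> y \<in> B \<Longrightarrow> \<exists>x\<in>A. \<Phi> x = y"
  by (auto simp: bij_betw_def)

lemma bij_betw_unique_preimage:
  assumes "bij_betw \<Phi> A B" "y \<in> B" shows "the_inv_into A \<Phi> y \<in> A" "\<Phi> (the_inv_into A \<Phi> y) = y"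
  using assms by (auto simp: bij_betw_def f_the_inv_into_f intro: the_inv_into_into)

context preadditive_category
begin

text \<open>Universal arrows assemble to a functor by unique factorization. Existence matters
  because the functor of a decomposition is a choice among adjoints, about which nothing is known
  until there is one.\<close>

lemma left_adjoint_exists:
  assumes Q: "Q \<subseteq> Obj C"
    and R: "\<And>X. X \<in> Obj C \<Longrightarrow> R X \<in> Q" and g: "\<And>X. X \<in> Obj C \<Longrightarrow> g X \<in> Ar X (R X)"
    and bij: "\<And>X Y. X \<in> Obj C \<Longrightarrow> Y \<in> Q \<Longrightarrow> bij_betw (\<lambda>v. Comp C X (R X) Y v (g X)) (Ar (R X) Y) (Ar X Y)"
  shows "\<exists>F. adjoint_functors C (full_sub C Q) F embedding"
proof -
  define FM where "FM X Y u = the_inv_into (Ar (R X) (R Y)) (\<lambda>v. Comp C X (R X) (R Y) v (g X)) (Comp C X Y (R Y) (g Y) u)"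
    for X Y u
  have Ro: "R X \<in> Obj C" if "X \<in> Obj C" for X using R Q that by blast
  have FM: "FM X Y u \<in> Ar (R X) (R Y)" "Comp C X (R X) (R Y) (FM X Y u) (g X) = Comp C X Y (R Y) (g Y) u"
    if u: "u \<in> Ar X Y" for X Y u
  proof -
    have o: "X \<in> Obj C" "Y \<in> Obj C" using Ar_obj[OF u] by auto
    have "Comp C X Y (R Y) (g Y) u \<in> Ar X (R Y)" using u g o by blast
    note i = bij_betw_unique_preimage[OF bij[OF o(1) R[OF o(2)]] this]
    show "FM X Y u \<in> Ar (R X) (R Y)" "Comp C X (R X) (R Y) (FM X Y u) (g X) = Comp C X Y (R Y) (g Y) u"
      unfolding FM_def using i by auto
  qed
  have uniq: "v = w" if "X \<in> Obj C" "Y \<in> Q" "v \<in> Ar (R X) Y" "w \<in> Ar (R X) Y"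
    "Comp C X (R X) Y v (g X) = Comp C X (R X) Y w (g X)" for X Y v w
    using bij[OF that(1,2)] that(3-5) unfolding bij_betw_def by (auto dest: inj_onD)
  have F: "is_functor C (full_sub C Q) (R, FM)"
    unfolding is_functor_def fst_conv snd_conv full_sub_simps
  proof (intro conjI ballI)
    show "R X \<in> Q" if "X \<in> Obj C" for X using R that .
    show "FM X Y f \<in> Mor C (R X) (R Y)" if "X \<in> Obj C" "Y \<in> Obj C" "f \<in> Mor C X Y" for X Y f
      using FM(1)[of f X Y] that by (simp add: Ar_def)
    show "FM X X (Id C X) = Id C (R X)" if X: "X \<in> Obj C" for X
      by (rule uniq[OF X R[OF X]]) (use FM[of "Id C X" X X] X g[OF X] Ro in auto)
    fix X Y Z f h assume o: "X \<in> Obj C" "Y \<in> Obj C" "Z \<in> Obj C" and fh: "f \<in> Mor C X Y" "h \<in> Mor C Y Z"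
    have f: "f \<in> Ar X Y" and h: "h \<in> Ar Y Z" using o fh by (auto simp: Ar_def)
    show "FM X Z (Comp C X Y Z h f) = Comp C (R X) (R Y) (R Z) (FM Y Z h) (FM X Y f)"
    proof (rule uniq[OF o(1) R[OF o(3)]])
      show "FM X Z (Comp C X Y Z h f) \<in> Ar (R X) (R Z)" using f h by (intro FM) auto
      show "Comp C (R X) (R Y) (R Z) (FM Y Z h) (FM X Y f) \<in> Ar (R X) (R Z)" using FM(1)[OF f] FM(1)[OF h] by blast
      show "Comp C X (R X) (R Z) (FM X Z (Comp C X Y Z h f)) (g X) =
          Comp C X (R X) (R Z) (Comp C (R X) (R Y) (R Z) (FM Y Z h) (FM X Y f)) (g X)"
        using FM(2)[OF comp_Ar[OF f h]] assoc[OF g[OF o(1)] FM(1)[OF f] FM(1)[OF h]] FM(2)[OF f] FM(2)[OF h]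
          assoc[OF f g[OF o(2)] FM(1)[OF h]] assoc[OF f h g[OF o(3)]] by simp
    qed
  qed
  have E: "is_functor (full_sub C Q) C embedding"
    using Q unfolding is_functor_def embedding_def by auto
  show ?thesis
    unfolding adjoint_functors_def
  proof (intro exI[of _ "(R, FM)"] conjI F E exI[of _ "\<lambda>X Y h. Comp C X (R X) Y h (g X)"] ballI)
    show "bij_betw (\<lambda>h. Comp C X (R X) Y h (g X)) (Mor (full_sub C Q) (fst (R, FM) X) Y) (Mor C X (fst embedding Y))"
      if "X \<in> Obj C" "Y \<in> Obj (full_sub C Q)" for X Y
      using bij[of X Y] that Q Ro by (auto simp: embedding_def Ar_Mor subset_iff)
    fix X X' Y u h assume o: "X \<in> Obj C" "X' \<in> Obj C" "Y \<in> Obj (full_sub C Q)"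
      and u: "u \<in> Mor C X' X" and h: "h \<in> Mor (full_sub C Q) (fst (R, FM) X) Y"
    have Y: "Y \<in> Obj C" using o Q by auto
    have u': "u \<in> Ar X' X" and h': "h \<in> Ar (R X) Y" using u h o Y Ro by (auto simp: Ar_def)
    show "Comp C X' (R X') Y (Comp (full_sub C Q) (fst (R, FM) X') (fst (R, FM) X) Y h (snd (R, FM) X' X u)) (g X')
      = Comp C X' X (fst embedding Y) (Comp C X (R X) Y h (g X)) u"
      using assoc[OF g[OF o(2)] FM(1)[OF u'] h'] FM(2)[OF u'] assoc[OF u' g[OF o(1)] h']
      by (simp add: embedding_def)
  next
    fix X Y Y' v h assume o: "X \<in> Obj C" "Y \<in> Obj (full_sub C Q)" "Y' \<in> Obj (full_sub C Q)"
      and v: "v \<in> Mor (full_sub C Q) Y Y'" and h: "h \<in> Mor (full_sub C Q) (fst (R, FM) X) Y"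
    have Y: "Y \<in> Obj C" "Y' \<in> Obj C" using o Q by auto
    have v': "v \<in> Ar Y Y'" and h': "h \<in> Ar (R X) Y" using v h o Y Ro by (auto simp: Ar_def)
    show "Comp C X (R X) Y' (Comp (full_sub C Q) (fst (R, FM) X) Y Y' v h) (g X)
      = Comp C X (fst embedding Y) (fst embedding Y') (snd embedding Y Y' v) (Comp C X (R X) Y h (g X))"
      using assoc[OF g[OF o(1)] h' v'] by (simp add: embedding_def)
  qed
qed

lemma right_adjoint_exists:
  assumes P: "P \<subseteq> Obj C"
    and L: "\<And>X. X \<in> Obj C \<Longrightarrow> L X \<in> P" and f: "\<And>X. X \<in> Obj C \<Longrightarrow> f X \<in> Ar (L X) X"
    and bij: "\<And>X Y. X \<in> Obj C \<Longrightarrow> Y \<in> P \<Longrightarrow> bij_betw (\<lambda>v. Comp C Y (L X) X (f X) v) (Ar Y (L X)) (Ar Y X)"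
  shows "\<exists>G. adjoint_functors (full_sub C P) C embedding G"
proof -
  \<comment> \<open>The adjunction has to run from maps into \<open>X\<close> to maps into
    \<open>L X\<close>, opposite to composition with \<open>f X\<close>; hence the inverse of that
    composition.\<close>
  define lift where "lift Y X u = the_inv_into (Ar Y (L X)) (\<lambda>v. Comp C Y (L X) X (f X) v) u" for Y X u
  define GM where "GM X Y u = lift (L X) Y (Comp C (L X) X Y u (f X))" for X Y u
  have Lo: "L X \<in> Obj C" if "X \<in> Obj C" for X using L P that by blast
  have lift: "lift Y X u \<in> Ar Y (L X)" "Comp C Y (L X) X (f X) (lift Y X u) = u"
    if Y: "Y \<in> P" and u: "u \<in> Ar Y X" for X Y u
    using bij_betw_unique_preimage[OF bij[OF _ Y] u] Ar_obj[OF u] unfolding lift_def by auto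
  have uniq: "v = w" if "X \<in> Obj C" "Y \<in> P" "v \<in> Ar Y (L X)" "w \<in> Ar Y (L X)"
    "Comp C Y (L X) X (f X) v = Comp C Y (L X) X (f X) w" for X Y v w
    using bij[OF that(1,2)] that(3-5) unfolding bij_betw_def by (auto dest: inj_onD)
  have GM: "GM X Y u \<in> Ar (L X) (L Y)" "Comp C (L X) (L Y) Y (f Y) (GM X Y u) = Comp C (L X) X Y u (f X)"
    if u: "u \<in> Ar X Y" for X Y u
  proof -
    have o: "X \<in> Obj C" using Ar_obj[OF u] by auto
    note i = lift[OF L[OF o] comp_Ar[OF f[OF o] u]]
    show "GM X Y u \<in> Ar (L X) (L Y)" "Comp C (L X) (L Y) Y (f Y) (GM X Y u) = Comp C (L X) X Y u (f X)"
      unfolding GM_def using i by auto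
  qed
  have G: "is_functor C (full_sub C P) (L, GM)"
    unfolding is_functor_def fst_conv snd_conv full_sub_simps
  proof (intro conjI ballI)
    show "L X \<in> P" if "X \<in> Obj C" for X using L that .
    show "GM X Y u \<in> Mor C (L X) (L Y)" if "X \<in> Obj C" "Y \<in> Obj C" "u \<in> Mor C X Y" for X Y u
      using GM(1)[of u X Y] that by (simp add: Ar_def)
    show "GM X X (Id C X) = Id C (L X)" if X: "X \<in> Obj C" for X
      by (rule uniq[OF X L[OF X]]) (use GM[of "Id C X" X X] X f[OF X] Lo in auto)
    fix X Y Z u h assume o: "X \<in> Obj C" "Y \<in> Obj C" "Z \<in> Obj C" and uh: "u \<in> Mor C X Y" "h \<in> Mor C Y Z"
    have u: "u \<in> Ar X Y" and h: "h \<in> Ar Y Z" using o uh by (auto simp: Ar_def)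
    show "GM X Z (Comp C X Y Z h u) = Comp C (L X) (L Y) (L Z) (GM Y Z h) (GM X Y u)"
    proof (rule uniq[OF o(3) L[OF o(1)]])
      show "GM X Z (Comp C X Y Z h u) \<in> Ar (L X) (L Z)" using u h by (intro GM) auto
      show "Comp C (L X) (L Y) (L Z) (GM Y Z h) (GM X Y u) \<in> Ar (L X) (L Z)" using GM(1)[OF u] GM(1)[OF h] by blast
      show "Comp C (L X) (L Z) Z (f Z) (GM X Z (Comp C X Y Z h u)) =
          Comp C (L X) (L Z) Z (f Z) (Comp C (L X) (L Y) (L Z) (GM Y Z h) (GM X Y u))"
        using GM(2)[OF comp_Ar[OF u h]] assoc[OF GM(1)[OF u] GM(1)[OF h] f[OF o(3)]] GM(2)[OF u] GM(2)[OF h]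
          assoc[OF GM(1)[OF u] f[OF o(2)] h] assoc[OF f[OF o(1)] u h] by simp
    qed
  qed
  have E: "is_functor (full_sub C P) C embedding"
    using P unfolding is_functor_def embedding_def by auto
  have nat1: "lift X' Y (Comp C X' X Y h u) = Comp C X' X (L Y) (lift X Y h) u"
    if X: "X \<in> P" "X' \<in> P" and u: "u \<in> Ar X' X" and h: "h \<in> Ar X Y" for X X' Y u h
  proof -
    have o: "Y \<in> Obj C" using Ar_obj[OF h] by auto
    show ?thesis
      by (rule uniq[OF o X(2)]) (use lift[OF X(2) comp_Ar[OF u h]] lift[OF X(1) h] u
          assoc[OF u lift(1)[OF X(1) h] f[OF o]] in auto)
  qed
  have nat2: "lift X Y' (Comp C X Y Y' v h) = Comp C X (L Y) (L Y') (GM Y Y' v) (lift X Y h)"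
    if X: "X \<in> P" and v: "v \<in> Ar Y Y'" and h: "h \<in> Ar X Y" for X Y Y' v h
  proof -
    have o: "Y \<in> Obj C" "Y' \<in> Obj C" using Ar_obj[OF v] by auto
    show ?thesis
      by (rule uniq[OF o(2) X]) (use lift[OF X comp_Ar[OF h v]] lift[OF X h] GM[OF v]
          assoc[OF lift(1)[OF X h] GM(1)[OF v] f[OF o(2)]] assoc[OF lift(1)[OF X h] f[OF o(1)] v] in auto)
  qed
  show ?thesis
    unfolding adjoint_functors_def
  proof (intro exI[of _ "(L, GM)"] conjI G E exI[of _ lift] ballI)
    show "bij_betw (lift X Y) (Mor C (fst embedding X) Y) (Mor (full_sub C P) X (fst (L, GM) Y))"
      if "X \<in> Obj (full_sub C P)" "Y \<in> Obj C" for X Y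
      using bij_betw_the_inv_into[OF bij[of Y X]] that P Lo
      by (auto simp: embedding_def Ar_Mor subset_iff lift_def[abs_def])
    fix X X' Y u h assume o: "X \<in> Obj (full_sub C P)" "X' \<in> Obj (full_sub C P)" "Y \<in> Obj C"
      and u: "u \<in> Mor (full_sub C P) X' X" and h: "h \<in> Mor C (fst embedding X) Y"
    have X: "X \<in> Obj C" "X' \<in> Obj C" using o P by auto
    show "lift X' Y (Comp C (fst embedding X') (fst embedding X) Y h (snd embedding X' X u))
      = Comp (full_sub C P) X' X (fst (L, GM) Y) (lift X Y h) u"
      using nat1[of X X' u h Y] u h o X by (simp add: embedding_def Ar_def)
  next
    fix X Y Y' v h assume o: "X \<in> Obj (full_sub C P)" "Y \<in> Obj C" "Y' \<in> Obj C"
      and v: "v \<in> Mor C Y Y'" and h: "h \<in> Mor C (fst embedding X) Y"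
    have X: "X \<in> Obj C" using o P by auto
    show "lift X Y' (Comp C (fst embedding X) Y Y' v h)
      = Comp (full_sub C P) X (fst (L, GM) Y) (fst (L, GM) Y') (snd (L, GM) Y Y' v) (lift X Y h)"
      using nat2[of X v Y Y' h] v h o X by (simp add: embedding_def Ar_def)
  qed
qed

text \<open>Whichever adjoint was chosen, its unit \<open>e\<close> is a universal arrow from
  \<open>X\<close> to \<open>Q\<close>, and so is \<open>g\<close>; the two factor through each
  other by mutually inverse maps.\<close>

lemma left_adjoint_value:
  assumes F: "adjoint_functors C (full_sub C Q) F embedding" and Q: "Q \<subseteq> Obj C"
    and X: "X \<in> Obj C" and R: "R \<in> Q" and g: "g \<in> Ar X R"
    and bij: "\<And>Y. Y \<in> Q \<Longrightarrow> bij_betw (\<lambda>v. Comp C X R Y v g) (Ar R Y) (Ar X Y)"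
  shows "fst F X \<in> Obj C \<and> isomorphic C R (fst F X)"
proof -
  let ?Y = "fst F X"
  obtain \<phi> where \<phi>': "\<forall>X\<in>Obj C. \<forall>Y\<in>Q. bij_betw (\<phi> X Y) (Mor C (fst F X) Y) (Mor C X Y)"
    and n': "\<forall>X\<in>Obj C. \<forall>Y\<in>Q. \<forall>Y'\<in>Q. \<forall>v\<in>Mor C Y Y'. \<forall>h\<in>Mor C (fst F X) Y.
             \<phi> X Y' (Comp C (fst F X) Y Y' v h) = Comp C X Y Y' v (\<phi> X Y h)"
    using F unfolding adjoint_functors_def embedding_def full_sub_simps fst_conv snd_conv
    by (elim conjE exE) (rule that; assumption)
  note \<phi> = \<phi>'[rule_format, OF X] and n = n'[rule_format, OF X]
  have YQ: "?Y \<in> Q" using F X unfolding adjoint_functors_def is_functor_def by auto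
  then have Yo: "?Y \<in> Obj C" and Ro: "R \<in> Obj C" using Q R by auto
  define e where "e = \<phi> X ?Y (Id C ?Y)"
  have e: "e \<in> Ar X ?Y" using \<phi>[OF YQ] X Yo unfolding e_def bij_betw_def by (auto simp: Ar_def Id_closed)
  have \<phi>e: "\<phi> X Y v = Comp C X ?Y Y v e" if Y: "Y \<in> Q" and v: "v \<in> Ar ?Y Y" for Y v
    using n[OF YQ Y, of v "Id C ?Y"] v Yo unfolding e_def by (simp add: Ar_def Id_closed Comp_Id_right)
  obtain a where a: "a \<in> Ar R ?Y" "Comp C X R ?Y a g = e"
    using bij_betw_preimage[OF bij[OF YQ] e] by blast
  have "g \<in> \<phi> X R ` Mor C ?Y R" using \<phi>[OF R] g X Ro unfolding bij_betw_def by (auto simp: Ar_def)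
  then obtain b where b: "b \<in> Ar ?Y R" "Comp C X ?Y R b e = g"
    using \<phi>e[OF R] Yo Ro by (auto simp: Ar_Mor)
  have "Comp C R ?Y R b a = Id C R"
    using bij[OF R] assoc[OF g a(1) b(1)] a b g Ro unfolding bij_betw_def inj_on_def by auto
  moreover have "Comp C ?Y R ?Y a b = Id C ?Y"
  proof -
    have "\<phi> X ?Y (Comp C ?Y R ?Y a b) = \<phi> X ?Y (Id C ?Y)"
      using \<phi>e[OF YQ comp_Ar[OF b(1) a(1)]] assoc[OF e b(1) a(1)] a b e_def by simp
    moreover have "Comp C ?Y R ?Y a b \<in> Mor C ?Y ?Y" "Id C ?Y \<in> Mor C ?Y ?Y"
      using a b Yo comp_Ar[OF b(1) a(1)] by (auto simp: Ar_def Id_closed)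
    ultimately show ?thesis using \<phi>[OF YQ] unfolding bij_betw_def inj_on_def by blast
  qed
  ultimately show ?thesis using Yo is_isoI[OF a(1) b(1)] unfolding isomorphic_def by blast
qed

lemma right_adjoint_value:
  assumes G: "adjoint_functors (full_sub C P) C embedding G" and P: "P \<subseteq> Obj C"
    and X: "X \<in> Obj C" and L: "L \<in> P" and f: "f \<in> Ar L X"
    and bij: "\<And>Y. Y \<in> P \<Longrightarrow> bij_betw (\<lambda>v. Comp C Y L X f v) (Ar Y L) (Ar Y X)"
  shows "fst G X \<in> Obj C \<and> isomorphic C L (fst G X)"
proof -
  let ?Y = "fst G X"
  obtain \<phi> where \<phi>': "\<forall>Y\<in>P. \<forall>X\<in>Obj C. bij_betw (\<phi> Y X) (Mor C Y X) (Mor C Y (fst G X))"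
    and n': "\<forall>Y\<in>P. \<forall>Y'\<in>P. \<forall>X\<in>Obj C. \<forall>u\<in>Mor C Y' Y. \<forall>h\<in>Mor C Y X.
             \<phi> Y' X (Comp C Y' Y X h u) = Comp C Y' Y (fst G X) (\<phi> Y X h) u"
    using G unfolding adjoint_functors_def embedding_def full_sub_simps fst_conv snd_conv
    by (elim conjE exE) (rule that; assumption)
  note \<phi> = \<phi>'[rule_format, OF _ X] and n = n'[rule_format, OF _ _ X]
  have YP: "?Y \<in> P" using G X unfolding adjoint_functors_def is_functor_def by auto
  then have Yo: "?Y \<in> Obj C" and Lo: "L \<in> Obj C" using P L by auto
  \<comment> \<open>Its preimage \<open>e\<close> is the counit of the given adjunction.\<close>
  have "Id C ?Y \<in> \<phi> ?Y X ` Mor C ?Y X" using \<phi>[OF YP] Yo unfolding bij_betw_def by (simp add: Id_closed)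
  then obtain e where e: "e \<in> Ar ?Y X" "\<phi> ?Y X e = Id C ?Y" using Yo X by (auto simp: Ar_Mor)
  have \<phi>e: "\<phi> Y X (Comp C Y ?Y X e u) = u" if Y: "Y \<in> P" and u: "u \<in> Ar Y ?Y" for Y u
    using n[OF YP Y, of u e] u e by (simp add: Ar_def Comp_Id_left)
  obtain a where a: "a \<in> Ar ?Y L" "Comp C ?Y L X f a = e"
    using bij_betw_preimage[OF bij[OF YP] e(1)] by blast
  define b where "b = \<phi> L X f"
  have b: "b \<in> Ar L ?Y" using \<phi>[OF L] f Lo Yo unfolding bij_betw_def b_def by (auto simp: Ar_def)
  have eb: "Comp C L ?Y X e b = f"
  proof -
    have "\<phi> L X (Comp C L ?Y X e b) = \<phi> L X f" using \<phi>e[OF L b] b_def by simp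
    moreover have "Comp C L ?Y X e b \<in> Mor C L X" "f \<in> Mor C L X"
      using comp_Ar[OF b e(1)] f by (auto simp: Ar_def)
    ultimately show ?thesis using \<phi>[OF L] unfolding bij_betw_def inj_on_def by blast
  qed
  have "Comp C L ?Y L a b = Id C L"
    using bij[OF L] assoc[OF b a(1) f] a b eb f Lo unfolding bij_betw_def inj_on_def by auto
  moreover have "Comp C ?Y L ?Y b a = Id C ?Y"
    using \<phi>e[OF YP comp_Ar[OF a(1) b]] assoc[OF a(1) b e(1)] eb a e by simp
  ultimately show ?thesis using Yo is_isoI[OF b a(1)] unfolding isomorphic_def by blast
qed

end

context triangulated_category
begin

lemma full_sub_Obj [simp]: "full_sub D (Obj D) = D"
  by (simp add: full_sub_def)

text \<open>Triangles chosen for all objects show that an adjoint exists, so that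
  \<open>SOME\<close> returns one. Its value is then compared with an arbitrary triangle of
  \<open>N\<close>, independently of those choices.\<close>

lemma sod_left_functor_value:
  assumes sod: "sod (Obj D) (P, Q)"
    and t: "(L, N, R, f, g, h) \<in> Tri D" "L \<in> P" "R \<in> Q"
  shows "fst (sod_left_functor D (Obj D) (P, Q)) N \<in> Obj D \<and>
    isomorphic D R (fst (sod_left_functor D (Obj D) (P, Q)) N)"
proof -
  note s = sod[unfolded sod_iff]
  have P: "tsub P" and orth: "P \<subseteq> left_perp Q" and Q: "Q \<subseteq> Obj D" using s by auto
  have "\<forall>M\<in>Obj D. \<exists>L R f g h. L \<in> P \<and> R \<in> Q \<and> (L, M, R, f, g, h) \<in> Tri D"
    using s unfolding extensions_def by blast
  then obtain L' R' f' g' h' where d: "\<And>M. M \<in> Obj D \<Longrightarrow> L' M \<in> P \<and> R' M \<in> Q \<and> (L' M, M, R' M, f' M, g' M, h' M) \<in> Tri D"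
    by metis
  have "\<exists>F. adjoint_functors D (full_sub D Q) F embedding"
  proof (rule left_adjoint_exists[OF Q])
    fix X assume X: "X \<in> Obj D"
    show "R' X \<in> Q" "g' X \<in> Ar X (R' X)" using d[OF X] Tri_Ar by blast+
    show "bij_betw (\<lambda>v. Comp D X (R' X) Y v (g' X)) (Ar (R' X) Y) (Ar X Y)" if "Y \<in> Q" for Y
      using bij_precomp_second[OF _ P orth] d[OF X] that Q by blast
  qed
  then have F: "adjoint_functors D (full_sub D Q) (sod_left_functor D (Obj D) (P, Q)) embedding"
    unfolding sod_left_functor_def full_sub_Obj snd_conv by (rule someI_ex)
  show ?thesis
    by (rule left_adjoint_value[OF F Q _ t(3) Tri_Ar(2)[OF t(1)] bij_precomp_second[OF t(1) P orth t(2)]])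
      (use Tri_obj[OF t(1)] Q in auto)
qed

lemma sod_right_functor_value:
  assumes sod: "sod (Obj D) (P, Q)"
    and t: "(L, N, R, f, g, h) \<in> Tri D" "L \<in> P" "R \<in> Q"
  shows "fst (sod_right_functor D (Obj D) (P, Q)) N \<in> Obj D \<and>
    isomorphic D L (fst (sod_right_functor D (Obj D) (P, Q)) N)"
proof -
  note s = sod[unfolded sod_iff]
  have Q: "tsub Q" and orth: "P \<subseteq> left_perp Q" and P: "P \<subseteq> Obj D" using s by auto
  have "\<forall>M\<in>Obj D. \<exists>L R f g h. L \<in> P \<and> R \<in> Q \<and> (L, M, R, f, g, h) \<in> Tri D"
    using s unfolding extensions_def by blast
  then obtain L' R' f' g' h' where d: "\<And>M. M \<in> Obj D \<Longrightarrow> L' M \<in> P \<and> R' M \<in> Q \<and> (L' M, M, R' M, f' M, g' M, h' M) \<in> Tri D"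
    by metis
  have "\<exists>F. adjoint_functors (full_sub D P) D embedding F"
  proof (rule right_adjoint_exists[OF P])
    fix X assume X: "X \<in> Obj D"
    show "L' X \<in> P" "f' X \<in> Ar (L' X) X" using d[OF X] Tri_Ar by blast+
    show "bij_betw (\<lambda>v. Comp D Y (L' X) X (f' X) v) (Ar Y (L' X)) (Ar Y X)" if "Y \<in> P" for Y
      using bij_postcomp_first[OF _ Q orth] d[OF X] that by blast
  qed
  then have F: "adjoint_functors (full_sub D P) D embedding (sod_right_functor D (Obj D) (P, Q))"
    unfolding sod_right_functor_def full_sub_Obj fst_conv by (rule someI_ex)
  show ?thesis
    by (rule right_adjoint_value[OF F P _ t(2) Tri_Ar(1)[OF t(1)] bij_postcomp_first[OF t(1) Q orth t(3)]])
      (use Tri_obj[OF t(1)] in auto)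
qed

end

section \<open>Abelian categories and graded modules\<close>

context abelian_category
begin

lemma cokernel_epi:
  assumes c: "is_cokernel C X Y Q f c" and f: "f \<in> Ar X Y" and g: "g \<in> Ar Q W" "h \<in> Ar Q W"
    and eq: "Comp C Y Q W g c = Comp C Y Q W h c"
  shows "g = h"
proof -
  have c': "Q \<in> Obj C" "c \<in> Ar Y Q" "Comp C X Y Q c f = Zero C X Q"
    using c f by (auto simp: is_cokernel_def Ar_def)
  have o: "W \<in> Obj C" using g Ar_obj by blast
  have "Comp C Y Q W g c \<in> Mor C Y W" using c' g comp_Ar[of c Y Q g W] by (simp add: Ar_def)
  moreover have "Comp C X Y W (Comp C Y Q W g c) f = Zero C X W"
    using assoc[OF f c'(2) g(1)] c'(3) g(1) Ar_obj[OF f] by simp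
  ultimately have "\<exists>!k. k \<in> Mor C Q W \<and> Comp C Y Q W k c = Comp C Y Q W g c"
    using c o unfolding is_cokernel_def by blast
  moreover have "g \<in> Mor C Q W" "h \<in> Mor C Q W" using g by (auto simp: Ar_def)
  ultimately show ?thesis using eq by metis
qed

lemma cokernel_factor:
  assumes c: "is_cokernel C X Y Q f c" and g: "g \<in> Ar Y W" "Comp C X Y W g f = Zero C X W"
  shows "\<exists>h\<in>Ar Q W. Comp C Y Q W h c = g"
proof -
  have "\<exists>h. h \<in> Mor C Q W \<and> Comp C Y Q W h c = g"
    using c g unfolding is_cokernel_def Ar_def by blast
  then show ?thesis using c Ar_obj[OF g(1)] unfolding is_cokernel_def Ar_def by blast
qed

lemma kernel_factor:
  assumes k: "is_kernel C K X Y k f" and g: "g \<in> Ar W X" "Comp C W X Y f g = Zero C W Y"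
  shows "\<exists>h\<in>Ar W K. Comp C W K X k h = g"
proof -
  have "\<exists>h. h \<in> Mor C W K \<and> Comp C W K X k h = g"
    using k g unfolding is_kernel_def Ar_def by blast
  then show ?thesis using k Ar_obj[OF g(1)] unfolding is_kernel_def Ar_def by blast
qed

text \<open>Exactness of an embedding is a statement about short exact sequences, so the kernel and
  cokernel of \<open>f\<close> are displayed as ends of two of them, glued at the image. The image
  is the cokernel of the kernel; the work lies in showing \<open>m\<close> monic.\<close>

lemma image_factorization:
  assumes f: "f \<in> Ar G H"
  shows "\<exists>K I Q k e m c. short_exact C K G I k e \<and> short_exact C I H Q m c \<and> f = Comp C G I H m e"
proof -
  have o: "G \<in> Obj C" "H \<in> Obj C" "f \<in> Mor C G H" using f by (auto simp: Ar_def)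
  obtain K k where k: "is_kernel C K G H k f" using kernel_exists[OF o] by blast
  have k': "k \<in> Ar K G" "Comp C K G H f k = Zero C K H"
    using k o by (auto simp: is_kernel_def Ar_def)
  obtain I e where e: "is_cokernel C K G I k e"
    using cokernel_exists[of K G k] k' o by (auto simp: Ar_def)
  have e': "e \<in> Ar G I" "Comp C K G I e k = Zero C K I"
    using e o by (auto simp: is_cokernel_def Ar_def)
  have ko: "K \<in> Obj C" "I \<in> Obj C" using k' e' Ar_obj by auto
  obtain m where m: "m \<in> Ar I H" "Comp C G I H m e = f" using cokernel_factor[OF e f k'(2)] by blast
  note epi = cokernel_epi[OF e k'(1)]
  \<comment> \<open>Let \<open>q\<close> be the cokernel of \<open>x\<close>. The epimorphism
    \<open>q\<close> after \<open>e\<close> is the cokernel of some \<open>z\<close>, and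
    \<open>f\<close>, hence \<open>e\<close>, kills \<open>z\<close>. So \<open>e\<close> factors
    through \<open>q\<close> after \<open>e\<close>, which makes \<open>q\<close> split monic; as
    \<open>q\<close> kills \<open>x\<close>, \<open>x\<close> is zero.\<close>
  have m0: "x = Zero C W I" if x: "x \<in> Ar W I" and mx: "Comp C W I H m x = Zero C W H" for W x
  proof -
    have W: "W \<in> Obj C" using x Ar_obj by blast
    obtain J q where q: "is_cokernel C W I J x q"
      using cokernel_exists[of W I x] x by (auto simp: Ar_def)
    have q': "q \<in> Ar I J" "Comp C W I J q x = Zero C W J"
      using q ko by (auto simp: is_cokernel_def Ar_def)
    have Jo: "J \<in> Obj C" using q' Ar_obj by blast
    obtain n where n: "n \<in> Ar J H" "Comp C I J H n q = m" using cokernel_factor[OF q m(1) mx] by blast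
    have qe: "Comp C G I J q e \<in> Ar G J" using q' e' by blast
    have "is_epi C G J (Comp C G I J q e)"
      unfolding is_epi_def
    proof (intro conjI ballI impI)
      show "Comp C G I J q e \<in> Mor C G J" using qe by (simp add: Ar_def)
      fix V g h assume V: "V \<in> Obj C" and gh: "g \<in> Mor C J V" "h \<in> Mor C J V"
        and eq: "Comp C G J V g (Comp C G I J q e) = Comp C G J V h (Comp C G I J q e)"
      have g: "g \<in> Ar J V" and h: "h \<in> Ar J V" using gh V Jo by (auto simp: Ar_def)
      have "Comp C I J V g q = Comp C I J V h q"
        by (rule epi) (use g h q' eq assoc[OF e'(1) q'(1) g] assoc[OF e'(1) q'(1) h] in auto)
      then show "g = h" by (rule cokernel_epi[OF q x g h])
    qed
    then obtain V z where z: "V \<in> Obj C" "z \<in> Mor C V G" "is_cokernel C V G J z (Comp C G I J q e)"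
      using epi_is_cokernel o(1) Jo by blast
    have z': "z \<in> Ar V G" using z o by (simp add: Ar_def)
    have "Comp C V G J (Comp C G I J q e) z = Zero C V J" using z(3) by (simp add: is_cokernel_def)
    moreover have "f = Comp C G J H n (Comp C G I J q e)"
      using m(2) assoc[OF e'(1) q'(1) n(1)] n(2) by simp
    ultimately have "Comp C V G H f z = Zero C V H"
      using assoc[OF z' qe n(1)] n(1) z(1) by simp
    then obtain z2 where z2: "z2 \<in> Ar V K" "Comp C V K G k z2 = z" using kernel_factor[OF k z'] by blast
    have "Comp C V G I e z = Zero C V I"
      using assoc[OF z2(1) k'(1) e'(1)] e'(2) z2 ko by simp
    then obtain t where t: "t \<in> Ar J I" "Comp C G J I t (Comp C G I J q e) = e"
      using cokernel_factor[OF z(3) e'(1)] by blast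
    have "Comp C I J I t q = Id C I"
      by (rule epi) (use t q' ko e' assoc[OF e'(1) q'(1) t(1)] in auto)
    then show ?thesis using assoc[OF x q'(1) t(1)] q'(2) t(1) x W by simp
  qed
  have "is_mono C I H m"
    unfolding is_mono_def
  proof (intro conjI ballI impI)
    show "m \<in> Mor C I H" using m by (simp add: Ar_def)
    fix W g h assume W: "W \<in> Obj C" and gh: "g \<in> Mor C W I" "h \<in> Mor C W I"
      and eq: "Comp C W I H m g = Comp C W I H m h"
    have g: "g \<in> Ar W I" and h: "h \<in> Ar W I" using gh W ko by (auto simp: Ar_def)
    have "diff W H (Comp C W I H m g) (Comp C W I H m h) = Zero C W H"
      using diff_eq_zero[OF comp_Ar[OF g m(1)] comp_Ar[OF h m(1)]] eq by blast
    then have "diff W I g h = Zero C W I"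
      by (intro m0) (use g h m in \<open>auto simp: comp_diff_right\<close>)
    then show "g = h" using diff_eq_zero[OF g h] by blast
  qed
  then obtain Z g where g: "Z \<in> Obj C" "g \<in> Mor C H Z" "is_kernel C I H Z m g"
    using mono_is_kernel ko o by blast
  have g': "g \<in> Ar H Z" "Comp C I H Z g m = Zero C I Z" using g o by (auto simp: Ar_def is_kernel_def)
  obtain Q c where c: "is_cokernel C I H Q m c"
    using cokernel_exists[of I H m] m by (auto simp: Ar_def)
  have c': "c \<in> Ar H Q" "Comp C I H Q c m = Zero C I Q"
    using c o by (auto simp: is_cokernel_def Ar_def)
  have Qo: "Q \<in> Obj C" using c' Ar_obj by blast
  \<comment> \<open>A kernel of some \<open>g\<close> is a kernel of its own cokernel
    \<open>c\<close>, because \<open>g\<close> factors through \<open>c\<close>.\<close>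
  have "is_kernel C I H Q m c"
    unfolding is_kernel_def
  proof (intro conjI ballI impI)
    fix W u assume W: "W \<in> Obj C" and u: "u \<in> Mor C W H" and cu: "Comp C W H Q c u = Zero C W Q"
    have u': "u \<in> Ar W H" using u W o by (simp add: Ar_def)
    obtain g2 where g2: "g2 \<in> Ar Q Z" "Comp C H Q Z g2 c = g" using cokernel_factor[OF c g'] by blast
    have "Comp C W H Z g u = Zero C W Z" using assoc[OF u' c'(1) g2(1)] g2 cu W by simp
    then show "\<exists>!h. h \<in> Mor C W I \<and> Comp C W I H m h = u"
      using g(3) W u unfolding is_kernel_def by blast
  qed (use c' m ko in \<open>auto simp: Ar_def\<close>)
  moreover have "is_kernel C K G I k e"
    unfolding is_kernel_def
  proof (intro conjI ballI impI)
    fix W u assume W: "W \<in> Obj C" and u: "u \<in> Mor C W G" and eu: "Comp C W G I e u = Zero C W I"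
    have u': "u \<in> Ar W G" using u W o by (simp add: Ar_def)
    have "Comp C W G H f u = Zero C W H" using assoc[OF u' e'(1) m(1)] m eu W by simp
    then show "\<exists>!h. h \<in> Mor C W K \<and> Comp C W K G k h = u"
      using k W u unfolding is_kernel_def by blast
  qed (use k' e' ko in \<open>auto simp: Ar_def\<close>)
  ultimately have "short_exact C K G I k e" "short_exact C I H Q m c"
    unfolding short_exact_def using e c k' e' m c' ko o Qo by (auto simp: Ar_def)
  then show ?thesis using m(2) by blast
qed

end

section \<open>Linear maps between modules\<close>

lemma linear_map_closed: "linear_map R M N f \<Longrightarrow> x \<in> carrier M \<Longrightarrow> f x \<in> carrier N"
  by (auto simp: linear_map_def)

lemma linear_map_add: "linear_map R M N f \<Longrightarrow> x \<in> carrier M \<Longrightarrow> y \<in> carrier M \<Longrightarrow>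
  f (x \<oplus>\<^bsub>M\<^esub> y) = f x \<oplus>\<^bsub>N\<^esub> f y"
  by (auto simp: linear_map_def)

lemma linear_map_smult: "linear_map R M N f \<Longrightarrow> r \<in> carrier R \<Longrightarrow> x \<in> carrier M \<Longrightarrow>
  f (r \<odot>\<^bsub>M\<^esub> x) = r \<odot>\<^bsub>N\<^esub> f x"
  by (auto simp: linear_map_def)

lemma linear_mapI:
  assumes "\<And>x. x \<in> carrier M \<Longrightarrow> f x \<in> carrier N"
    and "\<And>x y. x \<in> carrier M \<Longrightarrow> y \<in> carrier M \<Longrightarrow> f (x \<oplus>\<^bsub>M\<^esub> y) = f x \<oplus>\<^bsub>N\<^esub> f y"
    and "\<And>r x. r \<in> carrier R \<Longrightarrow> x \<in> carrier M \<Longrightarrow> f (r \<odot>\<^bsub>M\<^esub> x) = r \<odot>\<^bsub>N\<^esub> f x"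
  shows "linear_map R M N f"
  using assms by (auto simp: linear_map_def)

lemma module_group: "module R M \<Longrightarrow> abelian_group M"
  by (simp add: module_def)

lemma module_zero_closed: "module R M \<Longrightarrow> \<zero>\<^bsub>M\<^esub> \<in> carrier M"
  by (simp add: module_def abelian_group.axioms(1) abelian_monoid.zero_closed)

lemma module_add_closed: "module R M \<Longrightarrow> x \<in> carrier M \<Longrightarrow> y \<in> carrier M \<Longrightarrow> x \<oplus>\<^bsub>M\<^esub> y \<in> carrier M"
  by (simp add: module_def abelian_group.axioms(1) abelian_monoid.a_closed)

lemma linear_map_0:
  assumes "module R M" "module R N" "linear_map R M N f"
  shows "f \<zero>\<^bsub>M\<^esub> = \<zero>\<^bsub>N\<^esub>"
proof -
  interpret N: abelian_group N by (rule module_group[OF assms(2)])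
  note z = module_zero_closed[OF assms(1)]
  have "\<zero>\<^bsub>M\<^esub> \<oplus>\<^bsub>M\<^esub> \<zero>\<^bsub>M\<^esub> = \<zero>\<^bsub>M\<^esub>"
    using abelian_monoid.l_zero[OF abelian_group.axioms(1)[OF module_group[OF assms(1)]] z] .
  then have "f \<zero>\<^bsub>M\<^esub> \<oplus>\<^bsub>N\<^esub> f \<zero>\<^bsub>M\<^esub> = f \<zero>\<^bsub>M\<^esub>"
    using linear_map_add[OF assms(3) z z] by simp
  then show ?thesis
    using N.add.r_cancel_one[of "f \<zero>\<^bsub>M\<^esub>" "f \<zero>\<^bsub>M\<^esub>"] linear_map_closed[OF assms(3) z] by simp
qed

lemma linear_map_minus:
  assumes "module R M" "module R N" "linear_map R M N f" "x \<in> carrier M" "y \<in> carrier M"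
  shows "f (x \<ominus>\<^bsub>M\<^esub> y) = f x \<ominus>\<^bsub>N\<^esub> f y"
proof -
  interpret M: abelian_group M by (rule module_group[OF assms(1)])
  interpret N: abelian_group N by (rule module_group[OF assms(2)])
  note cl = linear_map_closed[OF assms(3)]
  have "f y \<oplus>\<^bsub>N\<^esub> f (x \<ominus>\<^bsub>M\<^esub> y) = f x"
    using linear_map_add[OF assms(3,5), of "x \<ominus>\<^bsub>M\<^esub> y"] M.add_minus_cancel[OF assms(4,5)] assms(4,5) by simp
  moreover have "f y \<oplus>\<^bsub>N\<^esub> (f x \<ominus>\<^bsub>N\<^esub> f y) = f x"
    using N.add_minus_cancel cl assms(4,5) by blast
  ultimately show ?thesis
    using N.add.right_cancel[of "f y" "f (x \<ominus>\<^bsub>M\<^esub> y)" "f x \<ominus>\<^bsub>N\<^esub> f y"] N.a_comm cl assms(4,5) by simp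
qed

lemma linear_map_inj:
  assumes "module R M" "module R N" "linear_map R M N f"
    and "\<And>x. x \<in> carrier M \<Longrightarrow> f x = \<zero>\<^bsub>N\<^esub> \<Longrightarrow> x = \<zero>\<^bsub>M\<^esub>"
  shows "inj_on f (carrier M)"
proof (rule inj_onI)
  fix x y assume xy: "x \<in> carrier M" "y \<in> carrier M" "f x = f y"
  note M = module_group[OF assms(1)] and N = module_group[OF assms(2)]
  have "f (x \<ominus>\<^bsub>M\<^esub> y) = \<zero>\<^bsub>N\<^esub>"
    using linear_map_minus[OF assms(1-3) xy(1,2)] xy(3)
      abelian_group.minus_eq_zero_iff[OF N] linear_map_closed[OF assms(3)] xy(1,2) by simp
  then have "x \<ominus>\<^bsub>M\<^esub> y = \<zero>\<^bsub>M\<^esub>" using assms(4) abelian_group.minus_closed[OF M xy(1,2)] by blast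
  then show "x = y" using abelian_group.minus_eq_zero_iff[OF M xy(1,2)] by blast
qed

lemma linear_map_cong: "linear_map R M N f \<Longrightarrow> module R M \<Longrightarrow> (\<And>x. x \<in> carrier M \<Longrightarrow> f' x = f x) \<Longrightarrow> linear_map R M N f'"
  by (intro linear_mapI) (auto simp: linear_map_closed linear_map_add linear_map_smult module_add_closed module.smult_closed)

lemma linear_map_comp: "linear_map R M N f \<Longrightarrow> linear_map R N P g \<Longrightarrow> linear_map R M P (g \<circ> f)"
  by (intro linear_mapI) (auto simp: linear_map_closed linear_map_add linear_map_smult)

lemma linear_factor_inj:
  assumes K: "module R K" and k: "linear_map R K Y k" "inj_on k (carrier K)"
    and W: "module R W" and g: "linear_map R W Y g" "g ` carrier W \<subseteq> k ` carrier K"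
  shows "\<exists>h. linear_map R W K h \<and> (\<forall>w\<in>carrier W. k (h w) = g w)"
proof -
  have "\<forall>w\<in>carrier W. \<exists>x\<in>carrier K. k x = g w" 
  proof
    fix w assume "w \<in> carrier W"
    then have "g w \<in> k ` carrier K" using g(2) by blast
    then show "\<exists>x\<in>carrier K. k x = g w" by auto
  qed
  then obtain h where h: "\<And>w. w \<in> carrier W \<Longrightarrow> h w \<in> carrier K" "\<And>w. w \<in> carrier W \<Longrightarrow> k (h w) = g w"
    by metis
  note eq = inj_onD[OF k(2)]
  have "linear_map R W K h"
  proof (rule linear_mapI[OF h(1)])
    show "h (x \<oplus>\<^bsub>W\<^esub> y) = h x \<oplus>\<^bsub>K\<^esub> h y" if "x \<in> carrier W" "y \<in> carrier W" for x y
      by (rule eq) (use h that module_add_closed[OF W] module_add_closed[OF K] linear_map_add[OF k(1)]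
          linear_map_add[OF g(1)] in auto)
    show "h (r \<odot>\<^bsub>W\<^esub> x) = r \<odot>\<^bsub>K\<^esub> h x" if "r \<in> carrier R" "x \<in> carrier W" for r x
      by (rule eq) (use h that module.smult_closed[OF W] module.smult_closed[OF K] linear_map_smult[OF k(1)]
          linear_map_smult[OF g(1)] in auto)
  qed
  then show ?thesis using h(2) by blast
qed

lemma linear_factor_surj:
  assumes Y: "module R Y" and Q: "module R Q" and c: "linear_map R Y Q c" "c ` carrier Y = carrier Q"
    and W: "module R W" and g: "linear_map R Y W g"
    and ker: "\<And>y. y \<in> carrier Y \<Longrightarrow> c y = \<zero>\<^bsub>Q\<^esub> \<Longrightarrow> g y = \<zero>\<^bsub>W\<^esub>"
  shows "\<exists>h. linear_map R Q W h \<and> (\<forall>y\<in>carrier Y. h (c y) = g y)"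
proof (intro exI conjI ballI)
  let ?h = "\<lambda>q. g (inv_into (carrier Y) c q)"
  have cl: "inv_into (carrier Y) c q \<in> carrier Y" "c (inv_into (carrier Y) c q) = q" if "q \<in> carrier Q" for q
    using that c(2) by (auto simp: inv_into_into f_inv_into_f)
  have eq: "g y = g y'" if y: "y \<in> carrier Y" "y' \<in> carrier Y" "c y = c y'" for y y'
  proof -
    have "c (y \<ominus>\<^bsub>Y\<^esub> y') = \<zero>\<^bsub>Q\<^esub>"
      using linear_map_minus[OF Y Q c(1) y(1,2)] y(3) linear_map_closed[OF c(1)] y
        abelian_group.minus_eq_zero_iff[OF module_group[OF Q]] by simp
    then have "g (y \<ominus>\<^bsub>Y\<^esub> y') = \<zero>\<^bsub>W\<^esub>" using ker abelian_group.minus_closed[OF module_group[OF Y] y(1,2)] by blast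
    then show ?thesis
      using linear_map_minus[OF Y W g y(1,2)] linear_map_closed[OF g] y
        abelian_group.minus_eq_zero_iff[OF module_group[OF W]] by simp
  qed
  show *: "?h (c y) = g y" if "y \<in> carrier Y" for y
    by (rule eq) (use that cl linear_map_closed[OF c(1)] in auto)
  show "linear_map R Q W ?h"
  proof (rule linear_mapI)
    show "?h x \<in> carrier W" if "x \<in> carrier Q" for x using cl[OF that] linear_map_closed[OF g] by blast
    show "?h (x \<oplus>\<^bsub>Q\<^esub> y) = ?h x \<oplus>\<^bsub>W\<^esub> ?h y" if "x \<in> carrier Q" "y \<in> carrier Q" for x y
      unfolding linear_map_add[OF g cl(1)[OF that(1)] cl(1)[OF that(2)], symmetric]
      by (rule eq) (use cl that module_add_closed[OF Y] module_add_closed[OF Q] linear_map_add[OF c(1)] in auto)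
    show "?h (r \<odot>\<^bsub>Q\<^esub> x) = r \<odot>\<^bsub>W\<^esub> ?h x" if "r \<in> carrier R" "x \<in> carrier Q" for r x
      unfolding linear_map_smult[OF g that(1) cl(1)[OF that(2)], symmetric]
      by (rule eq) (use cl that module.smult_closed[OF Y] module.smult_closed[OF Q] linear_map_smult[OF c(1)] in auto)
  qed
qed

lemma linear_inverse:
  assumes "module R M" "module R N" "linear_map R M N f" "bij_betw f (carrier M) (carrier N)"
  shows "linear_map R N M (inv_into (carrier M) f)"
proof -
  have id: "linear_map R N N (\<lambda>x. x)" by (rule linear_mapI) auto
  have "inj_on f (carrier M)" "(\<lambda>x. x) ` carrier N \<subseteq> f ` carrier M" using assms(4) by (auto simp: bij_betw_def)
  from linear_factor_inj[OF assms(1,3) this(1) assms(2) id this(2)]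
  obtain h where h: "linear_map R N M h" "\<forall>w\<in>carrier N. f (h w) = w" by blast
  have "inv_into (carrier M) f x = h x" if "x \<in> carrier N" for x
    using h that linear_map_closed[OF h(1) that] assms(4) by (metis bij_betw_def inv_into_f_f)
  then show ?thesis using linear_map_cong[OF h(1) assms(2)] by blast
qed

lemma graded_module_iso_sym:
  assumes "\<And>i. module R (G i)" "\<And>i. module R (H i)" "graded_module_iso R G H"
  shows "graded_module_iso R H G"
  unfolding graded_module_iso_def
proof
  fix i
  obtain f where "linear_map R (G i) (H i) f" "bij_betw f (carrier (G i)) (carrier (H i))"
    using assms(3) unfolding graded_module_iso_def by blast
  then show "\<exists>f. linear_map R (H i) (G i) f \<and> bij_betw f (carrier (H i)) (carrier (G i))"
    using linear_inverse[OF assms(1,2)] bij_betw_inv_into by blast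
qed

lemma graded_module_iso_trans:
  assumes "graded_module_iso R G H" "graded_module_iso R H K"
  shows "graded_module_iso R G K"
  unfolding graded_module_iso_def
proof
  fix i
  obtain f where "linear_map R (G i) (H i) f" "bij_betw f (carrier (G i)) (carrier (H i))"
    using assms(1) unfolding graded_module_iso_def by blast
  moreover obtain g where "linear_map R (H i) (K i) g" "bij_betw g (carrier (H i)) (carrier (K i))"
    using assms(2) unfolding graded_module_iso_def by blast
  ultimately show "\<exists>f. linear_map R (G i) (K i) f \<and> bij_betw f (carrier (G i)) (carrier (K i))"
    using linear_map_comp bij_betw_trans by blast
qed

lemma kernel_submodule:
  assumes M: "module R M" and N: "module R N" and f: "linear_map R M N f"
  shows "module R (M\<lparr>carrier := {x \<in> carrier M. f x = \<zero>\<^bsub>N\<^esub>}\<rparr>)"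
proof (rule submodule.submodule_is_module[OF _ M], rule module.submoduleI[OF M])
  interpret M: abelian_group M by (rule module_group[OF M])
  interpret N: abelian_group N by (rule module_group[OF N])
  have neg: "f (\<ominus>\<^bsub>M\<^esub> x) = \<zero>\<^bsub>N\<^esub>" if "x \<in> carrier M" "f x = \<zero>\<^bsub>N\<^esub>" for x
    using linear_map_minus[OF M N f, of "\<zero>\<^bsub>M\<^esub>" x] linear_map_0[OF M N f] that
    by (simp add: a_minus_def)
  show "\<ominus>\<^bsub>M\<^esub> a \<in> {x \<in> carrier M. f x = \<zero>\<^bsub>N\<^esub>}" if "a \<in> {x \<in> carrier M. f x = \<zero>\<^bsub>N\<^esub>}" for a
    using that neg by simp
qed (use linear_map_0[OF M N f] linear_map_add[OF f] linear_map_smult[OF f] in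
    \<open>auto simp: module_zero_closed[OF M] module_zero_closed[OF N] module_add_closed[OF M] module.smult_closed[OF M]
      module.smult_r_null[OF N] abelian_monoid.l_zero[OF abelian_group.axioms(1)[OF module_group[OF N]]]\<close>)

lemma image_submodule:
  assumes M: "module R M" and N: "module R N" and f: "linear_map R M N f"
  shows "module R (N\<lparr>carrier := f ` carrier M\<rparr>)"
proof (rule submodule.submodule_is_module[OF _ N], rule module.submoduleI[OF N])
  interpret M: abelian_group M by (rule module_group[OF M])
  interpret N: abelian_group N by (rule module_group[OF N])
  have neg: "f (\<ominus>\<^bsub>M\<^esub> x) = \<ominus>\<^bsub>N\<^esub> f x" if "x \<in> carrier M" for x
    using linear_map_minus[OF M N f, of "\<zero>\<^bsub>M\<^esub>" x] linear_map_0[OF M N f] that linear_map_closed[OF f that]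
    by (simp add: a_minus_def)
  show "\<ominus>\<^bsub>N\<^esub> a \<in> f ` carrier M" if "a \<in> f ` carrier M" for a
    using that by (auto simp: neg[symmetric])
  show "\<zero>\<^bsub>N\<^esub> \<in> f ` carrier M" using linear_map_0[OF M N f] by (metis M.zero_closed image_eqI)
  show "a \<oplus>\<^bsub>N\<^esub> b \<in> f ` carrier M" if "a \<in> f ` carrier M" "b \<in> f ` carrier M" for a b
    using that by (auto simp: linear_map_add[OF f, symmetric])
  show "a \<odot>\<^bsub>N\<^esub> x \<in> f ` carrier M" if "a \<in> carrier R" "x \<in> f ` carrier M" for a x
    using that module.smult_closed[OF M] by (auto simp: linear_map_smult[OF f, symmetric])
qed (use linear_map_closed[OF f] in auto)

text \<open>Copies a module into another type: morphism groups have elements in \<open>'m\<close>,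
  the objects of the graded category have elements in \<open>'u\<close>.\<close>

definition transport_module :: "('a \<Rightarrow> 'b) \<Rightarrow> ('r, 'a) module \<Rightarrow> ('r, 'b) module" where
  "transport_module p M = (let q = inv_into (carrier M) p in
     \<lparr>carrier = p ` carrier M, monoid.mult = undefined, one = undefined, zero = p \<zero>\<^bsub>M\<^esub>,
      add = (\<lambda>a b. p (q a \<oplus>\<^bsub>M\<^esub> q b)), smult = (\<lambda>r a. p (r \<odot>\<^bsub>M\<^esub> q a))\<rparr>)"

lemma transport_module:
  assumes M: "module R M" and p: "inj_on p (carrier M)"
  shows "module R (transport_module p M)" and "linear_map R M (transport_module p M) p"
    and "bij_betw p (carrier M) (carrier (transport_module p M))"
proof -
  interpret M: module R M by fact
  let ?N = "transport_module p M"
  have c: "carrier ?N = p ` carrier M" and z: "\<zero>\<^bsub>?N\<^esub> = p \<zero>\<^bsub>M\<^esub>"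
    by (simp_all add: transport_module_def Let_def)
  have a: "p x \<oplus>\<^bsub>?N\<^esub> p y = p (x \<oplus>\<^bsub>M\<^esub> y)" if "x \<in> carrier M" "y \<in> carrier M" for x y
    using that p by (simp add: transport_module_def Let_def)
  have s: "r \<odot>\<^bsub>?N\<^esub> p x = p (r \<odot>\<^bsub>M\<^esub> x)" if "x \<in> carrier M" for r x
    using that p by (simp add: transport_module_def Let_def)
  have "abelian_group ?N"
  proof (rule abelian_groupI)
    fix x assume "x \<in> carrier ?N"
    then obtain x' where x': "x' \<in> carrier M" "x = p x'" using c by auto
    then have "p (\<ominus>\<^bsub>M\<^esub> x') \<oplus>\<^bsub>?N\<^esub> x = \<zero>\<^bsub>?N\<^esub>" using a z M.M.l_neg by simp
    then show "\<exists>y\<in>carrier ?N. y \<oplus>\<^bsub>?N\<^esub> x = \<zero>\<^bsub>?N\<^esub>" using c x' by blast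
  qed (auto simp: c z a M.M.a_ac)
  then show "module R ?N"
    by (intro moduleI M.R.is_cring)
      (auto simp: c a s M.smult_l_distr M.smult_r_distr M.smult_assoc1)
  show "linear_map R M ?N p" by (rule linear_mapI) (auto simp: c a s)
  show "bij_betw p (carrier M) (carrier ?N)" using p c by (simp add: bij_betw_def)
qed

section \<open>Graded modules: categorical notions read off on elements\<close>

abbreviation (input) "GM \<equiv> graded_modules"

lemma GM_Obj [simp]: "G \<in> Obj (GM \<kappa> R) \<longleftrightarrow> (\<forall>i. module R (G i) \<and> small \<kappa> (carrier (G i)))"
  by (simp add: graded_modules_def)

lemma GM_Mor [simp]: "f \<in> Mor (GM \<kappa> R) G H \<longleftrightarrow>
    (\<forall>i. linear_map R (G i) (H i) (f i) \<and> f i \<in> extensional (carrier (G i)))"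
  by (simp add: graded_modules_def)

lemma GM_Zero [simp]: "Zero (GM \<kappa> R) G H = (\<lambda>i. \<lambda>x\<in>carrier (G i). \<zero>\<^bsub>H i\<^esub>)"
  by (simp add: graded_modules_def)

lemma GM_Comp [simp]: "Comp (GM \<kappa> R) G H K g f = (\<lambda>i. compose (carrier (G i)) (g i) (f i))"
  by (simp add: graded_modules_def)

lemma GM_Id [simp]: "Id (GM \<kappa> R) G = (\<lambda>i. \<lambda>x\<in>carrier (G i). x)"
  by (simp add: graded_modules_def)

lemma linear_map_zero_map: "module R M \<Longrightarrow> module R N \<Longrightarrow> linear_map R M N (\<lambda>x\<in>carrier M. \<zero>\<^bsub>N\<^esub>)"
  by (rule linear_mapI)
    (auto simp: module_zero_closed module_add_closed module.smult_closed module.smult_r_null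
      abelian_monoid.l_zero abelian_group.axioms(1) module_group)

text \<open>A test object: a universal property speaks of morphisms only, and evaluating it on the
  elementwise kernel recovers statements about elements.\<close>

lemma kernel_inclusion:
  assumes o: "X \<in> Obj (GM \<kappa> R)" "Y \<in> Obj (GM \<kappa> R)"
    and f: "f \<in> Mor (GM \<kappa> R) X Y"
  shows "\<exists>W\<in>Obj (GM \<kappa> R). \<exists>u\<in>Mor (GM \<kappa> R) W X.
    Comp (GM \<kappa> R) W X Y f u = Zero (GM \<kappa> R) W Y \<and>
    (\<forall>i. carrier (W i) = {x \<in> carrier (X i). f i x = \<zero>\<^bsub>Y i\<^esub>} \<and> (\<forall>x\<in>carrier (W i). u i x = x))"
proof -
  let ?C = "GM \<kappa> R"
  define W where "W i = (X i)\<lparr>carrier := {x \<in> carrier (X i). f i x = \<zero>\<^bsub>Y i\<^esub>}\<rparr>" for i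
  define u where "u i = (\<lambda>x\<in>carrier (W i). x)" for i
  have Wm: "module R (W i)" for i unfolding W_def using o f by (intro kernel_submodule) auto
  have "small \<kappa> (carrier (W i))" for i
    using o by (auto simp: W_def intro: small_subset[of \<kappa> "carrier (X i)"])
  then have "W \<in> Obj ?C" using Wm by simp
  moreover have "u \<in> Mor ?C W X"
    using module_add_closed[OF Wm] module.smult_closed[OF Wm] by (auto simp: u_def W_def intro!: linear_mapI)
  moreover have "Comp ?C W X Y f u = Zero ?C W Y" by (auto simp: compose_def u_def W_def fun_eq_iff)
  moreover have "\<forall>i. carrier (W i) = {x \<in> carrier (X i). f i x = \<zero>\<^bsub>Y i\<^esub>} \<and> (\<forall>x\<in>carrier (W i). u i x = x)"
    by (simp add: W_def u_def)
  ultimately show ?thesis by (intro bexI[of _ u] bexI[of _ W] conjI)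
qed

lemma is_kernel_elementwise:
  assumes k: "is_kernel (GM \<kappa> R) X Y Z f g"
    and o: "X \<in> Obj (GM \<kappa> R)" "Y \<in> Obj (GM \<kappa> R)" "Z \<in> Obj (GM \<kappa> R)"
    and g: "g \<in> Mor (GM \<kappa> R) Y Z"
  shows "inj_on (f i) (carrier (X i))"
    and "f i ` carrier (X i) = {y \<in> carrier (Y i). g i y = \<zero>\<^bsub>Z i\<^esub>}"
proof -
  let ?C = "GM \<kappa> R"
  have f: "f \<in> Mor ?C X Y" and gf: "Comp ?C X Y Z g f = Zero ?C X Z"
    and un: "\<And>W u. W \<in> Obj ?C \<Longrightarrow> u \<in> Mor ?C W Y \<Longrightarrow> Comp ?C W Y Z g u = Zero ?C W Z \<Longrightarrow>
      \<exists>!h. h \<in> Mor ?C W X \<and> Comp ?C W X Y f h = u"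
    using k unfolding is_kernel_def by blast+
  have m: "\<And>i. module R (X i)" "\<And>i. module R (Y i)" "\<And>i. module R (Z i)" using o by simp_all
  have fl: "\<And>i. linear_map R (X i) (Y i) (f i)" and gl: "\<And>i. linear_map R (Y i) (Z i) (g i)"
    using f g by simp_all
  have gf0: "g i (f i x) = \<zero>\<^bsub>Z i\<^esub>" if "x \<in> carrier (X i)" for i x
    using fun_cong[OF fun_cong[OF gf, of i], of x] that by (simp add: compose_eq)
  show "inj_on (f i) (carrier (X i))"
  proof (rule linear_map_inj[OF m(1,2) fl])
    fix x assume x: "x \<in> carrier (X i)" "f i x = \<zero>\<^bsub>Y i\<^esub>"
    \<comment> \<open>The inclusion of the elementwise kernel of \<open>f\<close> and the zero map
      have the same composite with \<open>f\<close>, so uniqueness of factorizations through the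
      categorical kernel makes the inclusion zero.\<close>
    obtain W u where W: "W \<in> Obj ?C" and u: "u \<in> Mor ?C W X" "Comp ?C W X Y f u = Zero ?C W Y"
      and Wi: "\<forall>i. carrier (W i) = {x \<in> carrier (X i). f i x = \<zero>\<^bsub>Y i\<^esub>} \<and> (\<forall>x\<in>carrier (W i). u i x = x)"
      using kernel_inclusion[OF o(1,2) f] by (elim bexE conjE) (rule that)
    have Wm: "module R (W i)" for i using W by simp
    have z: "Zero ?C W X \<in> Mor ?C W X" "Zero ?C W Y \<in> Mor ?C W Y"
      using linear_map_zero_map[OF Wm m(1)] linear_map_zero_map[OF Wm m(2)] by auto
    have "Comp ?C W X Y f (Zero ?C W X) = Zero ?C W Y" "Comp ?C W Y Z g (Zero ?C W Y) = Zero ?C W Z"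
      using linear_map_0[OF m(1,2) fl] linear_map_0[OF m(2,3) gl] by (auto simp: compose_def fun_eq_iff)
    then have "u = Zero ?C W X" using un[OF W z(2)] u z(1) by blast
    then have "u i x = (\<lambda>x\<in>carrier (W i). \<zero>\<^bsub>X i\<^esub>) x" by simp
    then show "x = \<zero>\<^bsub>X i\<^esub>" using x Wi by simp
  qed
  show "f i ` carrier (X i) = {y \<in> carrier (Y i). g i y = \<zero>\<^bsub>Z i\<^esub>}"
  proof (intro equalityI subsetI)
    fix y assume "y \<in> f i ` carrier (X i)"
    then show "y \<in> {y \<in> carrier (Y i). g i y = \<zero>\<^bsub>Z i\<^esub>}" using gf0 linear_map_closed[OF fl] by auto
  next
    fix y assume y: "y \<in> {y \<in> carrier (Y i). g i y = \<zero>\<^bsub>Z i\<^esub>}"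
    obtain W u where W: "W \<in> Obj ?C" and u: "u \<in> Mor ?C W Y" "Comp ?C W Y Z g u = Zero ?C W Z"
      and Wi: "\<forall>i. carrier (W i) = {x \<in> carrier (Y i). g i x = \<zero>\<^bsub>Z i\<^esub>} \<and> (\<forall>x\<in>carrier (W i). u i x = x)"
      using kernel_inclusion[OF o(2,3) g] by (elim bexE conjE) (rule that)
    obtain h where h: "h \<in> Mor ?C W X" "Comp ?C W X Y f h = u" using un[OF W u] by blast
    have yW: "y \<in> carrier (W i)" using y Wi by simp
    have "f i (h i y) = y"
      using fun_cong[OF fun_cong[OF h(2), of i], of y] yW Wi by (simp add: compose_eq)
    moreover have "h i y \<in> carrier (X i)" using h(1) yW linear_map_closed by fastforce
    ultimately show "y \<in> f i ` carrier (X i)" by (metis image_eqI)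
  qed
qed

text \<open>The cokernel of \<open>f\<close> factors through the image of \<open>g\<close>, hence \<open>g\<close> is onto.\<close>

lemma is_cokernel_surj:
  assumes k: "is_cokernel (GM \<kappa> R) X Y Z f g"
    and o: "X \<in> Obj (GM \<kappa> R)" "Y \<in> Obj (GM \<kappa> R)" "Z \<in> Obj (GM \<kappa> R)"
  shows "g i ` carrier (Y i) = carrier (Z i)"
proof -
  let ?C = "GM \<kappa> R"
  have g: "g \<in> Mor ?C Y Z" and gf: "Comp ?C X Y Z g f = Zero ?C X Z"
    and un: "\<And>W u. W \<in> Obj ?C \<Longrightarrow> u \<in> Mor ?C Y W \<Longrightarrow> Comp ?C X Y W u f = Zero ?C X W \<Longrightarrow>
      \<exists>!h. h \<in> Mor ?C Z W \<and> Comp ?C Y Z W h g = u"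
    using k unfolding is_cokernel_def by blast+
  have m: "\<And>i. module R (Y i)" "\<And>i. module R (Z i)" using o by simp_all
  have gl: "\<And>i. linear_map R (Y i) (Z i) (g i)" using g by simp_all
  define W where "W i = (Z i)\<lparr>carrier := g i ` carrier (Y i)\<rparr>" for i
  have Wm: "module R (W i)" for i unfolding W_def by (rule image_submodule[OF m gl])
  have WZ: "carrier (W i) \<subseteq> carrier (Z i)" for i using linear_map_closed[OF gl] by (auto simp: W_def)
  moreover have "small \<kappa> (carrier (Z i))" for i using o(3) by simp
  ultimately have "small \<kappa> (carrier (W i))" for i by (blast intro: small_subset)
  then have W: "W \<in> Obj ?C" using Wm by simp
  have gW: "g \<in> Mor ?C Y W"
  proof -
    have "linear_map R (Y i) (W i) (g i)" for i
      using linear_map_add[OF gl] linear_map_smult[OF gl] by (intro linear_mapI) (auto simp: W_def)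
    then show ?thesis using g by simp
  qed
  have "Comp ?C X Y W g f = Zero ?C X W" using gf by (simp add: W_def)
  from un[OF W gW this] obtain h where h: "h \<in> Mor ?C Z W" "Comp ?C Y Z W h g = g" by blast
  have hZ: "h \<in> Mor ?C Z Z"
  proof -
    have "linear_map R (Z i) (Z i) (h i)" for i
    proof -
      have hl: "linear_map R (Z i) (W i) (h i)" using h(1) by simp
      show ?thesis
        using linear_map_closed[OF hl] WZ[of i] linear_map_add[OF hl] linear_map_smult[OF hl]
        by (intro linear_mapI) (auto simp: W_def)
    qed
    then show ?thesis using h(1) by simp
  qed
  have i: "Id ?C Z \<in> Mor ?C Z Z" "Comp ?C Y Z Z (Id ?C Z) g = g"
    using module_add_closed[OF m(2)] module.smult_closed[OF m(2)] g linear_map_closed[OF gl]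
    by (auto intro!: linear_mapI ext simp: compose_def extensional_def)
  have "Comp ?C Y Z Z h g = g" using h(2) by simp
  \<comment> \<open>The identity and \<open>h\<close>, viewed as an endomorphism of
    \<open>Z\<close>, both fix \<open>g\<close>, so they agree; but \<open>h\<close> takes values in
    the image of \<open>g\<close>.\<close>
  with un[OF o(3) g gf] have "h = Id ?C Z" using hZ i by blast
  then have "z \<in> g i ` carrier (Y i)" if "z \<in> carrier (Z i)" for z
    using h(1) that linear_map_closed[of R "Z i" "W i" "h i" z] by (simp add: W_def)
  then show ?thesis using WZ[of i] by (auto simp: W_def)
qed

lemma short_exactI_elementwise:
  assumes o: "X \<in> Obj (GM \<kappa> R)" "Y \<in> Obj (GM \<kappa> R)" "Z \<in> Obj (GM \<kappa> R)"
    and f: "f \<in> Mor (GM \<kappa> R) X Y" and g: "g \<in> Mor (GM \<kappa> R) Y Z"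
    and inj: "\<And>i. inj_on (f i) (carrier (X i))" and surj: "\<And>i. g i ` carrier (Y i) = carrier (Z i)"
    and ex: "\<And>i. f i ` carrier (X i) = {y \<in> carrier (Y i). g i y = \<zero>\<^bsub>Z i\<^esub>}"
  shows "short_exact (GM \<kappa> R) X Y Z f g"
proof -
  let ?C = "GM \<kappa> R"
  have m: "\<And>i. module R (X i)" "\<And>i. module R (Y i)" "\<And>i. module R (Z i)" using o by simp_all
  have fl: "\<And>i. linear_map R (X i) (Y i) (f i)" and gl: "\<And>i. linear_map R (Y i) (Z i) (g i)"
    using f g by simp_all
  have gf: "Comp ?C X Y Z g f = Zero ?C X Z"
    using ex by (auto simp: compose_def fun_eq_iff)
  have "is_kernel ?C X Y Z f g"
    unfolding is_kernel_def
  proof (intro conjI ballI impI)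
    fix W u assume W: "W \<in> Obj ?C" and u: "u \<in> Mor ?C W Y" and gu: "Comp ?C W Y Z g u = Zero ?C W Z"
    have Wm: "\<And>i. module R (W i)" and ul: "\<And>i. linear_map R (W i) (Y i) (u i)" using W u by simp_all
    have "g i (u i w) = \<zero>\<^bsub>Z i\<^esub>" if "w \<in> carrier (W i)" for i w
      using fun_cong[OF fun_cong[OF gu, of i], of w] that by (simp add: compose_eq)
    then have im: "u i ` carrier (W i) \<subseteq> f i ` carrier (X i)" for i
      using ex linear_map_closed[OF ul] by auto
    have "\<exists>h. linear_map R (W i) (X i) h \<and> (\<forall>w\<in>carrier (W i). f i (h w) = u i w)" for i
      by (rule linear_factor_inj[OF m(1) fl inj Wm ul im])
    then obtain h where h: "\<And>i. linear_map R (W i) (X i) (h i)" "\<And>i w. w \<in> carrier (W i) \<Longrightarrow> f i (h i w) = u i w"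
      by metis
    show "\<exists>!h. h \<in> Mor ?C W X \<and> Comp ?C W X Y f h = u"
    proof (rule ex1I[of _ "\<lambda>i. restrict (h i) (carrier (W i))"], intro conjI)
      show "(\<lambda>i. restrict (h i) (carrier (W i))) \<in> Mor ?C W X"
        using linear_map_cong[OF h(1) Wm] by auto
      show "Comp ?C W X Y f (\<lambda>i. restrict (h i) (carrier (W i))) = u"
        using h(2) u by (auto simp: compose_def fun_eq_iff extensional_def)
      fix h' assume h': "h' \<in> Mor ?C W X \<and> Comp ?C W X Y f h' = u"
      show "h' = (\<lambda>i. restrict (h i) (carrier (W i)))"
      proof (intro ext)
        fix i w
        show "h' i w = restrict (h i) (carrier (W i)) w"
        proof (cases "w \<in> carrier (W i)")
          case True
          have "f i (h' i w) = u i w"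
            using fun_cong[OF fun_cong[OF conjunct2[OF h'], of i], of w] True by (simp add: compose_eq)
          then have "f i (h' i w) = f i (h i w)" using h(2)[OF True] by simp
          moreover have "h' i w \<in> carrier (X i)" "h i w \<in> carrier (X i)"
            using h' linear_map_closed[OF h(1) True] linear_map_closed[OF _ True] by auto
          ultimately show ?thesis using inj[of i] True by (auto dest: inj_onD)
        next
          case False
          then show ?thesis using h' by (auto simp: extensional_def)
        qed
      qed
    qed
  qed (use o f gf in auto)
  moreover have "is_cokernel ?C X Y Z f g"
    unfolding is_cokernel_def
  proof (intro conjI ballI impI)
    fix W u assume W: "W \<in> Obj ?C" and u: "u \<in> Mor ?C Y W" and uf: "Comp ?C X Y W u f = Zero ?C X W"
    have Wm: "\<And>i. module R (W i)" and ul: "\<And>i. linear_map R (Y i) (W i) (u i)" using W u by simp_all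
    have ker: "u i y = \<zero>\<^bsub>W i\<^esub>" if y: "y \<in> carrier (Y i)" "g i y = \<zero>\<^bsub>Z i\<^esub>" for i y
    proof -
      obtain x where "x \<in> carrier (X i)" "y = f i x" using ex[of i] y by blast
      then show ?thesis using fun_cong[OF fun_cong[OF uf, of i], of x] by (simp add: compose_eq)
    qed
    have "\<exists>h. linear_map R (Z i) (W i) h \<and> (\<forall>y\<in>carrier (Y i). h (g i y) = u i y)" for i
      by (rule linear_factor_surj[OF m(2,3) gl surj Wm ul ker])
    then obtain h where h: "\<And>i. linear_map R (Z i) (W i) (h i)" "\<And>i y. y \<in> carrier (Y i) \<Longrightarrow> h i (g i y) = u i y"
      by metis
    show "\<exists>!h. h \<in> Mor ?C Z W \<and> Comp ?C Y Z W h g = u"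
    proof (rule ex1I[of _ "\<lambda>i. restrict (h i) (carrier (Z i))"], intro conjI)
      show "(\<lambda>i. restrict (h i) (carrier (Z i))) \<in> Mor ?C Z W"
        using linear_map_cong[OF h(1) m(3)] by auto
      show "Comp ?C Y Z W (\<lambda>i. restrict (h i) (carrier (Z i))) g = u"
        using h(2) u linear_map_closed[OF gl] by (auto simp: compose_def fun_eq_iff extensional_def)
      fix h' assume h': "h' \<in> Mor ?C Z W \<and> Comp ?C Y Z W h' g = u"
      show "h' = (\<lambda>i. restrict (h i) (carrier (Z i)))"
      proof (intro ext)
        fix i z
        show "h' i z = restrict (h i) (carrier (Z i)) z"
        proof (cases "z \<in> carrier (Z i)")
          case True
          then obtain y where y: "y \<in> carrier (Y i)" "z = g i y" using surj[of i] by blast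
          have "h' i z = u i y"
            using fun_cong[OF fun_cong[OF conjunct2[OF h'], of i], of y] y by (simp add: compose_eq)
          then show ?thesis using h(2)[OF y(1)] y(2) True by simp
        next
          case False
          then show ?thesis using h' by (auto simp: extensional_def)
        qed
      qed
    qed
  qed (use o g gf in auto)
  ultimately show ?thesis unfolding short_exact_def using o f g by blast
qed

lemma short_exact_elementwise:
  assumes "short_exact (GM \<kappa> R) X Y Z f g"
  shows "inj_on (f i) (carrier (X i))"
    and "f i ` carrier (X i) = {y \<in> carrier (Y i). g i y = \<zero>\<^bsub>Z i\<^esub>}"
    and "g i ` carrier (Y i) = carrier (Z i)"
  using assms is_kernel_elementwise[of \<kappa> R X Y Z f g] is_cokernel_surj[of \<kappa> R X Y Z f g]
  unfolding short_exact_def by blast+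

text \<open>The factorization takes place in \<open>A\<close>; since the embedding is exact, its two
  short exact sequences stay short exact among all graded modules, where they can be read on
  elements. So the kernel and cokernel formed in \<open>A\<close> are those of modules.\<close>

lemma exact_abelian_kernel_cokernel:
  assumes A: "exact_abelian_subcategory (GM \<kappa> R) A"
    and o: "G \<in> A" "H \<in> A" and f: "f \<in> Mor (GM \<kappa> R) G H"
  shows "\<exists>K\<in>A. \<exists>k\<in>Mor (GM \<kappa> R) K G. \<exists>Q\<in>A. \<exists>c\<in>Mor (GM \<kappa> R) H Q. \<forall>i.
     inj_on (k i) (carrier (K i)) \<and> k i ` carrier (K i) = {x \<in> carrier (G i). f i x = \<zero>\<^bsub>H i\<^esub>} \<and>
     c i ` carrier (H i) = carrier (Q i) \<and> f i ` carrier (G i) = {y \<in> carrier (H i). c i y = \<zero>\<^bsub>Q i\<^esub>}"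
proof -
  let ?C = "GM \<kappa> R"
  interpret A: abelian_category "full_sub ?C A" using A by (simp add: exact_abelian_subcategory_def)
  have "f \<in> A.Ar G H" using o f by (simp add: A.Ar_def)
  then obtain K I Q k e m c where s: "short_exact (full_sub ?C A) K G I k e"
    "short_exact (full_sub ?C A) I H Q m c" "f = Comp ?C G I H m e"
    using A.image_factorization[of f G H] by auto
  have ko: "K \<in> A" "I \<in> A" "Q \<in> A" and km: "k \<in> Mor ?C K G" "c \<in> Mor ?C H Q" "m \<in> Mor ?C I H" "e \<in> Mor ?C G I"
    using s(1,2) unfolding short_exact_def full_sub_simps by blast+
  have S: "short_exact ?C K G I k e" "short_exact ?C I H Q m c"
    using A s(1,2) unfolding exact_abelian_subcategory_def by blast+
  note E1 = short_exact_elementwise[OF S(1)] and E2 = short_exact_elementwise[OF S(2)]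
  have AO: "A \<subseteq> Obj ?C" using A by (simp add: exact_abelian_subcategory_def strictly_full_def)
  have md: "\<And>i. module R (I i)" "\<And>i. module R (H i)" using AO ko o by (auto simp: subset_iff)
  have ml: "\<And>i. linear_map R (I i) (H i) (m i)" and el: "\<And>i. linear_map R (G i) (I i) (e i)" using km by simp_all
  have fe: "f i x = m i (e i x)" if "x \<in> carrier (G i)" for i x
    using s(3) that by (simp add: compose_eq)
  have k0: "f i x = \<zero>\<^bsub>H i\<^esub> \<longleftrightarrow> e i x = \<zero>\<^bsub>I i\<^esub>" if x: "x \<in> carrier (G i)" for i x
  proof -
    have "m i (e i x) = m i \<zero>\<^bsub>I i\<^esub> \<longleftrightarrow> e i x = \<zero>\<^bsub>I i\<^esub>"
      using inj_on_eq_iff[OF E2(1)] linear_map_closed[OF el x] module_zero_closed[OF md(1)] by blast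
    then show ?thesis using fe[OF x] linear_map_0[OF md ml] by simp
  qed
  have "k i ` carrier (K i) = {x \<in> carrier (G i). f i x = \<zero>\<^bsub>H i\<^esub>}" for i
    using E1(2)[of i] k0 by blast
  moreover have "f i ` carrier (G i) = {y \<in> carrier (H i). c i y = \<zero>\<^bsub>Q i\<^esub>}" for i
  proof -
    have "f i ` carrier (G i) = m i ` (e i ` carrier (G i))" using fe by (auto simp: image_iff)
    then show ?thesis using E1(3)[of i] E2(2)[of i] by simp
  qed
  ultimately show ?thesis
    using E1(1) E2(3) by (intro bexI[OF _ ko(1)] bexI[OF _ km(1)] bexI[OF _ ko(3)] bexI[OF _ km(2)] allI conjI) auto
qed

text \<open>Exactness makes \<open>X3\<close> an extension of the kernel of \<open>f4\<close> by the
  cokernel of \<open>f1\<close>, and both of these lie in \<open>A\<close>.\<close>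

lemma five_term_closed:
  assumes A: "exact_abelian_subcategory (GM \<kappa> R) A" and ec: "extension_closed (GM \<kappa> R) A"
    and o: "X1 \<in> A" "X2 \<in> A" "X4 \<in> A" "X5 \<in> A" and X3: "X3 \<in> Obj (GM \<kappa> R)"
    and f: "f1 \<in> Mor (GM \<kappa> R) X1 X2" "f2 \<in> Mor (GM \<kappa> R) X2 X3"
      "f3 \<in> Mor (GM \<kappa> R) X3 X4" "f4 \<in> Mor (GM \<kappa> R) X4 X5"
    and ex: "\<And>i. f1 i ` carrier (X1 i) = {x \<in> carrier (X2 i). f2 i x = \<zero>\<^bsub>X3 i\<^esub>}"
      "\<And>i. f2 i ` carrier (X2 i) = {x \<in> carrier (X3 i). f3 i x = \<zero>\<^bsub>X4 i\<^esub>}"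
      "\<And>i. f3 i ` carrier (X3 i) = {x \<in> carrier (X4 i). f4 i x = \<zero>\<^bsub>X5 i\<^esub>}"
  shows "X3 \<in> A"
proof -
  let ?C = "GM \<kappa> R"
  have AO: "A \<subseteq> Obj ?C" using A by (simp add: exact_abelian_subcategory_def strictly_full_def)
  obtain Q c where Q: "Q \<in> A" "c \<in> Mor ?C X2 Q"
    and "\<forall>i. c i ` carrier (X2 i) = carrier (Q i) \<and> f1 i ` carrier (X1 i) = {y \<in> carrier (X2 i). c i y = \<zero>\<^bsub>Q i\<^esub>}"
    using exact_abelian_kernel_cokernel[OF A o(1,2) f(1)] by (elim bexE) (rule that, assumption, assumption, blast)
  then have Qi: "c i ` carrier (X2 i) = carrier (Q i)"
    "f1 i ` carrier (X1 i) = {y \<in> carrier (X2 i). c i y = \<zero>\<^bsub>Q i\<^esub>}" for i by simp_all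
  obtain K k where K: "K \<in> A" "k \<in> Mor ?C K X4"
    and "\<forall>i. inj_on (k i) (carrier (K i)) \<and> k i ` carrier (K i) = {x \<in> carrier (X4 i). f4 i x = \<zero>\<^bsub>X5 i\<^esub>}"
    using exact_abelian_kernel_cokernel[OF A o(3,4) f(4)] by (elim bexE) (rule that, assumption, assumption, blast)
  then have Ki: "inj_on (k i) (carrier (K i))"
    "k i ` carrier (K i) = {x \<in> carrier (X4 i). f4 i x = \<zero>\<^bsub>X5 i\<^esub>}" for i by simp_all
  have m: "\<And>i. module R (X2 i)" "\<And>i. module R (X3 i)" "\<And>i. module R (X4 i)" "\<And>i. module R (Q i)" "\<And>i. module R (K i)"
    using AO o X3 Q(1) K(1) by (auto simp: subset_iff)
  have l: "\<And>i. linear_map R (X2 i) (X3 i) (f2 i)" "\<And>i. linear_map R (X3 i) (X4 i) (f3 i)"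
    "\<And>i. linear_map R (X2 i) (Q i) (c i)" "\<And>i. linear_map R (K i) (X4 i) (k i)"
    using f Q(2) K(2) by simp_all
  have kc: "f2 i x = \<zero>\<^bsub>X3 i\<^esub> \<longleftrightarrow> c i x = \<zero>\<^bsub>Q i\<^esub>" if "x \<in> carrier (X2 i)" for i x
    using ex(1)[of i] Qi(2)[of i] that by blast
  have "\<exists>h. linear_map R (Q i) (X3 i) h \<and> (\<forall>y\<in>carrier (X2 i). h (c i y) = f2 i y)" for i
    by (rule linear_factor_surj[OF m(1,4) l(3) Qi(1) m(2) l(1)]) (simp add: kc)
  then obtain a where a: "\<And>i. linear_map R (Q i) (X3 i) (a i)" "\<And>i y. y \<in> carrier (X2 i) \<Longrightarrow> a i (c i y) = f2 i y"
    by metis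
  have im: "f3 i ` carrier (X3 i) \<subseteq> k i ` carrier (K i)" for i using ex(3)[of i] Ki(2)[of i] by simp
  have "\<exists>h. linear_map R (X3 i) (K i) h \<and> (\<forall>w\<in>carrier (X3 i). k i (h w) = f3 i w)" for i
    by (rule linear_factor_inj[OF m(5) l(4) Ki(1) m(2) l(2) im])
  then obtain b where b: "\<And>i. linear_map R (X3 i) (K i) (b i)" "\<And>i w. w \<in> carrier (X3 i) \<Longrightarrow> k i (b i w) = f3 i w"
    by metis
  define a' where "a' i = restrict (a i) (carrier (Q i))" for i
  define b' where "b' i = restrict (b i) (carrier (X3 i))" for i
  have b0: "b i w = \<zero>\<^bsub>K i\<^esub> \<longleftrightarrow> f3 i w = \<zero>\<^bsub>X4 i\<^esub>" if w: "w \<in> carrier (X3 i)" for i w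
  proof -
    have "k i (b i w) = k i \<zero>\<^bsub>K i\<^esub> \<longleftrightarrow> b i w = \<zero>\<^bsub>K i\<^esub>"
      using inj_on_eq_iff[OF Ki(1)] linear_map_closed[OF b(1) w] module_zero_closed[OF m(5)] by blast
    then show ?thesis using b(2)[OF w] linear_map_0[OF m(5,3) l(4)] by simp
  qed
  have "short_exact ?C Q X3 K a' b'"
  proof (rule short_exactI_elementwise)
    show "Q \<in> Obj ?C" "K \<in> Obj ?C" using AO Q(1) K(1) by auto
    show "a' \<in> Mor ?C Q X3" using linear_map_cong[OF a(1) m(4)] by (auto simp: a'_def)
    show "b' \<in> Mor ?C X3 K" using linear_map_cong[OF b(1) m(2)] by (auto simp: b'_def)
    show "inj_on (a' i) (carrier (Q i))" for i
    proof -
      have "inj_on (a i) (carrier (Q i))"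
      proof (rule linear_map_inj[OF m(4,2) a(1)])
        fix q assume q: "q \<in> carrier (Q i)" "a i q = \<zero>\<^bsub>X3 i\<^esub>"
        then obtain y where y: "y \<in> carrier (X2 i)" "q = c i y" using Qi(1)[of i] by blast
        then show "q = \<zero>\<^bsub>Q i\<^esub>" using a(2)[OF y(1)] kc[OF y(1)] q by simp
      qed
      then show ?thesis by (simp add: a'_def)
    qed
    show "b' i ` carrier (X3 i) = carrier (K i)" for i
    proof (intro equalityI subsetI)
      show "x \<in> carrier (K i)" if "x \<in> b' i ` carrier (X3 i)" for x
        using that linear_map_closed[OF b(1)] by (auto simp: b'_def)
      fix x assume x: "x \<in> carrier (K i)"
      then have "k i x \<in> f3 i ` carrier (X3 i)" using ex(3)[of i] Ki(2)[of i] by blast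
      then obtain w where w: "w \<in> carrier (X3 i)" "k i x = f3 i w" by blast
      then have "x = b i w"
        using inj_onD[OF Ki(1), of i x "b i w"] b(2)[OF w(1)] x linear_map_closed[OF b(1) w(1)] by simp
      then show "x \<in> b' i ` carrier (X3 i)" using w by (auto simp: b'_def)
    qed
    show "a' i ` carrier (Q i) = {y \<in> carrier (X3 i). b' i y = \<zero>\<^bsub>K i\<^esub>}" for i
    proof -
      have "a' i ` carrier (Q i) = a i ` (c i ` carrier (X2 i))" using Qi(1)[of i] by (simp add: a'_def)
      also have "\<dots> = f2 i ` carrier (X2 i)" using a(2) by (auto simp: image_iff)
      finally show ?thesis using ex(2)[of i] b0 by (auto simp: b'_def)
    qed
  qed (fact X3)
  then show ?thesis using ec Q(1) K(1) unfolding extension_closed_def by blast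
qed

lemma graded_linear_transfer:
  assumes m: "\<And>i. module R (M i)" "\<And>i. module R (M' i)"
    and t: "\<And>i. linear_map R (M i) (M' i) (t i)" "\<And>i. bij_betw (t i) (carrier (M i)) (carrier (M' i))"
    and t': "\<And>i. linear_map R (N i) (N' i) (t' i)" and g: "\<And>i. linear_map R (M i) (N i) (g i)"
  shows "\<exists>f\<in>Mor (GM \<kappa> R) M' N'. \<forall>i. \<forall>x\<in>carrier (M i). f i (t i x) = t' i (g i x)"
proof (intro bexI allI ballI)
  let ?h = "\<lambda>i. t' i \<circ> g i \<circ> inv_into (carrier (M i)) (t i)"
  have "linear_map R (M' i) (N' i) (?h i)" for i
    using linear_map_comp[OF linear_inverse[OF m t] linear_map_comp[OF g t']] by (simp add: o_assoc)
  then have "linear_map R (M' i) (N' i) (restrict (?h i) (carrier (M' i)))" for i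
    by (rule linear_map_cong[OF _ m(2)]) simp
  then show "(\<lambda>i. restrict (?h i) (carrier (M' i))) \<in> Mor (GM \<kappa> R) M' N'" by simp
  show "restrict (?h i) (carrier (M' i)) (t i x) = t' i (g i x)" if "x \<in> carrier (M i)" for i x
    using that t(2)[of i] linear_map_closed[OF t(1)] by (simp add: bij_betw_def)
qed

lemma exact_transfer:
  assumes m: "module R M2" "module R M3" "module R M3'"
    and b: "bij_betw t1 (carrier M1) (carrier M1')" "bij_betw t2 (carrier M2) (carrier M2')"
      "bij_betw t3 (carrier M3) (carrier M3')" "linear_map R M3 M3' t3"
    and g2: "linear_map R M2 M3 g2"
    and f: "\<And>x. x \<in> carrier M1 \<Longrightarrow> f1 (t1 x) = t2 (g1 x)" "\<And>x. x \<in> carrier M2 \<Longrightarrow> f2 (t2 x) = t3 (g2 x)"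
    and ex: "g1 ` carrier M1 = {x \<in> carrier M2. g2 x = \<zero>\<^bsub>M3\<^esub>}"
  shows "f1 ` carrier M1' = {x \<in> carrier M2'. f2 x = \<zero>\<^bsub>M3'\<^esub>}"
proof -
  have c: "carrier M1' = t1 ` carrier M1" "carrier M2' = t2 ` carrier M2" using b by (auto simp: bij_betw_def)
  have z: "f2 (t2 x) = \<zero>\<^bsub>M3'\<^esub> \<longleftrightarrow> g2 x = \<zero>\<^bsub>M3\<^esub>" if x: "x \<in> carrier M2" for x
  proof -
    have "t3 (g2 x) = t3 \<zero>\<^bsub>M3\<^esub> \<longleftrightarrow> g2 x = \<zero>\<^bsub>M3\<^esub>"
      using b(3) linear_map_closed[OF g2 x] module_zero_closed[OF m(2)] by (intro inj_on_eq_iff) (auto simp: bij_betw_def)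
    then show ?thesis using f(2)[OF x] linear_map_0[OF m(2,3) b(4)] by simp
  qed
  have "f1 ` carrier M1' = t2 ` (g1 ` carrier M1)" unfolding c using f(1) by (auto simp: image_iff)
  also have "\<dots> = {x \<in> carrier M2'. f2 x = \<zero>\<^bsub>M3'\<^esub>}" unfolding ex c using z by auto
  finally show ?thesis .
qed

text \<open>The outer terms have copies in \<open>A\<close>, over \<open>'u\<close>. The middle one
  gets a copy by transport along injections, which exist because its components are small; maps and
  exactness are then carried over along the isomorphisms.\<close>

lemma five_term_closed_iso:
  fixes \<kappa> :: "'u rel" and A :: "('r, 'u) graded_module set" and H3 :: "('r, 'm) graded_module"
  assumes \<kappa>: "smallness_cardinal \<kappa>"
    and A: "exact_abelian_subcategory (GM \<kappa> R) A" and ec: "extension_closed (GM \<kappa> R) A"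
    and m: "\<And>i. module R (H1 i)" "\<And>i. module R (H2 i)" "\<And>i. module R (H3 i)" "\<And>i. module R (H4 i)" "\<And>i. module R (H5 i)"
    and iso: "\<exists>G\<in>A. graded_module_iso R H1 G" "\<exists>G\<in>A. graded_module_iso R H2 G"
      "\<exists>G\<in>A. graded_module_iso R H4 G" "\<exists>G\<in>A. graded_module_iso R H5 G"
    and small: "\<And>i. small \<kappa> (carrier (H3 i))"
    and g: "\<And>i. linear_map R (H1 i) (H2 i) (g1 i)" "\<And>i. linear_map R (H2 i) (H3 i) (g2 i)"
      "\<And>i. linear_map R (H3 i) (H4 i) (g3 i)" "\<And>i. linear_map R (H4 i) (H5 i) (g4 i)"
    and ex: "\<And>i. g1 i ` carrier (H1 i) = {x \<in> carrier (H2 i). g2 i x = \<zero>\<^bsub>H3 i\<^esub>}"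
      "\<And>i. g2 i ` carrier (H2 i) = {x \<in> carrier (H3 i). g3 i x = \<zero>\<^bsub>H4 i\<^esub>}"
      "\<And>i. g3 i ` carrier (H3 i) = {x \<in> carrier (H4 i). g4 i x = \<zero>\<^bsub>H5 i\<^esub>}"
  shows "\<exists>G\<in>A. graded_module_iso R H3 G"
proof -
  let ?C = "GM \<kappa> R"
  have AO: "A \<subseteq> Obj ?C" using A by (simp add: exact_abelian_subcategory_def strictly_full_def)
  obtain X1 X2 X4 X5 where X: "X1 \<in> A" "X2 \<in> A" "X4 \<in> A" "X5 \<in> A"
    and X_iso: "graded_module_iso R H1 X1" "graded_module_iso R H2 X2" "graded_module_iso R H4 X4" "graded_module_iso R H5 X5"
    using iso by blast
  obtain t1 where t1: "\<And>i. linear_map R (H1 i) (X1 i) (t1 i)" "\<And>i. bij_betw (t1 i) (carrier (H1 i)) (carrier (X1 i))"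
    using X_iso(1) unfolding graded_module_iso_def by metis
  obtain t2 where t2: "\<And>i. linear_map R (H2 i) (X2 i) (t2 i)" "\<And>i. bij_betw (t2 i) (carrier (H2 i)) (carrier (X2 i))"
    using X_iso(2) unfolding graded_module_iso_def by metis
  obtain t4 where t4: "\<And>i. linear_map R (H4 i) (X4 i) (t4 i)" "\<And>i. bij_betw (t4 i) (carrier (H4 i)) (carrier (X4 i))"
    using X_iso(3) unfolding graded_module_iso_def by metis
  obtain t5 where t5: "\<And>i. linear_map R (H5 i) (X5 i) (t5 i)" "\<And>i. bij_betw (t5 i) (carrier (H5 i)) (carrier (X5 i))"
    using X_iso(4) unfolding graded_module_iso_def by metis
  have "\<exists>e :: 'm \<Rightarrow> 'u. inj_on e (carrier (H3 i))" for i by (rule small_inj[OF \<kappa> small])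
  then obtain t3 :: "int \<Rightarrow> 'm \<Rightarrow> 'u" where "\<And>i. inj_on (t3 i) (carrier (H3 i))" by metis
  note t = transport_module[OF m(3) this]
  define X3 where "X3 i = transport_module (t3 i) (H3 i)" for i
  have t3: "linear_map R (H3 i) (X3 i) (t3 i)" "bij_betw (t3 i) (carrier (H3 i)) (carrier (X3 i))" for i
    using t(2,3) by (auto simp: X3_def)
  have mX: "\<And>i. module R (X1 i)" "\<And>i. module R (X2 i)" "\<And>i. module R (X3 i)" "\<And>i. module R (X4 i)" "\<And>i. module R (X5 i)"
    using AO X t(1) by (auto simp: X3_def subset_iff)
  have "small \<kappa> (carrier (X3 i))" for i
    using t3(2)[of i] small_image[OF small, of "t3 i" i] by (simp add: bij_betw_def)
  then have X3: "X3 \<in> Obj ?C" using mX by simp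
  obtain f1 where f1: "f1 \<in> Mor ?C X1 X2" "\<forall>i. \<forall>x\<in>carrier (H1 i). f1 i (t1 i x) = t2 i (g1 i x)"
    using graded_linear_transfer[where M=H1 and M'=X1 and N=H2 and N'=X2 and t=t1 and t'=t2 and g=g1 and \<kappa>=\<kappa>,
        OF m(1) mX(1) t1 t2(1) g(1)] by blast
  obtain f2 where f2: "f2 \<in> Mor ?C X2 X3" "\<forall>i. \<forall>x\<in>carrier (H2 i). f2 i (t2 i x) = t3 i (g2 i x)"
    using graded_linear_transfer[where M=H2 and M'=X2 and N=H3 and N'=X3 and t=t2 and t'=t3 and g=g2 and \<kappa>=\<kappa>,
        OF m(2) mX(2) t2 t3(1) g(2)] by blast
  obtain f3 where f3: "f3 \<in> Mor ?C X3 X4" "\<forall>i. \<forall>x\<in>carrier (H3 i). f3 i (t3 i x) = t4 i (g3 i x)"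
    using graded_linear_transfer[where M=H3 and M'=X3 and N=H4 and N'=X4 and t=t3 and t'=t4 and g=g3 and \<kappa>=\<kappa>,
        OF m(3) mX(3) t3 t4(1) g(3)] by blast
  obtain f4 where f4: "f4 \<in> Mor ?C X4 X5" "\<forall>i. \<forall>x\<in>carrier (H4 i). f4 i (t4 i x) = t5 i (g4 i x)"
    using graded_linear_transfer[where M=H4 and M'=X4 and N=H5 and N'=X5 and t=t4 and t'=t5 and g=g4 and \<kappa>=\<kappa>,
        OF m(4) mX(4) t4 t5(1) g(4)] by blast
  have "X3 \<in> A"
    by (rule five_term_closed[OF A ec X X3 f1(1) f2(1) f3(1) f4(1)
        exact_transfer[OF m(2,3) mX(3) t1(2) t2(2) t3(2,1) g(2) f1(2)[rule_format] f2(2)[rule_format] ex(1)]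
        exact_transfer[OF m(3,4) mX(4) t2(2) t3(2) t4(2,1) g(3) f2(2)[rule_format] f3(2)[rule_format] ex(2)]
        exact_transfer[OF m(4,5) mX(5) t3(2) t4(2) t5(2,1) g(4) f3(2)[rule_format] f4(2)[rule_format] ex(3)]])
  moreover have "graded_module_iso R H3 X3" using t3 unfolding graded_module_iso_def by blast
  ultimately show ?thesis by blast
qed

section \<open>Objects with values in an exact abelian subcategory\<close>

lemma Hom_module_simps [simp]:
  "carrier (Hom_module C s X Y) = Mor C X Y" "zero (Hom_module C s X Y) = Zero C X Y"
  "add (Hom_module C s X Y) = add (Hom C X Y)" "smult (Hom_module C s X Y) = s X Y"
  by (simp_all add: Hom_module_def ring.defs module.defs)

context triangulated_category
begin

lemma shift_by_0 [simp]: "shift_by D 0 X = X"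
  by (simp add: shift_by_def)

lemma shift_by_obj [simp, intro]: "X \<in> Obj D \<Longrightarrow> shift_by D n X \<in> Obj D"
proof -
  assume X: "X \<in> Obj D"
  have i: "inv_into (Obj D) S Y \<in> Obj D" if "Y \<in> Obj D" for Y
    using that Shift_bij by (simp add: bij_betw_def inv_into_into)
  have "(S ^^ k) X \<in> Obj D" "(inv_into (Obj D) S ^^ k) X \<in> Obj D" for k
    using X i by (induction k) auto
  then show ?thesis by (simp add: shift_by_def)
qed

lemma shift_by_plus_1: "X \<in> Obj D \<Longrightarrow> shift_by D (n + 1) X = S (shift_by D n X)"
proof (cases "0 \<le> n")
  case True
  then have "nat (n + 1) = Suc (nat n)" by simp
  then show ?thesis using True by (simp add: shift_by_def)
next
  case False
  assume X: "X \<in> Obj D"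
  \<comment> \<open>The number of inverse shifts for \<open>n + 1\<close>, one fewer than for
    \<open>n\<close>.\<close>
  define k where "k = nat (- (n + 1))"
  have n: "n = - int (Suc k)" "n + 1 = - int k" using False by (auto simp: k_def)
  have a: "shift_by D (- int j) X = (inv_into (Obj D) S ^^ j) X" for j
    by (cases "j = 0") (auto simp: shift_by_def)
  have "(inv_into (Obj D) S ^^ k) X \<in> Obj D" using shift_by_obj[OF X, of "- int k"] a by simp
  then have "S (inv_into (Obj D) S ((inv_into (Obj D) S ^^ k) X)) = (inv_into (Obj D) S ^^ k) X"
    using Shift_bij by (simp add: bij_betw_def f_inv_into_f)
  then show ?thesis using a[of k] a[of "Suc k", folded n(1)] unfolding n(2) by simp
qed

lemma Tri_shift_by:
  assumes t: "(X, Y, Z, f, g, h) \<in> Tri D"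
  shows "\<exists>f g h. (shift_by D n X, shift_by D n Y, shift_by D n Z, f, g, h) \<in> Tri D"
proof (induction n rule: int_induct[where k=0])
  case base
  then show ?case using t by auto
next
  case (step1 i)
  then show ?case using Tri_Shift Tri_obj[OF t] by (auto simp: shift_by_plus_1)
next
  case (step2 i)
  note o = Tri_obj[OF t]
  have "\<And>W. W \<in> Obj D \<Longrightarrow> shift_by D i W = S (shift_by D (i - 1) W)" using shift_by_plus_1[of _ "i - 1"] by simp
  then show ?case using step2 Tri_Shift_inverse[of "shift_by D (i - 1) X" "shift_by D (i - 1) Y" "shift_by D (i - 1) Z"] o
    by auto
qed

lemma tsub_shift_by:
  assumes T: "tsub T" and X: "X \<in> T"
  shows "shift_by D n X \<in> T"
proof (induction n rule: int_induct[where k=0])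
  case base
  then show ?case using X by simp
next
  case (step1 i)
  then show ?case using tsub_shift[OF T] tsub_obj[OF T X] by (simp add: shift_by_plus_1)
next
  case (step2 i)
  then show ?case using tsub_shift[OF T, of "shift_by D (i - 1) X"] tsub_obj[OF T X] shift_by_plus_1[of X "i - 1"] by simp
qed

lemma Hom_module: "linear_triangulated R D s \<Longrightarrow> X \<in> Obj D \<Longrightarrow> Y \<in> Obj D \<Longrightarrow> module R (Hom_module D s X Y)"
  by (simp add: linear_triangulated_def)

lemma graded_Hom_module:
  "linear_triangulated R D s \<Longrightarrow> N \<in> Obj D \<Longrightarrow> M \<in> Obj D \<Longrightarrow> module R (graded_Hom D s N M i)"
  by (simp add: graded_Hom_def Hom_module)

lemma precomp_linear:
  assumes "linear_triangulated R D s" "f \<in> Ar X Y" "B \<in> Obj D"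
  shows "linear_map R (Hom_module D s Y B) (Hom_module D s X B) (\<lambda>v. Comp D X Y B v f)"
  using assms Comp_closed Comp_add_left by (intro linear_mapI) (auto simp: linear_triangulated_def Ar_def)

lemma postcomp_linear:
  assumes "linear_triangulated R D s" "f \<in> Ar X Y" "W \<in> Obj D"
  shows "linear_map R (Hom_module D s W X) (Hom_module D s W Y) (\<lambda>v. Comp D W X Y f v)"
  using assms Comp_closed Comp_add_right by (intro linear_mapI) (auto simp: linear_triangulated_def Ar_def)

lemma ShiftM_linear:
  assumes "linear_triangulated R D s" "X \<in> Obj D" "Y \<in> Obj D"
  shows "linear_map R (Hom_module D s X Y) (Hom_module D s (S X) (S Y)) (SM X Y)"
  using assms ShiftM_add SM_Ar[of _ X Y] by (intro linear_mapI) (auto simp: linear_triangulated_def Ar_def)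

abbreviation values_in ::
  "('r, 'q) ring_scheme \<Rightarrow> ('o \<Rightarrow> 'o \<Rightarrow> 'r \<Rightarrow> 'm \<Rightarrow> 'm) \<Rightarrow> 'o set \<Rightarrow> ('r, 'u) graded_module set \<Rightarrow> 'o set"
  where "values_in R s T A \<equiv> objects_with_values_in R D s T A"

text \<open>The test object may change from \<open>M\<close> to another \<open>M'\<close> in
  \<open>T\<close>. This freedom is what the decomposition uses, where \<open>M'\<close> is one of
  the two parts of \<open>M\<close>.\<close>

lemma values_in_transfer:
  assumes "\<And>M. M \<in> T \<Longrightarrow> \<exists>M'\<in>T. graded_module_iso R (graded_Hom D s N' M) (graded_Hom D s N M')"
    and "N \<in> values_in R s T A" "N' \<in> Obj D"
  shows "N' \<in> values_in R s T A"
proof -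
  have "\<exists>G\<in>A. graded_module_iso R (graded_Hom D s N' M) G" if M: "M \<in> T" for M
  proof -
    obtain M' where M': "M' \<in> T" "graded_module_iso R (graded_Hom D s N' M) (graded_Hom D s N M')"
      using assms(1)[OF M] by blast
    obtain G where "G \<in> A" "graded_module_iso R (graded_Hom D s N M') G"
      using assms(2) M'(1) unfolding objects_with_values_in_def by blast
    then show ?thesis using graded_module_iso_trans[OF M'(2)] by blast
  qed
  then show ?thesis using assms(3) unfolding objects_with_values_in_def by blast
qed

lemma values_in_isomorphic:
  assumes lin: "linear_triangulated R D s" and T: "T \<subseteq> Obj D"
    and N: "N \<in> values_in R s T A" "N' \<in> Obj D" "isomorphic D N N'"
  shows "N' \<in> values_in R s T A"
proof (rule values_in_transfer[OF _ N(1,2)])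
  have No: "N \<in> Obj D" using N by (simp add: objects_with_values_in_def)
  obtain v u where v: "v \<in> Ar N' N" "u \<in> Ar N N'" "Comp D N' N N' u v = Id D N'" "Comp D N N' N v u = Id D N"
    using N(2,3) No by (auto simp: isomorphic_def is_iso_Ar)
  fix M assume M: "M \<in> T"
  have "\<exists>f. linear_map R (Hom_module D s W N') (Hom_module D s W N) f \<and>
     bij_betw f (carrier (Hom_module D s W N')) (carrier (Hom_module D s W N))" if W: "W \<in> Obj D" for W
  proof (intro exI conjI)
    show "linear_map R (Hom_module D s W N') (Hom_module D s W N) (\<lambda>x. Comp D W N' N v x)"
      by (rule postcomp_linear[OF lin v(1) W])
    have "bij_betw (\<lambda>x. Comp D W N' N v x) (Ar W N') (Ar W N)"
      by (rule bij_betw_byWitness[where f'="\<lambda>x. Comp D W N N' u x"])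
        (use v assoc[OF _ v(1,2), symmetric] assoc[OF _ v(2,1), symmetric] in auto)
    then show "bij_betw (\<lambda>x. Comp D W N' N v x) (carrier (Hom_module D s W N')) (carrier (Hom_module D s W N))"
      using W No N by (simp add: Ar_Mor)
  qed
  then have "graded_module_iso R (graded_Hom D s N' M) (graded_Hom D s N M)"
    using M T unfolding graded_module_iso_def graded_Hom_def by blast
  then show "\<exists>M'\<in>T. graded_module_iso R (graded_Hom D s N' M) (graded_Hom D s N M')" using M by blast
qed

text \<open>Degree \<open>i + 1\<close> at \<open>N\<close> is taken at \<open>M\<close> shifted by
  \<open>- (i + 1)\<close>; applying the shift functor gives degree \<open>i\<close> at
  \<open>S N\<close>. So shifting \<open>N\<close> amounts to regrading its values.\<close>

lemma graded_Hom_Shift: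
  assumes lin: "linear_triangulated R D s" and o: "N \<in> Obj D" "M \<in> Obj D"
  shows "graded_module_iso R (\<lambda>i. graded_Hom D s N M (i + 1)) (graded_Hom D s (S N) M)"
  unfolding graded_module_iso_def
proof
  fix i
  have "S (shift_by D (- (i + 1)) M) = shift_by D (- i) M"
    using shift_by_plus_1[OF o(2), of "- (i + 1)"] by simp
  moreover have "shift_by D (- (i + 1)) M \<in> Obj D" using o by blast
  ultimately show "\<exists>f. linear_map R (graded_Hom D s N M (i + 1)) (graded_Hom D s (S N) M i) f \<and>
      bij_betw f (carrier (graded_Hom D s N M (i + 1))) (carrier (graded_Hom D s (S N) M i))"
    using ShiftM_linear[OF lin, of "shift_by D (- (i + 1)) M" N] ShiftM_bij[of "shift_by D (- (i + 1)) M" N] o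
    unfolding graded_Hom_def by auto
qed

lemma values_in_Shift:
  fixes \<kappa> :: "'u rel" and A :: "('r, 'u) graded_module set"
  assumes lin: "linear_triangulated R D s" and T: "T \<subseteq> Obj D"
    and A: "A \<subseteq> Obj (GM \<kappa> R)" "shift_stable \<kappa> R A" and N: "N \<in> Obj D"
  shows "S N \<in> values_in R s T A \<longleftrightarrow> N \<in> values_in R s T A"
proof -
  have "(\<exists>G\<in>A. graded_module_iso R (graded_Hom D s (S N) M) G) \<longleftrightarrow>
     (\<exists>G\<in>A. graded_module_iso R (graded_Hom D s N M) G)" if M: "M \<in> T" for M
  proof
    have Mo: "M \<in> Obj D" using M T by blast
    note sh = graded_Hom_Shift[OF lin N Mo]
    note mod = graded_Hom_module[OF lin N Mo] and mod' = graded_Hom_module[OF lin Shift_obj[OF N] Mo]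
    {
      assume "\<exists>G\<in>A. graded_module_iso R (graded_Hom D s N M) G"
      then obtain G where G: "G \<in> A" "graded_module_iso R (graded_Hom D s N M) G" by blast
      have "graded_module_iso R (\<lambda>i. graded_Hom D s N M (i + 1)) (\<lambda>i. G (i + 1))"
        using G(2) unfolding graded_module_iso_def by blast
      then have "graded_module_iso R (graded_Hom D s (S N) M) (\<lambda>i. G (i + 1))"
        using graded_module_iso_trans[OF graded_module_iso_sym[OF _ mod' sh]] mod by blast
      moreover have "(\<lambda>i. G (i + 1)) \<in> A" using A G(1) unfolding shift_stable_def by blast
      ultimately show "\<exists>G\<in>A. graded_module_iso R (graded_Hom D s (S N) M) G" by blast
    }
    assume "\<exists>G\<in>A. graded_module_iso R (graded_Hom D s (S N) M) G"
    then obtain G where G: "G \<in> A" "graded_module_iso R (graded_Hom D s (S N) M) G" by blast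
    have i: "graded_module_iso R (\<lambda>i. graded_Hom D s N M (i + 1)) G" using graded_module_iso_trans[OF sh G(2)] .
    have "\<exists>f. linear_map R (graded_Hom D s N M i) (G (i - 1)) f \<and>
        bij_betw f (carrier (graded_Hom D s N M i)) (carrier (G (i - 1)))" for i
      using i[unfolded graded_module_iso_def, rule_format, of "i - 1"] by simp
    then have "graded_module_iso R (graded_Hom D s N M) (\<lambda>i. G (i - 1))"
      unfolding graded_module_iso_def by blast
    \<comment> \<open>Stability under shifts is an equivalence, applied here at the downward
      regrading of \<open>G\<close>, whose shift is \<open>G\<close> again.\<close>
    moreover have "(\<lambda>i. G (i - 1)) \<in> A"
    proof -
      have "(\<lambda>i. G (i - 1)) \<in> Obj (GM \<kappa> R)" using A(1) G(1) by auto
      then have "(\<lambda>i. G (i - 1)) \<in> A \<longleftrightarrow> (\<lambda>i. G (i + 1 - 1)) \<in> A"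
        by (rule bspec[OF A(2)[unfolded shift_stable_def], of "\<lambda>i. G (i - 1)"])
      then show ?thesis using G(1) by simp
    qed
    ultimately show "\<exists>G\<in>A. graded_module_iso R (graded_Hom D s N M) G" by blast
  qed
  then show ?thesis using N unfolding objects_with_values_in_def by auto
qed

text \<open>In a zero object of \<open>A\<close> the identity is the zero map, so all components are
  trivial modules, as are the values of \<open>N\<close>.\<close>

lemma values_in_zero:
  fixes \<kappa> :: "'u rel" and A :: "('r, 'u) graded_module set"
  assumes lin: "linear_triangulated R D s" and T: "T \<subseteq> Obj D"
    and A: "exact_abelian_subcategory (GM \<kappa> R) A" and N: "zero_object D N"
  shows "N \<in> values_in R s T A"
proof -
  let ?C = "GM \<kappa> R"
  have No: "N \<in> Obj D" using N by (simp add: zero_object_def)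
  interpret A: abelian_category "full_sub ?C A" using A by (simp add: exact_abelian_subcategory_def)
  obtain G where G: "zero_object (full_sub ?C A) G" using A.zero_object_exists by blast
  then have GA: "G \<in> A" by (simp add: zero_object_def)
  have Gm: "module R (G i)" for i
    using A GA by (auto simp: exact_abelian_subcategory_def strictly_full_def subset_iff)
  have IdG: "Id (full_sub ?C A) G = Zero (full_sub ?C A) G G"
    using G A.Id_Ar[of G] GA unfolding A.zero_object_Ar by (metis full_sub_simps(1))
  have "x = \<zero>\<^bsub>G i\<^esub>" if "x \<in> carrier (G i)" for i x
    using fun_cong[OF fun_cong[OF IdG, of i], of x] that by simp
  then have Gc: "carrier (G i) = {\<zero>\<^bsub>G i\<^esub>}" for i using module_zero_closed[OF Gm] by blast
  have "graded_module_iso R (graded_Hom D s N M) G" if M: "M \<in> T" for M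
    unfolding graded_module_iso_def
  proof
    fix i
    let ?H = "graded_Hom D s N M i"
    have Hm: "module R ?H" using graded_Hom_module[OF lin No] M T by blast
    have "shift_by D (- i) M \<in> Obj D" using M T by blast
    then have "carrier ?H = {\<zero>\<^bsub>?H\<^esub>}" using N by (simp add: zero_object_def graded_Hom_def)
    then have "bij_betw (\<lambda>x\<in>carrier ?H. \<zero>\<^bsub>G i\<^esub>) (carrier ?H) (carrier (G i))"
      using Gc by (auto simp: bij_betw_def)
    then show "\<exists>f. linear_map R ?H (G i) f \<and> bij_betw f (carrier ?H) (carrier (G i))"
      using linear_map_zero_map[OF Hm Gm] by blast
  qed
  then show ?thesis using No GA unfolding objects_with_values_in_def by blast
qed

lemma exact_postcomp:
  assumes "g \<in> Ar Y Z" "f \<in> Ar X Y" "W \<in> Obj D" "Comp D X Y Z g f = Zero D X Z"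
    and "\<And>y. y \<in> Ar W Y \<Longrightarrow> Comp D W Y Z g y = Zero D W Z \<Longrightarrow> \<exists>x\<in>Ar W X. Comp D W X Y f x = y"
  shows "(\<lambda>v. Comp D W X Y f v) ` carrier (Hom_module D s W X) =
    {v \<in> carrier (Hom_module D s W Y). Comp D W Y Z g v = \<zero>\<^bsub>Hom_module D s W Z\<^esub>}"
proof -
  have o: "X \<in> Obj D" "Y \<in> Obj D" "Z \<in> Obj D" using assms Ar_obj by auto
  have "Comp D W Y Z g (Comp D W X Y f v) = Zero D W Z" if "v \<in> Ar W X" for v
    using assoc[OF that assms(2,1)] assms(4) that o by simp
  then show ?thesis using assms o by (auto simp: Ar_Mor)
qed

text \<open>The five terms are the values of \<open>X\<close>, \<open>Y\<close>, \<open>Z\<close>,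
  \<open>S X\<close> and \<open>S Y\<close> in the long exact sequence of the triangle. Stability of
  \<open>A\<close> under shifts handles the last two, and local smallness allows the values of
  \<open>Z\<close> to be copied over \<open>'u\<close>.\<close>

lemma values_in_cone:
  fixes \<kappa> :: "'u rel" and A :: "('r, 'u) graded_module set"
  assumes \<kappa>: "smallness_cardinal \<kappa>" and ls: "locally_small \<kappa> D"
    and lin: "linear_triangulated R D s" and T: "T \<subseteq> Obj D"
    and A: "exact_abelian_subcategory (GM \<kappa> R) A" "shift_stable \<kappa> R A"
      "extension_closed (GM \<kappa> R) A"
    and t: "(X, Y, Z, f, g, h) \<in> Tri D"
    and XY: "X \<in> values_in R s T A" "Y \<in> values_in R s T A"
  shows "Z \<in> values_in R s T A"
proof -
  note o = Tri_obj[OF t] and a = Tri_Ar[OF t] and z = Tri_comp_zero[OF t]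
  have AO: "A \<subseteq> Obj (GM \<kappa> R)" using A by (simp add: exact_abelian_subcategory_def strictly_full_def)
  have SXY: "S X \<in> values_in R s T A" "S Y \<in> values_in R s T A"
    using values_in_Shift[OF lin T AO A(2)] XY o by auto
  have "\<exists>G\<in>A. graded_module_iso R (graded_Hom D s Z M) G" if M: "M \<in> T" for M
  proof (rule five_term_closed_iso[OF \<kappa> A(1,3)])
    have Mo: "M \<in> Obj D" using M T by blast
    have Wo: "shift_by D (- i) M \<in> Obj D" for i using Mo by blast
    show "module R (graded_Hom D s X M i)" "module R (graded_Hom D s Y M i)" "module R (graded_Hom D s Z M i)"
      "module R (graded_Hom D s (S X) M i)" "module R (graded_Hom D s (S Y) M i)" for i
      using graded_Hom_module[OF lin _ Mo] o by auto
    show "\<exists>G\<in>A. graded_module_iso R (graded_Hom D s X M) G" "\<exists>G\<in>A. graded_module_iso R (graded_Hom D s Y M) G"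
      "\<exists>G\<in>A. graded_module_iso R (graded_Hom D s (S X) M) G" "\<exists>G\<in>A. graded_module_iso R (graded_Hom D s (S Y) M) G"
      using XY SXY M unfolding objects_with_values_in_def by blast+
    show "small \<kappa> (carrier (graded_Hom D s Z M i))" for i
      using ls Wo o by (simp add: graded_Hom_def locally_small_def)
    show "linear_map R (graded_Hom D s X M i) (graded_Hom D s Y M i) (\<lambda>v. Comp D (shift_by D (- i) M) X Y f v)"
      "linear_map R (graded_Hom D s Y M i) (graded_Hom D s Z M i) (\<lambda>v. Comp D (shift_by D (- i) M) Y Z g v)"
      "linear_map R (graded_Hom D s Z M i) (graded_Hom D s (S X) M i) (\<lambda>v. Comp D (shift_by D (- i) M) Z (S X) h v)"
      "linear_map R (graded_Hom D s (S X) M i) (graded_Hom D s (S Y) M i)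
         (\<lambda>v. Comp D (shift_by D (- i) M) (S X) (S Y) (SM X Y f) v)" for i
      unfolding graded_Hom_def by (rule postcomp_linear[OF lin _ Wo], use a in blast)+
    show "(\<lambda>v. Comp D (shift_by D (- i) M) X Y f v) ` carrier (graded_Hom D s X M i) =
        {v \<in> carrier (graded_Hom D s Y M i). Comp D (shift_by D (- i) M) Y Z g v = \<zero>\<^bsub>graded_Hom D s Z M i\<^esub>}" for i
      unfolding graded_Hom_def by (rule exact_postcomp[OF a(2,1) Wo z(1) Tri_lift[OF t]])
    show "(\<lambda>v. Comp D (shift_by D (- i) M) Y Z g v) ` carrier (graded_Hom D s Y M i) =
        {v \<in> carrier (graded_Hom D s Z M i). Comp D (shift_by D (- i) M) Z (S X) h v = \<zero>\<^bsub>graded_Hom D s (S X) M i\<^esub>}" for i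
      unfolding graded_Hom_def by (rule exact_postcomp[OF a(3,2) Wo z(2) Tri_lift3[OF t]])
    show "(\<lambda>v. Comp D (shift_by D (- i) M) Z (S X) h v) ` carrier (graded_Hom D s Z M i) =
        {v \<in> carrier (graded_Hom D s (S X) M i).
          Comp D (shift_by D (- i) M) (S X) (S Y) (SM X Y f) v = \<zero>\<^bsub>graded_Hom D s (S Y) M i\<^esub>}" for i
      unfolding graded_Hom_def by (rule exact_postcomp[OF SM_Ar[OF a(1)] a(3) Wo z(3) Tri_lift4[OF t]])
  qed
  then show ?thesis using o unfolding objects_with_values_in_def by blast
qed

lemma tsub_values_in:
  fixes \<kappa> :: "'u rel" and A :: "('r, 'u) graded_module set"
  assumes "smallness_cardinal \<kappa>" and "locally_small \<kappa> D"
    and lin: "linear_triangulated R D s" and T: "T \<subseteq> Obj D"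
    and A: "exact_abelian_subcategory (GM \<kappa> R) A" "shift_stable \<kappa> R A"
      "extension_closed (GM \<kappa> R) A"
  shows "tsub (values_in R s T A)"
proof (rule triangulated_subcategoryI)
  have AO: "A \<subseteq> Obj (GM \<kappa> R)" using A by (simp add: exact_abelian_subcategory_def strictly_full_def)
  show "values_in R s T A \<subseteq> Obj D" by (auto simp: objects_with_values_in_def)
  show "S X \<in> values_in R s T A \<longleftrightarrow> X \<in> values_in R s T A" if "X \<in> Obj D" for X
    by (rule values_in_Shift[OF lin T AO A(2) that])
qed (fact values_in_isomorphic[OF lin T] values_in_zero[OF lin T A(1)] values_in_cone[OF assms])+

text \<open>Two shapes occur for a decomposition triangle from \<open>A'\<close> to \<open>N\<close>
  to \<open>B\<close>. The modules \<open>D(M, B)\<close> and \<open>D(L, N)\<close> both map onto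
  \<open>D(L, B)\<close>, a cospan; \<open>D(R, A')\<close> maps onto both \<open>D(M, A')\<close>
  and \<open>D(R, N)\<close>, a span, treated next.\<close>

lemma Hom_module_iso_cospan:
  assumes lin: "linear_triangulated R D s"
    and o: "W1 \<in> Obj D" "Y1 \<in> Obj D" "W2 \<in> Obj D" "Y2 \<in> Obj D" "W3 \<in> Obj D" "Y3 \<in> Obj D"
    and p: "linear_map R (Hom_module D s W1 Y1) (Hom_module D s W3 Y3) p" "bij_betw p (Ar W1 Y1) (Ar W3 Y3)"
    and q: "linear_map R (Hom_module D s W2 Y2) (Hom_module D s W3 Y3) q" "bij_betw q (Ar W2 Y2) (Ar W3 Y3)"
  shows "\<exists>f. linear_map R (Hom_module D s W1 Y1) (Hom_module D s W2 Y2) f \<and>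
    bij_betw f (carrier (Hom_module D s W1 Y1)) (carrier (Hom_module D s W2 Y2))"
proof -
  note m = Hom_module[OF lin o(3,4)] Hom_module[OF lin o(5,6)]
  have b: "bij_betw p (carrier (Hom_module D s W1 Y1)) (carrier (Hom_module D s W3 Y3))"
    "bij_betw q (carrier (Hom_module D s W2 Y2)) (carrier (Hom_module D s W3 Y3))"
    using p(2) q(2) o by (simp_all add: Ar_Mor)
  show ?thesis
    using linear_map_comp[OF p(1) linear_inverse[OF m q(1) b(2)]] bij_betw_trans[OF b(1) bij_betw_inv_into[OF b(2)]] by blast
qed

lemma Hom_module_iso_span:
  assumes lin: "linear_triangulated R D s"
    and o: "W1 \<in> Obj D" "Y1 \<in> Obj D" "W2 \<in> Obj D" "Y2 \<in> Obj D" "W3 \<in> Obj D" "Y3 \<in> Obj D"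
    and p: "linear_map R (Hom_module D s W3 Y3) (Hom_module D s W1 Y1) p" "bij_betw p (Ar W3 Y3) (Ar W1 Y1)"
    and q: "linear_map R (Hom_module D s W3 Y3) (Hom_module D s W2 Y2) q" "bij_betw q (Ar W3 Y3) (Ar W2 Y2)"
  shows "\<exists>f. linear_map R (Hom_module D s W1 Y1) (Hom_module D s W2 Y2) f \<and>
    bij_betw f (carrier (Hom_module D s W1 Y1)) (carrier (Hom_module D s W2 Y2))"
proof -
  note m = Hom_module[OF lin o(5,6)] Hom_module[OF lin o(1,2)]
  have b: "bij_betw p (carrier (Hom_module D s W3 Y3)) (carrier (Hom_module D s W1 Y1))"
    "bij_betw q (carrier (Hom_module D s W3 Y3)) (carrier (Hom_module D s W2 Y2))"
    using p(2) q(2) o by (simp_all add: Ar_Mor)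
  show ?thesis
    using linear_map_comp[OF linear_inverse[OF m p(1) b(1)] q(1)] bij_betw_trans[OF bij_betw_inv_into[OF b(1)] b(2)] by blast
qed

text \<open>Nothing maps from \<open>RO\<close> to \<open>B\<close> nor from \<open>LO\<close> to
  \<open>A'\<close>. Hence maps from \<open>M\<close> to \<open>B\<close> are determined by their
  restriction to \<open>L1\<close>, and maps from \<open>L1\<close> to \<open>B\<close> lift
  uniquely to \<open>N\<close>; dually for \<open>R1\<close> and \<open>A'\<close>. Shifts of the
  triangle of \<open>M\<close> are again decompositions, which gives every degree.\<close>

lemma values_in_decomposition:
  assumes lin: "linear_triangulated R D s" and sod: "sod T (LO, RO)"
    and t: "(A', N, B, f, g, h) \<in> Tri D" and A': "A' \<in> rperp LO" and B: "B \<in> rperp RO"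
    and N: "N \<in> values_in R s T A"
  shows "A' \<in> values_in R s T A" "B \<in> values_in R s T A"
proof -
  note sd = sod[unfolded sod_iff]
  have L: "tsub LO" "LO \<subseteq> T" and R: "tsub RO" "RO \<subseteq> T" using sd by auto
  note LQ = tsub_right_perp[OF L(1)] and RQ = tsub_right_perp[OF R(1)]
  note Lo = tsub_subset[OF L(1)] and Ro = tsub_subset[OF R(1)]
  have orth: "LO \<subseteq> left_perp (rperp LO)" "RO \<subseteq> left_perp (rperp RO)"
    using orthogonal_left_perp[OF Lo tsub_subset[OF LQ]] orthogonal_right_perp[OF Lo tsub_subset[OF LQ]]
      orthogonal_left_perp[OF Ro tsub_subset[OF RQ]] orthogonal_right_perp[OF Ro tsub_subset[OF RQ]] by auto
  note o = Tri_obj[OF t] and a = Tri_Ar[OF t]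
  have dec: "\<exists>L1\<in>LO. \<exists>R1\<in>RO. \<exists>f g h. (L1, M, R1, f, g, h) \<in> Tri D" if "M \<in> T" for M
    using that sd unfolding extensions_def by blast
  show "B \<in> values_in R s T A"
  proof (rule values_in_transfer[OF _ N o(3)])
    fix M assume "M \<in> T"
    then obtain L1 R1 u v w where d: "L1 \<in> LO" "R1 \<in> RO" "(L1, M, R1, u, v, w) \<in> Tri D" using dec by blast
    have "\<exists>f. linear_map R (graded_Hom D s B M i) (graded_Hom D s N L1 i) f \<and>
        bij_betw f (carrier (graded_Hom D s B M i)) (carrier (graded_Hom D s N L1 i))" for i
    proof -
      let ?s = "shift_by D (- i)"
      obtain u v w where st: "(?s L1, ?s M, ?s R1, u, v, w) \<in> Tri D" using Tri_shift_by[OF d(3)] by blast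
      have sLR: "?s L1 \<in> LO" "?s R1 \<in> RO" using tsub_shift_by d(1,2) L(1) R(1) by auto
      note so = Tri_obj[OF st]
      show ?thesis
        unfolding graded_Hom_def
        by (rule Hom_module_iso_cospan[OF lin so(2) o(3) so(1) o(2) so(1) o(3) precomp_linear[OF lin Tri_Ar(1)[OF st] o(3)]
              bij_precomp_first[OF st R(1) orth(2) sLR(2) B o(3)]
              postcomp_linear[OF lin a(2) so(1)] bij_postcomp_second[OF t LQ orth(1) A' sLR(1)]])
    qed
    then have "graded_module_iso R (graded_Hom D s B M) (graded_Hom D s N L1)" unfolding graded_module_iso_def by blast
    then show "\<exists>M'\<in>T. graded_module_iso R (graded_Hom D s B M) (graded_Hom D s N M')" using d(1) L(2) by blast
  qed
  show "A' \<in> values_in R s T A"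
  proof (rule values_in_transfer[OF _ N o(1)])
    fix M assume "M \<in> T"
    then obtain L1 R1 u v w where d: "L1 \<in> LO" "R1 \<in> RO" "(L1, M, R1, u, v, w) \<in> Tri D" using dec by blast
    have "\<exists>f. linear_map R (graded_Hom D s A' M i) (graded_Hom D s N R1 i) f \<and>
        bij_betw f (carrier (graded_Hom D s A' M i)) (carrier (graded_Hom D s N R1 i))" for i
    proof -
      let ?s = "shift_by D (- i)"
      obtain u v w where st: "(?s L1, ?s M, ?s R1, u, v, w) \<in> Tri D" using Tri_shift_by[OF d(3)] by blast
      have sLR: "?s L1 \<in> LO" "?s R1 \<in> RO" using tsub_shift_by d(1,2) L(1) R(1) by auto
      note so = Tri_obj[OF st]
      show ?thesis
        unfolding graded_Hom_def
        by (rule Hom_module_iso_span[OF lin so(2) o(1) so(3) o(2) so(3) o(1) precomp_linear[OF lin Tri_Ar(2)[OF st] o(1)]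
              bij_precomp_second[OF st L(1) orth(1) sLR(1) A' o(1)]
              postcomp_linear[OF lin a(1) so(3)] bij_postcomp_first[OF t RQ orth(2) B sLR(2)]])
    qed
    then have "graded_module_iso R (graded_Hom D s A' M) (graded_Hom D s N R1)" unfolding graded_module_iso_def by blast
    then show "\<exists>M'\<in>T. graded_module_iso R (graded_Hom D s A' M) (graded_Hom D s N M')" using d(2) R(2) by blast
  qed
qed

end

section \<open>Closures, restrictions and assembly of the theorem\<close>

context triangulated_with_coproducts
begin

text \<open>Left orthogonals are localizing, so vanishing can be tested on the generators.\<close>

lemma right_perp_coprod_closure:
  assumes P: "tsub P"
  shows "rperp (Loc P) = rperp P"
proof
  let ?R = "rperp P"
  note Po = tsub_subset[OF P] and R = tsub_right_perp[OF P]
  note Ro = tsub_subset[OF R]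
  have "P \<subseteq> left_perp ?R"
    using orthogonal_left_perp[OF Po Ro] orthogonal_right_perp[OF Po Ro] by blast
  then have "Loc P \<subseteq> left_perp ?R"
    by (intro coprod_closure_least tsub_left_perp R closed_left_perp)
  then show "?R \<subseteq> rperp (Loc P)"
    using orthogonal_left_perp[OF coprod_closure_obj[OF Po] Ro] orthogonal_right_perp[OF coprod_closure_obj[OF Po] Ro]
    by blast
  show "rperp (Loc P) \<subseteq> ?R"
    using coprod_closure_extensive[of P] unfolding right_perp_def by blast
qed

text \<open>Representatives of objects of \<open>P\<close> lie in \<open>P\<close> by closure under
  isomorphism, so intersecting \<open>S0\<close> with \<open>P\<close> suffices.\<close>

lemma essentially_small_subset:
  assumes es: "essentially_small \<kappa> D T" and P: "tsub P" "P \<subseteq> T" and T: "T \<subseteq> Obj D"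
  shows "essentially_small \<kappa> D P"
proof -
  obtain S0 where S0: "S0 \<subseteq> T" "small \<kappa> S0" "\<forall>X\<in>T. \<exists>Y\<in>S0. isomorphic D X Y"
    using es unfolding essentially_small_def by blast
  have "\<exists>Y\<in>S0 \<inter> P. isomorphic D X Y" if X: "X \<in> P" for X
  proof -
    obtain Y where Y: "Y \<in> S0" "isomorphic D X Y" using S0(3) P(2) X by blast
    then have "Y \<in> P" using tsub_iso[OF P(1) X] S0(1) T by blast
    then show ?thesis using Y by blast
  qed
  moreover have "small \<kappa> (S0 \<inter> P)" using S0(2) small_subset by blast
  ultimately show ?thesis unfolding essentially_small_def by blast
qed

text \<open>\<open>P\<close> and \<open>Q\<close> are localizing, so the closures stay inside them
  and inherit their orthogonality. The resulting decomposition of \<open>Loc T\<close> is then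
  compared with the larger pair by maximality.\<close>

lemma sod_restrict_coprod_closure:
  assumes sod: "sod (Obj D) (P, Q)"
    and cl: "closed_coproducts P" "closed_coproducts Q"
    and sod0: "sod T (P \<inter> T, Q \<inter> T)"
  shows "sod (Loc T) (Loc (P \<inter> T), Loc (Q \<inter> T))"
    and "P \<inter> Loc T = Loc (P \<inter> T)"
    and "Q \<inter> Loc T = Loc (Q \<inter> T)"
proof -
  note s = sod[unfolded sod_iff]
  have sub: "Loc (P \<inter> T) \<subseteq> P" "Loc (Q \<inter> T) \<subseteq> Q"
    using s cl coprod_closure_least[of P "P \<inter> T"] coprod_closure_least[of Q "Q \<inter> T"] by auto
  then have "Loc (P \<inter> T) \<subseteq> left_perp (Loc (Q \<inter> T))"
    using s left_perp_antimono by blast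
  from sod_coprod_closure[OF sod0 this]
  show *: "sod (Loc T) (Loc (P \<inter> T), Loc (Q \<inter> T))" .
  show "P \<inter> Loc T = Loc (P \<inter> T)"
    "Q \<inter> Loc T = Loc (Q \<inter> T)"
    using sod_maximal[OF * _ sub(1) _ sub(2)] s by auto
qed

end

theorem theorem3p1p1:
  fixes \<kappa> :: "'u rel"
    and D :: "('o, 'm) tricat"
    and T LO RO :: "'o set"
  assumes "smallness_cardinal \<kappa>"
    and "triangulated_category D"
    and "locally_small \<kappa> D"
    and "has_small_coproducts \<kappa> D"
    and "triangulated_subcategory D T"
    and "\<forall>M\<in>T. compact_object \<kappa> D M"
    and "Obj D = coprod_closure \<kappa> D T"
    and "semiorthogonal_decomposition D T (LO, RO)"
  shows
    "semiorthogonal_decomposition D (Obj D) (couple_coprod \<kappa> D (LO, RO))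
     \<and>
     (essentially_small \<kappa> D T \<longrightarrow>
        semiorthogonal_decomposition D (Obj D) (couple_perp D (Obj D) (LO, RO)) \<and>
        adjacent D (Obj D) (couple_coprod \<kappa> D (LO, RO)) (Obj D) (couple_perp D (Obj D) (LO, RO)) \<and>
        right_perp D (Obj D) LO = coprod_closure \<kappa> D RO)
     \<and>
     (\<forall>T0 LO0 RO0.
        triangulated_subcategory D T0 \<and>
        restricts_to D (couple_perp D (Obj D) (LO, RO)) T0 \<and>
        couple_restrict (couple_perp D (Obj D) (LO, RO)) T0 = (LO0, RO0) \<longrightarrow>
          restricts_to D (couple_perp D (Obj D) (LO, RO)) (coprod_closure \<kappa> D T0) \<and>
          couple_restrict (couple_perp D (Obj D) (LO, RO)) (coprod_closure \<kappa> D T0)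
          = couple_coprod \<kappa> D (LO0, RO0))
     \<and>
     (\<forall>(R :: 'r ring) s (A :: ('r, 'u) graded_module set).
        essentially_small \<kappa> D T \<and>
        cring R \<and>
        linear_triangulated R D s \<and>
        exact_abelian_subcategory (graded_modules \<kappa> R) A \<and>
        shift_stable \<kappa> R A \<longrightarrow>
          (let TA = objects_with_values_in R D s T A in
             (extension_closed (graded_modules \<kappa> R) A \<longrightarrow> triangulated_subcategory D TA) \<and>
             (\<forall>N\<in>TA.
                fst (sod_left_functor D (Obj D) (couple_perp D (Obj D) (LO, RO))) N \<in> TA \<and>
                fst (sod_right_functor D (Obj D) (couple_perp D (Obj D) (LO, RO))) N \<in> TA) \<and>
             (extension_closed (graded_modules \<kappa> R) A \<longrightarrow>
                semiorthogonal_decomposition D TA (couple_perp D TA (LO, RO)))))"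
proof -
  interpret triangulated_with_coproducts D \<kappa>
    using assms(1,2,4) by (simp add: triangulated_with_coproducts_def triangulated_with_coproducts_axioms_def)
  note T = assms(5) and sod = assms(8)
  note s = sod[unfolded sod_iff]
  have To: "T \<subseteq> Obj D" by (rule tsub_subset[OF T])
  have LO: "triangulated_subcategory D LO" "LO \<subseteq> T" "\<forall>M\<in>LO. compact_object \<kappa> D M"
    and RO: "triangulated_subcategory D RO" "RO \<subseteq> T" "\<forall>M\<in>RO. compact_object \<kappa> D M"
    using s assms(6) by auto
  let ?P = "right_perp D (Obj D) LO" and ?Q = "right_perp D (Obj D) RO"
  have sod_coprod: "semiorthogonal_decomposition D (Obj D) (coprod_closure \<kappa> D LO, coprod_closure \<kappa> D RO)"
    using sod_coprod_closure[OF sod orthogonal_coprod_closure[OF LO(1,3) tsub_subset[OF RO(1)]]] s assms(7) by simp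
  \<comment> \<open>Both sides are the right orthogonal of the closure of \<open>LO\<close>: the
    left one because generators suffice for testing, the right one by maximality of the
    decomposition just obtained.\<close>
  have P_eq: "?P = coprod_closure \<kappa> D RO"
    using sod_right_perp[OF sod_coprod] right_perp_coprod_closure[OF LO(1)] by simp
  \<comment> \<open>After rewriting the first half, the couple consists of the closure of the
    compact objects \<open>RO\<close> and their right orthogonal, which is the localization at
    \<open>RO\<close>.\<close>
  have sod_perp: "semiorthogonal_decomposition D (Obj D) (?P, ?Q)" if "essentially_small \<kappa> D T"
    unfolding P_eq by (rule localization_sod[OF assms(3) RO(1,3) essentially_small_subset[OF that RO(1,2) To]])
  have cl: "closed_under_coproducts \<kappa> D ?P" "closed_under_coproducts \<kappa> D ?Q"
    using closed_right_perp LO(3) RO(3) by auto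
  have I3: "restricts_to D (?P, ?Q) (coprod_closure \<kappa> D T0) \<and>
      couple_restrict (?P, ?Q) (coprod_closure \<kappa> D T0) = couple_coprod \<kappa> D (LO0, RO0)"
    if "restricts_to D (?P, ?Q) T0" and "couple_restrict (?P, ?Q) T0 = (LO0, RO0)" for T0 LO0 RO0
  proof -
    have e: "LO0 = ?P \<inter> T0" "RO0 = ?Q \<inter> T0" using that(2) by (auto simp: couple_restrict_def)
    have s0: "semiorthogonal_decomposition D (Obj D) (?P, ?Q)" "semiorthogonal_decomposition D T0 (?P \<inter> T0, ?Q \<inter> T0)"
      using that(1) by (auto simp: restricts_to_def couple_restrict_def)
    note r = sod_restrict_coprod_closure[OF s0(1) cl s0(2)]
    then show ?thesis using s0(1) r(1)[unfolded sod_iff]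
      by (auto simp: restricts_to_def couple_restrict_def couple_coprod_def e)
  qed
  have II: "let TA = objects_with_values_in R D s T A in
       (extension_closed (graded_modules \<kappa> R) A \<longrightarrow> triangulated_subcategory D TA) \<and>
       (\<forall>N\<in>TA. fst (sod_left_functor D (Obj D) (?P, ?Q)) N \<in> TA \<and>
                fst (sod_right_functor D (Obj D) (?P, ?Q)) N \<in> TA) \<and>
       (extension_closed (graded_modules \<kappa> R) A \<longrightarrow>
                semiorthogonal_decomposition D TA (couple_perp D TA (LO, RO)))"
    if es: "essentially_small \<kappa> D T" and lin: "linear_triangulated R D s"
      and A: "exact_abelian_subcategory (graded_modules \<kappa> R) A" "shift_stable \<kappa> R A"
    for R :: "'r ring" and s and A :: "('r, 'u) graded_module set"
  proof -
    let ?TA = "objects_with_values_in R D s T A"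
    note sp = sod_perp[OF es]
    note sp' = sp[unfolded sod_iff]
    have TAo: "?TA \<subseteq> Obj D" by (auto simp: objects_with_values_in_def)
    have dec: "\<exists>L\<in>?P. \<exists>B\<in>?Q. \<exists>f g h. (L, N, B, f, g, h) \<in> Tri D" if "N \<in> Obj D" for N
      using sp' that unfolding extensions_def by blast
    have tri: "triangulated_subcategory D ?TA" if "extension_closed (graded_modules \<kappa> R) A"
      by (rule tsub_values_in[OF assms(1,3) lin To A that])
    \<comment> \<open>The chosen adjoints return the outer terms of the triangle only up to
      isomorphism, so closure of \<open>?TA\<close> under isomorphism completes the
      argument.\<close>
    have functors: "fst (sod_left_functor D (Obj D) (?P, ?Q)) N \<in> ?TA \<and> fst (sod_right_functor D (Obj D) (?P, ?Q)) N \<in> ?TA"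
      if N: "N \<in> ?TA" for N
    proof -
      obtain L B f g h where t: "L \<in> ?P" "B \<in> ?Q" "(L, N, B, f, g, h) \<in> Tri D" using dec TAo N by blast
      note v = values_in_decomposition[OF lin sod t(3,1,2) N]
      show ?thesis
        using sod_left_functor_value[OF sp t(3,1,2)] sod_right_functor_value[OF sp t(3,1,2)]
          values_in_isomorphic[OF lin To v(1)] values_in_isomorphic[OF lin To v(2)] by blast
    qed
    \<comment> \<open>The ambient triangle of \<open>N\<close> already has its outer terms in
      \<open>?TA\<close>; orthogonality is inherited, and both halves are intersections of
      triangulated subcategories.\<close>
    have sod_TA: "semiorthogonal_decomposition D ?TA (couple_perp D ?TA (LO, RO))"
      if ec: "extension_closed (graded_modules \<kappa> R) A"
    proof -
      have "\<exists>L\<in>?P \<inter> ?TA. \<exists>B\<in>?Q \<inter> ?TA. \<exists>f g h. (L, N, B, f, g, h) \<in> Tri D" if N: "N \<in> ?TA" for N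
      proof -
        obtain L B f g h where t: "L \<in> ?P" "B \<in> ?Q" "(L, N, B, f, g, h) \<in> Tri D" using dec TAo N by blast
        then show ?thesis using values_in_decomposition[OF lin sod t(3,1,2) N] by blast
      qed
      then have "?TA \<subseteq> extensions (?P \<inter> ?TA) (?Q \<inter> ?TA)" unfolding extensions_def by blast
      moreover have "?P \<inter> ?TA \<subseteq> left_perp (?Q \<inter> ?TA)"
        using sp' left_perp_antimono[of "?Q \<inter> ?TA" ?Q] by blast
      ultimately show ?thesis
        unfolding couple_perp_def fst_conv snd_conv right_perp_Int[OF TAo] sod_iff
        using tri[OF ec] sp' tsub_Int by blast
    qed
    show ?thesis unfolding Let_def using tri functors sod_TA by blast
  qed
  \<comment> \<open>Adjacency asks for the orthogonals of the closures, which agree with the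
    orthogonals of \<open>LO\<close> and \<open>RO\<close> themselves.\<close>
  have adj: "adjacent D (Obj D) (couple_coprod \<kappa> D (LO, RO)) (Obj D) (?P, ?Q)" if "essentially_small \<kappa> D T"
    using sod_coprod sod_perp[OF that] tsub_Obj right_perp_coprod_closure[OF LO(1)] right_perp_coprod_closure[OF RO(1)]
    by (simp add: adjacent_def couple_coprod_def couple_perp_def)
  have cp: "couple_perp D (Obj D) (LO, RO) = (?P, ?Q)" by (simp add: couple_perp_def)
  show ?thesis
    unfolding cp using sod_coprod sod_perp adj P_eq I3 II
    by (intro conjI impI allI) (auto simp: couple_coprod_def)
qed

end
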